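(* Let $\alpha>n$ and let $h:(0,\infty)\to\mathbb{R}$ be $C^1$, convex and bounded below, with $h(\delta)=\delta h(\delta^{-1})$ for all $\delta>0$ and $h'(1)=-n$. For $A\in M^{n\times n}_+$ with singular values $v_1,\dots,v_n$ set $$\Psi(A)=\sum_{i=1}^n v_i^{\alpha}+(\det A)\sum_{i=1}^n v_i^{-\alpha}+h(\det A),$$ and let $$\psi(c,d,A)=\Psi(A)+(1+\det A)|c-d|^2,\qquad c,d\in\mathbb{R}^m,\ A\in M^{n\times n}_+.$$ Let $\Omega_1\subset\mathbb{R}^n$ be a bounded Lipschitz domain, let $\lambda>0$, and let $P_1=(\Omega_1,c_1)$ and $P_2=(\Omega_2,c_2)$ be images related by the uniform magnification $\lambda$, i.e. $\Omega_2=\lambda\Omega_1$ and $c_2(\lambda x)=c_1(x)$ for $x\in\Omega_1$. Then for every orientation-preserving invertible $y$ with $y(\Omega_1)=\lambda\Omega_1$, $$I_{P_1,P_2}(y)=\int_{\Omega_1}\psi(c_1(x),c_2(y(x)),Dy(x))\,dx\geq\int_{\Omega_1}\Psi(\lambda\mathbf{1})\,dx=I_{P_1,P_2}(\lambda\,\cdot),$$ so that $y(x)=\lambda x$ is a minimizer of $I_{P_1,P_2}$. Moreover, equality holds only if $y(x)=a+\lambda Rx$ for some $a\in\mathbb{R}^n$ and $R\in SO(n)$ with $a+\lambda R\Omega_1=\lambda\Omega_1$. In particular, if $\Omega_1$ is such that $a+\lambda R\Omega_1=\lambda\Omega_1$ with $a\in\mathbb{R}^n$, $R\in SO(n)$ implies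 $a=0$ and $R=\mathbf{1}$, then $y(x)=\lambda x$ is the unique minimizer.
   Context: $M^{n\times n}_+$ denotes the set of real $n\times n$ matrices with positive determinant, $\mathbf{1}$ is the identity matrix, and the singular values of $A$ are the eigenvalues of $\sqrt{A^TA}$. An image is a pair $P=(\Omega,c)$ with $\Omega\subset\mathbb{R}^n$ a bounded Lipschitz domain and $c:\Omega\to\mathbb{R}^m$ an intensity map, here assumed to be in $L^\infty$. $Dy$ is the distributional gradient. An orientation-preserving invertible map $y$ with $y(\Omega_1)=\Omega_2$ means a homeomorphism $y:\Omega_1\to\Omega_2$ with $y\in W^{1,p}(\Omega_1,\mathbb{R}^n)$ and $y^{-1}\in W^{1,p}(\Omega_2,\mathbb{R}^n)$ for some fixed exponent $p>n$, and $\det Dy(x)>0$ for a.e. $x\in\Omega_1$. No boundary values are prescribed on $\partial\Omega_1$. The integral may take the value $+\infty$. *)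

theory Defs
  imports "HOL-Analysis.Analysis" "HOL-Computational_Algebra.Polynomial"
begin

section \<open>Singular values\<close>

definition psd_sqrt :: "real^'n^'n \<Rightarrow> real^'n^'n" where
  "psd_sqrt M = (THE S. transpose S = S \<and> (\<forall>x. 0 \<le> x \<bullet> (S *v x)) \<and> S ** S = M)"

definition char_polynomial :: "real^'n^'n \<Rightarrow> real poly" where
  "char_polynomial A = det (\<chi> i j. (if i = j then [:0, 1:] else 0) - [:A $ i $ j:])"

text \<open>Real eigenvalues, counted with algebraic multiplicity.\<close>

definition eigenvalues :: "real^'n^'n \<Rightarrow> real multiset" where
  "eigenvalues A = proots (char_polynomial A)"

definition singular_values :: "real^'n^'n \<Rightarrow> real multiset" where
  "singular_values A = eigenvalues (psd_sqrt (transpose A ** A))"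

section \<open>Bounded Lipschitz domains\<close>

text \<open>Near each boundary point the domain is the strict epigraph of a Lipschitz function in
  suitable Cartesian coordinates: the unit vector \<open>e\<close> is the direction of the last coordinate axis,
  and the remaining coordinates of \<open>x\<close> are encoded by its orthogonal projection
  \<open>x - (x \<bullet> e) *\<^sub>R e\<close> onto the hyperplane orthogonal to \<open>e\<close>.\<close>

definition lipschitz_boundary :: "(real^'n) set \<Rightarrow> bool" where
  "lipschitz_boundary \<Omega> \<longleftrightarrow>
     (\<forall>z\<in>frontier \<Omega>. \<exists>r>0. \<exists>e \<gamma> L. norm e = 1 \<and> L-lipschitz_on {w. w \<bullet> e = 0} \<gamma> \<and>
        \<Omega> \<inter> ball z r = {x \<in> ball z r. \<gamma> (x - (x \<bullet> e) *\<^sub>R e) < x \<bullet> e})"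

definition bounded_lipschitz_domain :: "(real^'n) set \<Rightarrow> bool" where
  "bounded_lipschitz_domain \<Omega> \<longleftrightarrow>
     open \<Omega> \<and> connected \<Omega> \<and> \<Omega> \<noteq> {} \<and> bounded \<Omega> \<and> lipschitz_boundary \<Omega>"

section \<open>Lebesgue and Sobolev spaces\<close>

definition in_Linf :: "(real^'n) set \<Rightarrow> (real^'n \<Rightarrow> 'b::euclidean_space) \<Rightarrow> bool" where
  "in_Linf \<Omega> f \<longleftrightarrow> f \<in> borel_measurable (lebesgue_on \<Omega>) \<and>
     (\<exists>B. AE x in lebesgue_on \<Omega>. norm (f x) \<le> B)"

definition in_Lp :: "real \<Rightarrow> (real^'n) set \<Rightarrow> (real^'n \<Rightarrow> 'b::euclidean_space) \<Rightarrow> bool" where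
  "in_Lp p \<Omega> f \<longleftrightarrow> f \<in> borel_measurable (lebesgue_on \<Omega>) \<and>
     integrable (lebesgue_on \<Omega>) (\<lambda>x. norm (f x) powr p)"

definition locally_integrable :: "(real^'n) set \<Rightarrow> (real^'n \<Rightarrow> 'b::euclidean_space) \<Rightarrow> bool" where
  "locally_integrable \<Omega> f \<longleftrightarrow> (\<forall>K. compact K \<and> K \<subseteq> \<Omega> \<longrightarrow> integrable (lebesgue_on K) f)"

definition partial_deriv :: "'n::finite \<Rightarrow> (real^'n \<Rightarrow> real) \<Rightarrow> real^'n \<Rightarrow> real" where
  "partial_deriv j f x = frechet_derivative f (at x) (axis j 1)"

fun times_differentiable :: "nat \<Rightarrow> (real^'n \<Rightarrow> real) \<Rightarrow> bool" where
  "times_differentiable 0 f \<longleftrightarrow> True"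
| "times_differentiable (Suc k) f \<longleftrightarrow>
     (\<forall>x. f differentiable (at x)) \<and> (\<forall>j. times_differentiable k (partial_deriv j f))"

text \<open>The space of smooth functions with compact support in \<open>\<Omega>\<close>. Being \<open>k\<close> times differentiable
  for every \<open>k\<close> makes all iterated partial derivatives continuous.\<close>

definition test_function :: "(real^'n) set \<Rightarrow> (real^'n \<Rightarrow> real) \<Rightarrow> bool" where
  "test_function \<Omega> \<phi> \<longleftrightarrow> (\<forall>k. times_differentiable k \<phi>) \<and>
     compact (closure {x. \<phi> x \<noteq> 0}) \<and> closure {x. \<phi> x \<noteq> 0} \<subseteq> \<Omega>"

definition has_weak_gradient ::
    "(real^'n) set \<Rightarrow> (real^'n \<Rightarrow> real^'k) \<Rightarrow> (real^'n \<Rightarrow> real^'n^'k) \<Rightarrow> bool" where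
  "has_weak_gradient \<Omega> y G \<longleftrightarrow> locally_integrable \<Omega> y \<and> locally_integrable \<Omega> G \<and>
     (\<forall>\<phi> i j. test_function \<Omega> \<phi> \<longrightarrow>
        (LINT x|lebesgue_on \<Omega>. y x $ i * partial_deriv j \<phi> x) =
        - (LINT x|lebesgue_on \<Omega>. G x $ i $ j * \<phi> x))"

text \<open>A representative of the distributional gradient; it is unique up to null sets of \<open>\<Omega>\<close>.\<close>

definition weak_gradient :: "(real^'n) set \<Rightarrow> (real^'n \<Rightarrow> real^'k) \<Rightarrow> real^'n \<Rightarrow> real^'n^'k" where
  "weak_gradient \<Omega> y = (SOME G. has_weak_gradient \<Omega> y G)"

definition in_W1p :: "real \<Rightarrow> (real^'n) set \<Rightarrow> (real^'n \<Rightarrow> real^'k) \<Rightarrow> bool" where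
  "in_W1p p \<Omega> y \<longleftrightarrow> in_Lp p \<Omega> y \<and> (\<exists>G. has_weak_gradient \<Omega> y G \<and> in_Lp p \<Omega> G)"

section \<open>Images, admissible maps and the functional\<close>

type_synonym ('n, 'm) image = "(real^'n) set \<times> (real^'n \<Rightarrow> real^'m)"

definition is_image :: "('n::finite, 'm::finite) image \<Rightarrow> bool" where
  "is_image P \<longleftrightarrow> bounded_lipschitz_domain (fst P) \<and> in_Linf (fst P) (snd P)"

definition magnification_related ::
    "real \<Rightarrow> ('n::finite, 'm::finite) image \<Rightarrow> ('n, 'm) image \<Rightarrow> bool" where
  "magnification_related l P1 P2 \<longleftrightarrow>
     fst P2 = (\<lambda>x. l *\<^sub>R x) ` fst P1 \<and> (\<forall>x\<in>fst P1. snd P2 (l *\<^sub>R x) = snd P1 x)"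

definition orientation_preserving_invertible ::
    "real \<Rightarrow> (real^'n) set \<Rightarrow> (real^'n) set \<Rightarrow> (real^'n \<Rightarrow> real^'n) \<Rightarrow> bool" where
  "orientation_preserving_invertible p \<Omega>1 \<Omega>2 y \<longleftrightarrow>
     (\<exists>z. homeomorphism \<Omega>1 \<Omega>2 y z \<and> in_W1p p \<Omega>1 y \<and> in_W1p p \<Omega>2 z) \<and>
     (AE x in lebesgue_on \<Omega>1. det (weak_gradient \<Omega>1 y x) > 0)"

text \<open>Extended Lebesgue integral, equal to \<open>\<infinity>\<close> when the positive part is not integrable.
  Negative values are truncated to \<open>0\<close> by \<open>ennreal\<close>, so the two terms are the integrals of the
  positive and of the negative part.\<close>

definition ext_integral :: "'a measure \<Rightarrow> ('a \<Rightarrow> real) \<Rightarrow> ereal" where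
  "ext_integral M f =
     enn2ereal (\<integral>\<^sup>+ x. ennreal (f x) \<partial>M) - enn2ereal (\<integral>\<^sup>+ x. ennreal (- f x) \<partial>M)"

definition energy ::
    "(real^'m \<Rightarrow> real^'m \<Rightarrow> real^'n^'n \<Rightarrow> real) \<Rightarrow> ('n::finite, 'm::finite) image \<Rightarrow>
     ('n, 'm) image \<Rightarrow> (real^'n \<Rightarrow> real^'n) \<Rightarrow> ereal" where
  "energy \<psi> P1 P2 y = ext_integral (lebesgue_on (fst P1))
     (\<lambda>x. \<psi> (snd P1 x) (snd P2 (y x)) (weak_gradient (fst P1) y x))"

definition is_minimizer ::
    "(real^'m \<Rightarrow> real^'m \<Rightarrow> real^'n^'n \<Rightarrow> real) \<Rightarrow> real \<Rightarrow> ('n::finite, 'm::finite) image \<Rightarrow>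
     ('n, 'm) image \<Rightarrow> (real^'n \<Rightarrow> real^'n) \<Rightarrow> bool" where
  "is_minimizer \<psi> p P1 P2 y \<longleftrightarrow> orientation_preserving_invertible p (fst P1) (fst P2) y \<and>
     (\<forall>z. orientation_preserving_invertible p (fst P1) (fst P2) z \<longrightarrow>
        energy \<psi> P1 P2 y \<le> energy \<psi> P1 P2 z)"

definition Psi :: "real \<Rightarrow> (real \<Rightarrow> real) \<Rightarrow> real^'n^'n \<Rightarrow> real" where
  "Psi \<alpha> h A = (\<Sum>v\<in>#singular_values A. v powr \<alpha>)
     + det A * (\<Sum>v\<in>#singular_values A. v powr (- \<alpha>)) + h (det A)"

definition psi :: "real \<Rightarrow> (real \<Rightarrow> real) \<Rightarrow> real^'m \<Rightarrow> real^'m \<Rightarrow> real^'n^'n \<Rightarrow> real" where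
  "psi \<alpha> h c d A = Psi \<alpha> h A + (1 + det A) * (norm (c - d))\<^sup>2"

end

theory Submission
  imports Defs
begin

text \<open>Arithmetic-geometric mean gives \<open>\<Psi> A \<ge> H (det A)\<close> with the convex function
  \<open>H d = n (d\<^sup>\<alpha>\<^sup>/\<^sup>n + d\<^sup>1\<^sup>-\<^sup>\<alpha>\<^sup>/\<^sup>n) + h d\<close>, and \<open>\<Psi> (\<lambda> 1) = H (\<lambda>\<^sup>n)\<close>. By the area formula \<open>det Dy\<close>
  integrates to \<open>|\<Omega>2| = \<lambda>\<^sup>n |\<Omega>1|\<close>, so the tangent of \<open>H\<close> at \<open>\<lambda>\<^sup>n\<close> integrates to the value of the
  energy at \<open>\<lambda> x\<close>, and the remainder of the convexity inequalities forces \<open>Dy / \<lambda> \<in> SO(n)\<close> almost everywhere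
  in the case of equality.

  The area formula needs differentiability almost everywhere and Lusin's condition (N). Both follow from
  Morrey's inequality, obtained here without mollification: averages of \<open>y\<close> against product bump
  kernels on nested cubes are compared by changing the kernel in one coordinate at a time, the
  difference of two one-dimensional bumps being the derivative of a compactly supported function.

  When \<open>Dy / \<lambda> \<in> SO(n)\<close>, \<open>y\<close> is locally \<open>\<lambda>\<close>-Lipschitz and multiplies volumes by \<open>\<lambda>\<^sup>n\<close>. If the images of two points came
  closer than \<open>\<lambda>\<close> times their distance, the disjoint images of the two touching balls around these points
  would fill two overlapping balls. So \<open>y\<close> is locally \<open>\<lambda>\<close> times an isometry, hence affine, and globally so by
  connectedness. No regularity theory is involved.\<close>

section \<open>Smooth bump functions\<close>

text \<open>The slope of \<open>H\<close> at \<lambda>^n vanishes for \<lambda> = 1, since h'(1) =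
  -n, and by convexity it is negative for \<lambda> < 1 and positive for \<lambda> > 1. An
  inequality for the integral of det Dy would therefore not do: its exact value is needed. Change of
  variables off the null set of non-differentiability only shows that the integral is at most
  |\<Omega>2|; condition (N) excludes a loss. The hypothesis \<alpha> > n makes d^(\<alpha>/n)
  strictly convex and the exponent 1 - \<alpha>/n negative. Strictness is taken from d^(\<alpha>/n)
  and from the equality case of the AM-GM inequality for the eigenvalues of A^T A. The hypothesis p
  > n turns the increments over cubes of side r/2^k into a geometric series with ratio 2^(n/p - 1).
  Equality of energies is read off from a bounded measurable remainder, because the singular values
  enter only through a pointwise inequality. The distributional gradient is an arbitrary
  representative, so facts about it are transferred to an L^p representative by uniqueness of weak
  gradients.\<close>

text \<open>The derivative is a witness, in the same recursive pattern as
  \<open>times_differentiable\<close>; closure properties become inductions on \<open>k\<close> with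
  the function kept arbitrary.\<close>

primrec smooth1 :: "nat \<Rightarrow> (real \<Rightarrow> real) \<Rightarrow> bool" where
  "smooth1 0 g \<longleftrightarrow> True"
| "smooth1 (Suc k) g \<longleftrightarrow> (\<exists>g'. (\<forall>t. (g has_real_derivative g' t) (at t)) \<and> smooth1 k g')"

lemma smooth1_SucD: "smooth1 (Suc k) g \<Longrightarrow> smooth1 k g"
proof (induction k arbitrary: g)
  case (Suc k)
  then obtain g' where g': "\<And>t. (g has_real_derivative g' t) (at t)" "smooth1 (Suc k) g'"
    by (auto simp del: smooth1.simps simp: smooth1.simps(2)[of "Suc k" g])
  from Suc.IH[OF g'(2)] g'(1) show ?case by auto
qed simp

lemma smooth1_const: "smooth1 k (\<lambda>t. c)"
proof (induction k arbitrary: c)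
  case (Suc k)
  have "\<forall>t. ((\<lambda>t. c) has_real_derivative (\<lambda>t. 0) t) (at t)" by auto
  with Suc[of 0] show ?case by (auto simp: exI[of _ "\<lambda>t. 0"])
qed simp

lemma smooth1_diff: "smooth1 k f \<Longrightarrow> smooth1 k g \<Longrightarrow> smooth1 k (\<lambda>t. f t - g t)"
proof (induction k arbitrary: f g)
  case (Suc k)
  then obtain f' g' where *: "\<And>t. (f has_real_derivative f' t) (at t)" "smooth1 k f'"
     "\<And>t. (g has_real_derivative g' t) (at t)" "smooth1 k g'" by auto
  have "\<forall>t. ((\<lambda>t. f t - g t) has_real_derivative f' t - g' t) (at t)"
    using * by (auto intro!: derivative_eq_intros)
  then show ?case using Suc.IH[OF *(2,4)] 
    by (auto intro!: exI[of _ "\<lambda>t. f' t - g' t"])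
qed simp

lemma smooth1_add: "smooth1 k f \<Longrightarrow> smooth1 k g \<Longrightarrow> smooth1 k (\<lambda>t. f t + g t)"
proof (induction k arbitrary: f g)
  case (Suc k)
  then obtain f' g' where *: "\<And>t. (f has_real_derivative f' t) (at t)" "smooth1 k f'"
     "\<And>t. (g has_real_derivative g' t) (at t)" "smooth1 k g'" by auto
  have "\<forall>t. ((\<lambda>t. f t + g t) has_real_derivative f' t + g' t) (at t)"
    using * by (auto intro!: derivative_eq_intros)
  then show ?case using Suc.IH[OF *(2,4)] 
    by (auto intro!: exI[of _ "\<lambda>t. f' t + g' t"])
qed simp

lemma smooth1_mult: "smooth1 k f \<Longrightarrow> smooth1 k g \<Longrightarrow> smooth1 k (\<lambda>t. f t * g t)"
proof (induction k arbitrary: f g)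
  case (Suc k)
  then obtain f' g' where *: "\<And>t. (f has_real_derivative f' t) (at t)" "smooth1 k f'"
     "\<And>t. (g has_real_derivative g' t) (at t)" "smooth1 k g'" by auto
  have fg: "smooth1 k f" "smooth1 k g"
    using Suc.prems smooth1_SucD by blast+
  have "\<forall>t. ((\<lambda>t. f t * g t) has_real_derivative f' t * g t + f t * g' t) (at t)"
    using * by (auto intro!: derivative_eq_intros)
  then show ?case using smooth1_add[OF Suc.IH[OF *(2) fg(2)] Suc.IH[OF fg(1) *(4)]]
    by (auto intro!: exI[of _ "\<lambda>t. f' t * g t + f t * g' t"])
qed simp

lemma smooth1_affine: "smooth1 k f \<Longrightarrow> smooth1 k (\<lambda>t. f (c * t + d))"
proof (induction k arbitrary: f)
  case (Suc k)
  then obtain f' where *: "\<And>t. (f has_real_derivative f' t) (at t)" "smooth1 k f'" by auto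
  have "\<forall>t. ((\<lambda>t. f (c * t + d)) has_real_derivative f' (c * t + d) * c) (at t)"
    by (auto intro!: derivative_eq_intros DERIV_chain2[OF *(1)])
  then show ?case using smooth1_mult[OF Suc.IH[OF *(2)] smooth1_const[of k c]] 
    by (auto intro!: exI[of _ "\<lambda>t. f' (c * t + d) * c"])
qed simp

text \<open>The family of functions \<open>P(1/t) exp(-1/t)\<close> is closed under differentiation.\<close>

definition flat :: "real poly \<Rightarrow> real \<Rightarrow> real" where
  "flat P t = (if t \<le> 0 then 0 else poly P (1/t) * exp (- (1/t)))"

lemma poly_exp_tendsto_0: "((\<lambda>x::real. poly P x * exp (- x)) \<longlongrightarrow> 0) at_top"
proof -
  have "((\<lambda>x::real. \<Sum>i\<le>degree P. coeff P i * (x ^ i / exp x)) \<longlongrightarrow> (\<Sum>i\<le>degree P. coeff P i * 0)) at_top"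
    by (intro tendsto_intros tendsto_power_div_exp_0)
  moreover have "(\<lambda>x::real. \<Sum>i\<le>degree P. coeff P i * (x ^ i / exp x)) = (\<lambda>x. poly P x * exp (- x))"
    by (auto simp: poly_altdef sum_distrib_right exp_minus divide_inverse mult.assoc)
  ultimately show ?thesis by simp
qed

text \<open>The chain rule produces the factor 1/t^2, which is the polynomial
  \<open>[:0,0,1:]\<close> at 1/t, and the two terms of the product rule combine to
  \<open>P - pderiv P\<close>. At 0 both one-sided difference quotients tend to 0.\<close>

lemma flat_has_derivative:
  "(flat P has_real_derivative flat ([:0,0,1:] * (P - pderiv P)) t) (at t)"
proof -
  consider "t < 0" | "t = 0" | "t > 0" by linarith
  then show ?thesis
  proof cases
    case 1
    have "((\<lambda>t. 0) has_real_derivative 0) (at t)" by simp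
    moreover have "\<forall>\<^sub>F s in nhds t. flat P s = 0"
      using 1 by (auto simp: flat_def eventually_nhds intro!: exI[of _ "{..<0}"])
    ultimately have "(flat P has_real_derivative 0) (at t)"
      by (subst DERIV_cong_ev[OF refl _ refl, of _ "\<lambda>t. 0"])
    then show ?thesis using 1 by (simp add: flat_def)
  next
    case 3
    have "((\<lambda>t. poly P (1/t) * exp (- (1/t))) has_real_derivative
        (poly (pderiv P) (1/t) * (- 1 / t^2) * exp (- (1/t)) + poly P (1/t) * (exp (- (1/t)) * (1 / t^2)))) (at t)"
      using 3 by (auto intro!: derivative_eq_intros DERIV_chain2[OF poly_DERIV] simp: power2_eq_square)
    moreover have "\<forall>\<^sub>F s in nhds t. flat P s = poly P (1/s) * exp (- (1/s))"
      using 3 by (auto simp: flat_def eventually_nhds intro!: exI[of _ "{0<..}"])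
    ultimately have "(flat P has_real_derivative
        (poly (pderiv P) (1/t) * (- 1 / t^2) * exp (- (1/t)) + poly P (1/t) * (exp (- (1/t)) * (1 / t^2)))) (at t)"
      by (subst DERIV_cong_ev[OF refl _ refl])
    moreover have "poly (pderiv P) (1/t) * (- 1 / t^2) * exp (- (1/t)) + poly P (1/t) * (exp (- (1/t)) * (1 / t^2))
       = flat ([:0,0,1:] * (P - pderiv P)) t"
      using 3 by (simp add: flat_def algebra_simps power2_eq_square)
    ultimately show ?thesis by simp
  next
    case 2
    have r: "((\<lambda>s. (flat P s) / s) \<longlongrightarrow> 0) (at_right 0)"
    proof -
      \<comment> \<open>Dividing by \<open>s\<close> multiplies \<open>P\<close> by its variable, so
        the quotient is again a polynomial times exp(-x), with x = 1/s going to infinity.\<close>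
      have "((\<lambda>x::real. poly ([:0,1:] * P) x * exp (- x)) \<longlongrightarrow> 0) at_top" by (rule poly_exp_tendsto_0)
      then have "((\<lambda>s::real. poly ([:0,1:] * P) (inverse s) * exp (- (inverse s))) \<longlongrightarrow> 0) (at_right 0)"
        by (rule filterlim_compose[OF _ filterlim_inverse_at_top_right])
      then show ?thesis
        by (rule Lim_transform_eventually) 
           (auto simp: eventually_at_filter flat_def field_simps)
    qed
    have l: "((\<lambda>s. (flat P s) / s) \<longlongrightarrow> 0) (at_left 0)"
      by (rule tendsto_eventually) (auto simp: eventually_at_filter flat_def)
    have "((\<lambda>s. (flat P s) / s) \<longlongrightarrow> 0) (at 0)"
      using l r by (simp add: filterlim_at_split)
    then show ?thesis using 2 by (simp add: DERIV_def flat_def)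
  qed
qed

lemma smooth1_flat: "smooth1 k (flat P)"
proof (induction k arbitrary: P)
  case (Suc k)
  show ?case
    unfolding smooth1.simps
    by (intro exI[of _ "flat ([:0,0,1:] * (P - pderiv P))"] conjI allI flat_has_derivative Suc)
qed simp

text \<open>\<open>\<eta>\<close> is a normalised bump on the unit interval and
  \<open>\<theta>\<close> its primitive. That \<open>\<theta>\<close> is 0 before and exactly 1
  after the interval is what makes the difference of two rescaled copies of \<open>\<theta>\<close>
  compactly supported.\<close>

lemma ex_smooth_step:
  "\<exists>\<theta> \<eta> M. (\<forall>k. smooth1 k \<theta>) \<and> (\<forall>k. smooth1 k \<eta>) \<and> (\<forall>t. (\<theta> has_real_derivative \<eta> t) (at t)) \<and>
     (\<forall>t. 0 \<le> \<eta> t \<and> \<eta> t \<le> M) \<and> (\<forall>t. t \<notin> {0<..<1} \<longrightarrow> \<eta> t = 0) \<and>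
     (\<forall>t\<le>0. \<theta> t = 0) \<and> (\<forall>t\<ge>1. \<theta> t = 1)"
proof -
  define b where "b t = flat [:1:] t * flat [:1:] (1 - t)" for t
  have sb: "smooth1 k b" for k
    unfolding b_def using smooth1_mult[OF smooth1_flat smooth1_affine[OF smooth1_flat, of k _ "-1" 1]]
    by (simp add: algebra_simps)
  have db: "\<exists>b'. \<forall>t. (b has_real_derivative b' t) (at t)"
    using sb[of 1] by auto
  then have cb: "continuous_on S b" for S
    by (meson DERIV_continuous continuous_at_imp_continuous_on)
  have b0: "b t = 0" if "t \<notin> {0<..<1}" for t using that by (auto simp: b_def flat_def)
  have bpos: "0 \<le> b t" for t by (auto simp: b_def flat_def)
  have flat1: "flat [:1:] t \<le> 1" "0 \<le> flat [:1:] t" for t by (auto simp: flat_def)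
  have b1: "b t \<le> 1" for t 
    unfolding b_def using mult_mono[OF flat1(1) flat1(1) _ flat1(2), of t "1-t"] flat1 by simp
  \<comment> \<open>The integral starts at -1, left of the support, so that 0 is an interior point
    and the derivative there is two-sided.\<close>
  define B where "B t = integral {-1..t} b" for t
  have dB: "(B has_real_derivative b t) (at t)" for t
  proof (cases "t > -1")
    case True
    have "(B has_real_derivative b t) (at t within {-1..t+1})"
      unfolding B_def using True by (intro integral_has_real_derivative cb) auto
    then show ?thesis
      using True by (subst (asm) at_within_interior) (auto simp: interior_atLeastAtMost_real)
  next
    case False
    have "B s = 0" if "s < 0" for s
      unfolding B_def using that by (intro integral_cong[THEN trans, OF _ integral_0]) (auto simp: b0)
    then have "\<forall>\<^sub>F s in nhds t. B s = 0"
      using False by (auto simp: eventually_nhds intro!: exI[of _ "{..<0}"])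
    then have "(B has_real_derivative 0) (at t)"
      by (subst DERIV_cong_ev[OF refl _ refl, of _ "\<lambda>t. 0"]) auto
    then show ?thesis using False b0 by simp
  qed
  have B0: "B t = 0" if "t \<le> 0" for t
    unfolding B_def using that by (intro integral_cong[THEN trans, OF _ integral_0]) (auto simp: b0)
  have B1: "B t = B 1" if "t \<ge> 1" for t
  proof (cases "t = 1")
    case False
    then have "1 < t" using that by simp
    then obtain z where "z > 1" "B t - B 1 = (t - 1) * b z"
      using MVT2[of 1 t B b] dB by auto
    then show ?thesis using b0[of z] by simp
  qed simp
  have "B 0 < B 1"
  proof -
    have mono: "B x \<le> B y" if "x \<le> y" for x y
      using DERIV_nonneg_imp_nondecreasing[OF that] dB bpos by blast
    \<comment> \<open>Any subinterval on which the bump is positive would do to make the total mass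
      positive.\<close>
    obtain z where z: "z > 1/4" "z < 1/2" "B (1/2) - B (1/4) = (1/2 - 1/4) * b z"
      using MVT2[of "1/4" "1/2" B b] dB by auto
    have "b z > 0" using z by (auto simp: b_def flat_def)
    then have "B (1/4) < B (1/2)" using z by simp
    then show ?thesis using mono[of 0 "1/4"] mono[of "1/2" 1] by simp
  qed
  then have c: "B 1 > 0" using B0[of 0] by simp
  define \<theta> where "\<theta> t = 1 / B 1 * B t" for t
  define \<eta> where "\<eta> t = 1 / B 1 * b t" for t
  have s\<eta>: "smooth1 k \<eta>" for k unfolding \<eta>_def by (intro smooth1_mult smooth1_const sb)
  have d\<theta>: "(\<theta> has_real_derivative \<eta> t) (at t)" for t
    unfolding \<theta>_def \<eta>_def by (intro DERIV_cmult dB)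
  have s\<theta>: "smooth1 k \<theta>" for k
    by (cases k) (use d\<theta> s\<eta> in auto)
  show ?thesis
  proof (rule exI[of _ \<theta>], rule exI[of _ \<eta>], rule exI[of _ "1 / B 1"], intro conjI allI impI)
    fix t show "0 \<le> \<eta> t" "\<eta> t \<le> 1 / B 1"
      using bpos[of t] b1[of t] c by (simp_all add: \<eta>_def divide_right_mono)
  next
    fix t :: real assume "1 \<le> t"
    then have "B t = B 1" by (rule B1)
    then show "\<theta> t = 1" using c by (simp add: \<theta>_def)
  next
    fix t :: real assume "t \<le> 0"
    then show "\<theta> t = 0" by (simp add: \<theta>_def B0)
  next
    fix t :: real assume "t \<notin> {0<..<1}"
    then show "\<eta> t = 0" unfolding \<eta>_def by (subst b0) auto
  qed (rule s\<theta> s\<eta> d\<theta>)+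
qed

section \<open>Products of functions of one coordinate as test functions\<close>

lemma prod_has_derivative:
  fixes f f' :: "'n::finite \<Rightarrow> real \<Rightarrow> real" and x :: "real^'n"
  assumes "\<And>i t. (f i has_real_derivative f' i t) (at t)"
  shows "((\<lambda>x. \<Prod>i\<in>UNIV. f i (x $ i)) has_derivative
     (\<lambda>v. \<Sum>i\<in>UNIV. f' i (x$i) * v$i * (\<Prod>j\<in>UNIV - {i}. f j (x$j)))) (at x)"
proof (rule has_derivative_prod)
  fix i :: 'n
  have "((\<lambda>x. x$i) has_derivative (\<lambda>v. v$i)) (at x)"
    by (rule bounded_linear_imp_has_derivative) (rule bounded_linear_vec_nth)
  from has_derivative_compose[OF this assms[THEN has_field_derivative_imp_has_derivative]]
  show "((\<lambda>x. f i (x$i)) has_derivative (\<lambda>v. f' i (x$i) * v$i)) (at x)" by simp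
qed

text \<open>Differentiation keeps the product shape and touches the \<open>j\<close>-th factor only;
  this carries the induction in \<open>times_differentiable_prod\<close>.\<close>

lemma partial_deriv_prod:
  fixes f f' :: "'n::finite \<Rightarrow> real \<Rightarrow> real"
  assumes "\<And>i t. (f i has_real_derivative f' i t) (at t)"
  shows "partial_deriv j (\<lambda>x. \<Prod>i\<in>UNIV. f i (x $ i)) = (\<lambda>x. \<Prod>i\<in>UNIV. (f(j := f' j)) i (x $ i))"
proof
  fix x :: "real^'n"
  have "partial_deriv j (\<lambda>x. \<Prod>i\<in>UNIV. f i (x $ i)) x
      = (\<Sum>i\<in>UNIV. f' i (x$i) * axis j 1 $i * (\<Prod>j\<in>UNIV - {i}. f j (x$j)))"
    unfolding partial_deriv_def
    by (subst frechet_derivative_at[OF prod_has_derivative[OF assms], symmetric]) simp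
  also have "\<dots> = (\<Sum>i\<in>UNIV. if i = j then f' j (x$j) * (\<Prod>i\<in>UNIV - {j}. f i (x$i)) else 0)"
    by (intro sum.cong) (auto simp: axis_def)
  also have "\<dots> = f' j (x$j) * (\<Prod>i\<in>UNIV - {j}. f i (x$i))" by simp
  also have "\<dots> = (\<Prod>i\<in>UNIV. (f(j := f' j)) i (x $ i))"
    by (subst prod.remove[of UNIV j]) (auto intro!: prod.cong)
  finally show "partial_deriv j (\<lambda>x. \<Prod>i\<in>UNIV. f i (x $ i)) x = (\<Prod>i\<in>UNIV. (f(j := f' j)) i (x $ i))" .
qed

lemma times_differentiable_prod:
  fixes f :: "'n::finite \<Rightarrow> real \<Rightarrow> real"
  assumes "\<And>i. smooth1 k (f i)"
  shows "times_differentiable k (\<lambda>x. \<Prod>i\<in>UNIV. f i (x $ i))"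
  using assms
proof (induction k arbitrary: f)
  case (Suc k)
  then have "\<forall>i. \<exists>g'. (\<forall>t. (f i has_real_derivative g' t) (at t)) \<and> smooth1 k g'" by simp
  then obtain f' where f': "\<And>i t. (f i has_real_derivative f' i t) (at t)" "\<And>i. smooth1 k (f' i)"
    by metis
  have "(\<lambda>x. \<Prod>i\<in>UNIV. f i (x $ i)) differentiable (at x)" for x
    unfolding differentiable_def by (rule exI) (rule prod_has_derivative, rule f'(1))
  moreover have "times_differentiable k (partial_deriv j (\<lambda>x. \<Prod>i\<in>UNIV. f i (x $ i)))" for j
    unfolding partial_deriv_prod[OF f'(1)]
    by (rule Suc.IH) (use f'(2) smooth1_SucD[OF Suc.prems] in auto)
  ultimately show ?case by simp
qed simp

lemma test_function_prod:
  fixes f :: "'n::finite \<Rightarrow> real \<Rightarrow> real" and a b :: "real^'n"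
  assumes "\<And>i k. smooth1 k (f i)" "\<And>i t. t \<notin> {a$i..b$i} \<Longrightarrow> f i t = 0" "cbox a b \<subseteq> \<Omega>"
  shows "test_function \<Omega> (\<lambda>x. \<Prod>i\<in>UNIV. f i (x $ i))"
proof -
  have "{x. (\<Prod>i\<in>UNIV. f i (x $ i)) \<noteq> 0} \<subseteq> cbox a b"
    using assms(2) by (force simp: mem_box_cart)
  then have "closure {x. (\<Prod>i\<in>UNIV. f i (x $ i)) \<noteq> 0} \<subseteq> cbox a b"
    by (intro closure_minimal) auto
  moreover from this have "compact (closure {x. (\<Prod>i\<in>UNIV. f i (x $ i)) \<noteq> 0})"
    using bounded_subset[OF bounded_cbox] by (auto simp: compact_eq_bounded_closed)
  moreover have "times_differentiable k (\<lambda>x. \<Prod>i\<in>UNIV. f i (x $ i))" for k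
    by (rule times_differentiable_prod) (rule assms(1))
  ultimately show ?thesis
    unfolding test_function_def using assms(3) by blast
qed

section \<open>Morrey's inequality on cubes\<close>

lemma
  fixes h :: "'a::euclidean_space \<Rightarrow> 'b::{banach,second_countable_topology}"
  assumes "Q \<subseteq> \<Omega>" "Q \<in> sets lebesgue" "\<Omega> \<in> sets lebesgue" "\<And>x. x \<in> \<Omega> - Q \<Longrightarrow> h x = 0"
  shows integrable_lebesgue_on_support: "integrable (lebesgue_on \<Omega>) h \<longleftrightarrow> integrable (lebesgue_on Q) h"
    and lint_lebesgue_on_support: "(LINT x|lebesgue_on \<Omega>. h x) = (LINT x|lebesgue_on Q. h x)"
proof -
  have eq: "(\<lambda>x. indicator \<Omega> x *\<^sub>R h x) = (\<lambda>x. indicator Q x *\<^sub>R h x)"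
    using assms by (auto simp: indicator_def fun_eq_iff)
  show "integrable (lebesgue_on \<Omega>) h \<longleftrightarrow> integrable (lebesgue_on Q) h"
    using assms by (simp add: integrable_restrict_space eq)
  show "(LINT x|lebesgue_on \<Omega>. h x) = (LINT x|lebesgue_on Q. h x)"
    using assms by (simp add: integral_restrict_space eq)
qed

lemma integrable_lebesgue_on_subset:
  fixes f :: "'a::euclidean_space \<Rightarrow> 'b::euclidean_space"
  assumes "integrable (lebesgue_on Q) f" "S \<subseteq> Q" "S \<in> sets lebesgue" "Q \<in> sets lebesgue"
  shows "integrable (lebesgue_on S) f"
proof -
  have "set_integrable lebesgue Q f" using assms by (simp add: integrable_restrict_space set_integrable_def)
  then have "set_integrable lebesgue S f" by (rule set_integrable_subset) (use assms in auto)
  then show ?thesis using assms by (simp add: integrable_restrict_space set_integrable_def)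
qed

lemma lint_lebesgue_on_mono_set:
  fixes f :: "'a::euclidean_space \<Rightarrow> real"
  assumes f: "integrable (lebesgue_on Q) f" and S: "S \<subseteq> Q" "S \<in> sets lebesgue" "Q \<in> sets lebesgue"
    and nn: "\<And>x. x \<in> Q \<Longrightarrow> 0 \<le> f x"
  shows "(LINT x|lebesgue_on S. f x) \<le> (LINT x|lebesgue_on Q. f x)"
proof -
  have iS: "integrable lebesgue (\<lambda>x. indicator S x *\<^sub>R f x)"
    using integrable_lebesgue_on_subset[OF f S] S by (simp add: integrable_restrict_space)
  have iQ: "integrable lebesgue (\<lambda>x. indicator Q x *\<^sub>R f x)"
    using f S by (simp add: integrable_restrict_space)
  have "(LINT x|lebesgue. indicator S x *\<^sub>R f x) \<le> (LINT x|lebesgue. indicator Q x *\<^sub>R f x)"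
    by (rule integral_mono[OF iS iQ]) (use S nn in \<open>auto simp: indicator_def\<close>)
  then show ?thesis using S by (simp add: integral_restrict_space)
qed

text \<open>One row of \<open>has_weak_gradient\<close> without its integrability clauses, which are
  carried as separate hypotheses in the form each estimate needs.\<close>

definition weak_grad :: "(real^'n) set \<Rightarrow> (real^'n \<Rightarrow> real) \<Rightarrow> (real^'n \<Rightarrow> real^'n) \<Rightarrow> bool" where
  "weak_grad \<Omega> u g \<longleftrightarrow> (\<forall>\<phi> j. test_function \<Omega> \<phi> \<longrightarrow>
     (LINT x|lebesgue_on \<Omega>. u x * partial_deriv j \<phi> x) = - (LINT x|lebesgue_on \<Omega>. g x $ j * \<phi> x))"

text \<open>\<open>a\<close> is the lowest corner and \<open>r\<close> the side length; the cube
  centred at \<open>x\<close> is written \<open>cube (x - vec (r / 2)) r\<close>.\<close>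

abbreviation cube :: "real^'n \<Rightarrow> real \<Rightarrow> (real^'n) set" where
  "cube a r \<equiv> cbox a (a + vec r)"

lemma continuous_on_prod_components:
  fixes f :: "'n::finite \<Rightarrow> real \<Rightarrow> real"
  assumes "\<And>i. continuous_on UNIV (f i)"
  shows "continuous_on S (\<lambda>x::real^'n. \<Prod>i\<in>UNIV. f i (x$i))"
  by (intro continuous_on_prod continuous_on_compose2[OF assms] continuous_intros) auto

lemma smooth1_continuous: "smooth1 (Suc k) f \<Longrightarrow> continuous_on S f"
  by (meson DERIV_continuous continuous_at_imp_continuous_on smooth1.simps(2))

text \<open>Integration by parts in direction \<open>j\<close> replaces the factor \<open>e\<close>
  by its primitive \<open>f j\<close>, which is bounded by 1 instead of by the height of a kernel.
  Hence only n - 1 factors \<open>B\<close>: the saved power of the length scale is the one that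
  Morrey's inequality lives on.\<close>

lemma weak_grad_product_bound:
  fixes f :: "'n::finite \<Rightarrow> real \<Rightarrow> real" and a :: "real^'n"
  assumes weak: "weak_grad \<Omega> u g" and \<Omega>: "\<Omega> \<in> sets lebesgue" and Q: "cube a r \<subseteq> \<Omega>"
    and g: "integrable (lebesgue_on (cube a r)) g"
    and f: "\<And>i k. smooth1 k (f i)" "\<And>i t. t \<notin> {a$i..a$i+r} \<Longrightarrow> f i t = 0"
    and B: "0 \<le> B" "\<And>i t. i \<noteq> j \<Longrightarrow> \<bar>f i t\<bar> \<le> B" "\<And>t. \<bar>f j t\<bar> \<le> 1"
    and e: "\<And>t. (f j has_real_derivative e t) (at t)"
  shows "\<bar>LINT x|lebesgue_on \<Omega>. u x * (\<Prod>i\<in>UNIV. (f(j := e)) i (x$i))\<bar>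
     \<le> B ^ (CARD('n) - 1) * (LINT x|lebesgue_on (cube a r). norm (g x))"
proof -
  define \<phi> where "\<phi> x = (\<Prod>i\<in>UNIV. f i (x $ i))" for x :: "real^'n"
  have "\<forall>i. \<exists>g'. (\<forall>t. (f i has_real_derivative g' t) (at t))"
    using f(1)[of "Suc 0"] by simp
  then obtain f' where f': "\<And>i t. (f i has_real_derivative f' i t) (at t)"
    by metis
  have pd: "partial_deriv j \<phi> = (\<lambda>x. \<Prod>i\<in>UNIV. (f(j := e)) i (x$i))"
  proof -
    have "(f i has_real_derivative (f'(j:=e)) i t) (at t)" for i t using f' e by auto
    from partial_deriv_prod[OF this, of j] show ?thesis by (simp add: \<phi>_def[abs_def])
  qed
  have test: "test_function \<Omega> \<phi>"
    unfolding \<phi>_def by (rule test_function_prod[OF f(1) _ Q]) (use f(2) in auto)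
  have cont: "continuous_on S \<phi>" for S
    unfolding \<phi>_def by (rule continuous_on_prod_components) (rule smooth1_continuous[OF f(1)])
  have bound: "\<bar>\<phi> x\<bar> \<le> B ^ (CARD('n) - 1)" for x
  proof -
    have "\<bar>\<phi> x\<bar> = \<bar>f j (x$j)\<bar> * (\<Prod>i\<in>UNIV-{j}. \<bar>f i (x$i)\<bar>)"
      by (simp add: \<phi>_def abs_mult prod.remove[of UNIV j] abs_prod)
    also have "\<dots> \<le> 1 * (\<Prod>i\<in>UNIV-{j}. B)"
      by (intro mult_mono B prod_mono conjI prod_nonneg) (use B in auto)
    finally show ?thesis by (simp add: card_Diff_singleton)
  qed
  have zero: "\<phi> x = 0" if "x \<notin> cube a r" for x
    using that f(2) by (force simp: \<phi>_def mem_box_cart)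
  have gj: "integrable (lebesgue_on (cube a r)) (\<lambda>x. g x $ j)"
    using integrable_bounded_linear[OF bounded_linear_vec_nth g] by simp
  have m\<phi>: "\<phi> \<in> borel_measurable (lebesgue_on (cube a r))"
    by (intro continuous_imp_measurable_on_sets_lebesgue cont) auto
  have le: "\<bar>g x $ j * \<phi> x\<bar> \<le> B ^ (CARD('n) - 1) * norm (g x)" for x
    unfolding abs_mult
    using mult_mono[OF bound[of x] component_le_norm_cart[of "g x" j]] B(1) by (simp add: mult.commute)
  have int: "integrable (lebesgue_on (cube a r)) (\<lambda>x. B ^ (CARD('n) - 1) * norm (g x))"
    using g by (intro integrable_mult_right integrable_norm) 
  have int2: "integrable (lebesgue_on (cube a r)) (\<lambda>x. g x $ j * \<phi> x)"
    by (rule Bochner_Integration.integrable_bound[OF int])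
       (use le gj m\<phi> in \<open>auto intro!: AE_I2 borel_measurable_times intro: order_trans[OF _ abs_ge_self]\<close>)
  have "(LINT x|lebesgue_on \<Omega>. u x * partial_deriv j \<phi> x) = - (LINT x|lebesgue_on \<Omega>. g x $ j * \<phi> x)"
    using weak test by (auto simp: weak_grad_def)
  also have "(LINT x|lebesgue_on \<Omega>. g x $ j * \<phi> x) = (LINT x|lebesgue_on (cube a r). g x $ j * \<phi> x)"
    by (rule lint_lebesgue_on_support) (use zero Q \<Omega> in auto)
  also have "\<bar>- \<dots>\<bar> \<le> (LINT x|lebesgue_on (cube a r). B ^ (CARD('n) - 1) * norm (g x))"
    using order_trans[OF integral_norm_bound[of "lebesgue_on (cube a r)" "\<lambda>x. g x $ j * \<phi> x"]
      integral_mono[OF integrable_norm[OF int2] int]] le by (simp only: real_norm_def abs_minus_cancel)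
  finally show ?thesis unfolding pd by simp
qed

text \<open>Splitting at a level replaces Hoelder's inequality: a value above \<open>s\<close>
  satisfies t = t^(1-p) t^p with t^(1-p) at most s^(1-p). The level is free and is adapted to the
  scale later.\<close>

lemma lint_L1_le_Lp:
  fixes g :: "'a::euclidean_space \<Rightarrow> 'b::euclidean_space"
  assumes "S \<in> lmeasurable" "S \<subseteq> Q" "Q \<in> sets lebesgue" "integrable (lebesgue_on Q) g" "integrable (lebesgue_on Q) (\<lambda>x. norm (g x) powr p)"
    "0 < s" "1 \<le> p"
  shows "(LINT x|lebesgue_on S. norm (g x)) \<le> s * measure lebesgue S + s powr (1 - p) * (LINT x|lebesgue_on Q. norm (g x) powr p)"
proof -
  have S: "S \<in> sets lebesgue" using assms(1) by auto
  have sub: "integrable (lebesgue_on S) f" if "integrable (lebesgue_on Q) f" for f :: "'a \<Rightarrow> 'c::euclidean_space"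
    by (rule integrable_lebesgue_on_subset[OF that assms(2) S assms(3)])
  have le: "norm (g x) \<le> s + s powr (1 - p) * norm (g x) powr p" for x
  proof (cases "norm (g x) \<le> s")
    case False
    then have "norm (g x) = norm (g x) powr (1 - p) * norm (g x) powr p"
      using assms(6) by (simp add: powr_add[symmetric])
    also have "\<dots> \<le> s powr (1 - p) * norm (g x) powr p"
      using False assms(6,7) by (intro mult_right_mono powr_mono2') auto
    finally show ?thesis using assms(6) by simp
  qed (simp add: add_increasing2)
  have c: "integrable (lebesgue_on S) (\<lambda>x. s)"
    using assms(1) by (intro finite_measure.integrable_const finite_measure_lebesgue_on)
  have "(LINT x|lebesgue_on S. norm (g x)) \<le> (LINT x|lebesgue_on S. s + s powr (1 - p) * norm (g x) powr p)"
    using sub[OF assms(4)] sub[OF assms(5)] c le by (intro integral_mono Bochner_Integration.integrable_add) auto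
  also have "\<dots> = s * measure lebesgue S + s powr (1 - p) * (LINT x|lebesgue_on S. norm (g x) powr p)"
    using sub[OF assms(5)] c S by (subst Bochner_Integration.integral_add) (auto simp: measure_restrict_space)
  also have "(LINT x|lebesgue_on S. norm (g x) powr p) \<le> (LINT x|lebesgue_on Q. norm (g x) powr p)"
    by (rule lint_lebesgue_on_mono_set[OF assms(5,2) S assms(3)]) simp
  finally show ?thesis using assms by (simp add: mult_left_mono)
qed

lemma measure_cube: "0 \<le> r \<Longrightarrow> measure lebesgue (cube (a::real^'n::finite) r) = r ^ CARD('n)"
  using content_cbox_cart[of a "a + vec r"] by (simp add: interval_eq_empty_cart not_less)

lemma integrable_times_box:
  fixes u \<rho> :: "real^'n::finite \<Rightarrow> real"
  assumes "continuous_on \<Omega> u" "Q = cbox a b" "Q \<subseteq> \<Omega>" "\<Omega> \<in> sets lebesgue" "continuous_on UNIV \<rho>"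
    "\<And>x. x \<notin> Q \<Longrightarrow> \<rho> x = 0"
  shows "integrable (lebesgue_on \<Omega>) (\<lambda>x. u x * \<rho> x)"
proof -
  have "continuous_on Q (\<lambda>x. u x * \<rho> x)"
    using assms by (auto intro!: continuous_intros intro: continuous_on_subset)
  then have "integrable (lebesgue_on Q) (\<lambda>x. u x * \<rho> x)"
    unfolding assms(2) by (rule continuous_imp_integrable)
  then show ?thesis
    by (subst integrable_lebesgue_on_support[of Q]) (use assms in auto)
qed

section \<open>Unit-mass bump kernels on intervals and cubes\<close>

locale smooth_step =
  fixes \<theta> \<eta> :: "real \<Rightarrow> real" and M :: real
  assumes s\<theta>: "smooth1 k \<theta>" and s\<eta>: "smooth1 k \<eta>"
    and d\<theta>: "(\<theta> has_real_derivative \<eta> t) (at t)"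
    and \<eta>0: "0 \<le> \<eta> t" and \<eta>M: "\<eta> t \<le> M" and \<eta>out: "t \<notin> {0<..<1} \<Longrightarrow> \<eta> t = 0"
    and \<theta>0: "t \<le> 0 \<Longrightarrow> \<theta> t = 0" and \<theta>1: "1 \<le> t \<Longrightarrow> \<theta> t = 1"
begin

lemma M0: "0 \<le> M" using \<eta>0 \<eta>M order_trans by blast

lemma \<theta>_bounds: "0 \<le> \<theta> t" "\<theta> t \<le> 1"
proof -
  have mono: "\<theta> x \<le> \<theta> y" if "x \<le> y" for x y
    using DERIV_nonneg_imp_nondecreasing[OF that] d\<theta> \<eta>0 by blast
  show "0 \<le> \<theta> t" using mono[of "min t 0" t] \<theta>0[of "min t 0"] by simp
  show "\<theta> t \<le> 1" using mono[of t "max t 1"] \<theta>1[of "max t 1"] by simp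
qed

text \<open>The dilation of \<open>\<eta>\<close> to \<open>{a..a+r}\<close> that keeps the mass 1;
  its primitive is \<open>\<theta> ((t - a) / r)\<close>.\<close>

definition kern :: "real \<Rightarrow> real \<Rightarrow> real \<Rightarrow> real" where
  "kern a r t = \<eta> ((t - a) / r) / r"

lemma smooth1_kern: "smooth1 k (kern a r)"
proof -
  have "smooth1 k (\<lambda>t. (1/r) * \<eta> ((1/r) * t + (- a / r)))"
    by (intro smooth1_mult smooth1_const smooth1_affine s\<eta>)
  then show ?thesis by (simp add: kern_def[abs_def] diff_divide_distrib)
qed

lemma smooth1_step: "smooth1 k (\<lambda>t. \<theta> ((t - a) / r))"
proof -
  have "smooth1 k (\<lambda>t. \<theta> ((1/r) * t + (- a / r)))"
    by (intro smooth1_affine s\<theta>)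
  then show ?thesis by (simp add: diff_divide_distrib)
qed

lemma step_deriv: "((\<lambda>t. \<theta> ((t - a) / r)) has_real_derivative kern a r t) (at t)"
proof (cases "r = 0")
  case False
  have "((\<lambda>t. (t - a) / r) has_real_derivative 1 / r) (at t)"
    using False by (auto intro!: derivative_eq_intros)
  from DERIV_chain2[OF d\<theta> this] show ?thesis by (simp add: kern_def)
qed (simp add: kern_def)

lemma kern_nonneg: "0 < r \<Longrightarrow> 0 \<le> kern a r t"
  by (simp add: kern_def \<eta>0)

text \<open>Stated for all \<open>r\<close> above \<open>s\<close>, so that in
  \<open>kernel_change\<close> the one bound M/s covers the kernels of both sizes.\<close>

lemma kern_le: "0 < s \<Longrightarrow> s \<le> r \<Longrightarrow> kern a r t \<le> M / s"
  unfolding kern_def using \<eta>M M0 by (intro frac_le) auto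

lemma kern_outside: "0 < r \<Longrightarrow> t \<notin> {a..a+r} \<Longrightarrow> kern a r t = 0"
  unfolding kern_def by (subst \<eta>out) (auto simp: field_simps)

lemma kern_integral: 
  assumes "0 < r"
  shows "has_bochner_integral lborel (kern a r) 1"
proof -
  have "has_bochner_integral lborel (\<lambda>t. kern a r t * indicator {a..a+r} t)
     (\<theta> ((a + r - a) / r) - \<theta> ((a - a) / r))"
    by (rule has_bochner_integral_FTC_Icc_real)
       (use assms step_deriv smooth1_continuous[OF smooth1_kern, of UNIV a r] in 
          \<open>auto simp: continuous_on_eq_continuous_at\<close>)
  moreover have "(\<lambda>t. kern a r t * indicator {a..a+r} t) = kern a r"
    using kern_outside[OF assms] by (auto simp: indicator_def fun_eq_iff)
  ultimately show ?thesis using assms by (simp add: \<theta>0 \<theta>1)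
qed

definition bk :: "real^'n::finite \<Rightarrow> real \<Rightarrow> real^'n \<Rightarrow> real" where
  "bk a r x = (\<Prod>i\<in>UNIV. kern (a$i) r (x$i))"

lemma bk_continuous: "continuous_on S (bk a r)"
  unfolding bk_def by (intro continuous_on_prod_components smooth1_continuous smooth1_kern)

lemma bk_nonneg: "0 < r \<Longrightarrow> 0 \<le> bk a r x"
  unfolding bk_def by (intro prod_nonneg) (simp add: kern_nonneg)

lemma bk_outside: "0 < r \<Longrightarrow> x \<notin> cube a r \<Longrightarrow> bk a r x = 0"
  unfolding bk_def using kern_outside by (force simp: mem_box_cart)

text \<open>Fubini: \<open>lborel\<close> is the image of the product measure over
  \<open>Basis\<close>, under which the product kernel becomes a product of one-dimensional kernels
  of mass 1.\<close>

lemma bk_integral: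
  fixes a :: "real^'n::finite"
  assumes "0 < r"
  shows "has_bochner_integral lborel (bk a r) 1"
proof -
  interpret product_sigma_finite "\<lambda>b::real^'n. lborel" ..
  have B: "(Basis::(real^'n) set) = (\<lambda>i. axis i 1) ` UNIV" by (auto simp: Basis_vec_def)
  have inj: "inj (\<lambda>i::'n. axis i (1::real))" by (auto simp: inj_on_def axis_eq_axis)
  have eq: "bk a r (\<Sum>b\<in>Basis. p b *\<^sub>R b) = (\<Prod>b\<in>Basis. kern (a \<bullet> b) r (p b))" for p
  proof -
    have "(\<Sum>b\<in>Basis. p b *\<^sub>R b) $ i = p (axis i 1)" for i
      using inner_sum_left_Basis[of "axis i 1" p] by (simp add: inner_axis' inner_axis)
    then have "bk a r (\<Sum>b\<in>Basis. p b *\<^sub>R b) = (\<Prod>i\<in>UNIV. kern (a$i) r (p (axis i 1)))"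
      by (simp add: bk_def)
    also have "\<dots> = (\<Prod>b\<in>Basis. kern (a \<bullet> b) r (p b))"
      by (simp only: B prod.reindex[OF inj] o_def) (simp add: inner_axis)
    finally show ?thesis .
  qed
  have int: "integrable (\<Pi>\<^sub>M b\<in>(Basis::(real^'n) set). lborel) (\<lambda>p. \<Prod>b\<in>Basis. kern (a \<bullet> b) r (p b))"
    by (rule product_integrable_prod) (use kern_integral[OF assms] in \<open>auto simp: has_bochner_integral_iff\<close>)
  have "(LINT p|(\<Pi>\<^sub>M b\<in>(Basis::(real^'n) set). lborel). (\<Prod>b\<in>Basis. kern (a \<bullet> b) r (p b))) 
      = (\<Prod>b\<in>(Basis::(real^'n) set). (LINT t|lborel. kern (a \<bullet> b) r t))"
    by (rule product_integral_prod) (use kern_integral[OF assms] in \<open>auto simp: has_bochner_integral_iff\<close>)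
  also have "\<dots> = 1"
    by (intro prod.neutral ballI) (use kern_integral[OF assms] in \<open>auto simp: has_bochner_integral_iff\<close>)
  finally have 1: "has_bochner_integral (\<Pi>\<^sub>M b\<in>(Basis::(real^'n) set). lborel) (\<lambda>p. bk a r (\<Sum>b\<in>Basis. p b *\<^sub>R b)) 1"
    using int by (simp add: has_bochner_integral_iff eq)
  have m: "bk a r \<in> borel_measurable borel"
    by (rule borel_measurable_continuous_onI) (rule bk_continuous)
  show ?thesis
    by (subst lborel_eq) (rule has_bochner_integral_distr, use m 1 in auto)
qed

lemma bk_lint:
  assumes "0 < r" "cube a r \<subseteq> \<Omega>" "\<Omega> \<in> sets lebesgue"
  shows "(LINT x|lebesgue_on \<Omega>. bk a r x) = 1"
proof -
  have "(LINT x|lebesgue_on \<Omega>. bk a r x) = (LINT x|lebesgue_on UNIV. bk a r x)"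
    by (rule lint_lebesgue_on_support[symmetric]) (use assms bk_outside in auto)
  also have "\<dots> = (LINT x|lborel. bk a r x)"
    using bk_continuous by (subst lebesgue_on_UNIV_eq, subst integral_completion) (auto intro!: borel_measurable_continuous_onI)
  finally show ?thesis using bk_integral[OF assms(1), of a] by (simp add: has_bochner_integral_iff)
qed

lemma bk_average_close:
  assumes f: "integrable (lebesgue_on \<Omega>) (\<lambda>z. f z * bk a r z)" and \<Omega>: "\<Omega> \<in> sets lebesgue"
    and r: "0 < r" and sub: "cube a r \<subseteq> \<Omega>"
    and close: "\<And>z. z \<in> cube a r \<Longrightarrow> \<bar>f z - c\<bar> \<le> e"
  shows "\<bar>(LINT z|lebesgue_on \<Omega>. f z * bk a r z) - c\<bar> \<le> e"
proof -
  have ic: "integrable (lebesgue_on \<Omega>) (\<lambda>z. k * bk a r z)" for k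
    by (rule integrable_times_box[OF continuous_on_const refl sub \<Omega> bk_continuous]) (rule bk_outside[OF r])
  have one: "(LINT z|lebesgue_on \<Omega>. bk a r z) = 1" by (rule bk_lint[OF r sub \<Omega>])
  have "(LINT z|lebesgue_on \<Omega>. f z * bk a r z) - c = (LINT z|lebesgue_on \<Omega>. f z * bk a r z) - (LINT z|lebesgue_on \<Omega>. c * bk a r z)"
    by (simp add: one)
  also have "\<dots> = (LINT z|lebesgue_on \<Omega>. f z * bk a r z - c * bk a r z)"
    by (rule Bochner_Integration.integral_diff[OF f ic, symmetric])
  finally have "\<bar>(LINT z|lebesgue_on \<Omega>. f z * bk a r z) - c\<bar> \<le> (LINT z|lebesgue_on \<Omega>. norm (f z * bk a r z - c * bk a r z))"
    using integral_norm_bound[of "lebesgue_on \<Omega>" "\<lambda>z. f z * bk a r z - c * bk a r z"] by (simp only: real_norm_def)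
  also have "\<dots> \<le> (LINT z|lebesgue_on \<Omega>. e * bk a r z)"
  proof (rule integral_mono[OF integrable_norm[OF Bochner_Integration.integrable_diff[OF f ic]] ic])
    fix z
    show "norm (f z * bk a r z - c * bk a r z) \<le> e * bk a r z"
    proof (cases "z \<in> cube a r")
      case True
      have "norm (f z * bk a r z - c * bk a r z) = \<bar>f z - c\<bar> * bk a r z"
        by (simp add: left_diff_distrib[symmetric] abs_mult abs_of_nonneg[OF bk_nonneg[OF r]])
      also have "\<dots> \<le> e * bk a r z" using close[OF True] bk_nonneg[OF r] by (intro mult_right_mono)
      finally show ?thesis .
    qed (simp add: bk_outside[OF r])
  qed
  also have "\<dots> = e" by (simp add: one)
  finally show ?thesis .
qed

text \<open>The two product kernels are joined by hybrids that differ in one coordinate only.\<close>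

lemma kernel_change:
  fixes a b :: "real^'n::finite"
  assumes weak: "weak_grad \<Omega> u g" and \<Omega>: "\<Omega> \<in> sets lebesgue" and Q: "cube a r \<subseteq> \<Omega>"
    and g: "integrable (lebesgue_on (cube a r)) g" and u: "continuous_on \<Omega> u"
    and s: "0 < s" "s \<le> r" and sub: "\<And>i. a$i \<le> b$i \<and> b$i + s \<le> a$i + r"
  shows "\<bar>(LINT x|lebesgue_on \<Omega>. u x * bk b s x) - (LINT x|lebesgue_on \<Omega>. u x * bk a r x)\<bar>
    \<le> CARD('n) * (M / s) ^ (CARD('n) - 1) * (LINT x|lebesgue_on (cube a r). norm (g x))"
proof -
  define I where "I = (LINT x|lebesgue_on (cube a r). norm (g x))"
  define F where "F T i = (if i \<in> T then kern (b$i) s else kern (a$i) r)" for T and i :: 'n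
  define k where "k T x = (\<Prod>i\<in>UNIV. F T i (x$i))" for T and x :: "real^'n"
  have Fout: "F T i t = 0" if "t \<notin> {a$i..a$i+r}" for T i t
    using that s sub[of i] by (auto simp: F_def intro!: kern_outside)
  have Fsm: "smooth1 n (F T i)" for n T i
    by (auto simp: F_def smooth1_kern)
  have Fb: "\<bar>F T i t\<bar> \<le> M / s" for T i t
  proof -
    have "0 \<le> F T i t" "F T i t \<le> M / s"
      using s kern_le[of s s] kern_le[of s r] kern_nonneg[of s] kern_nonneg[of r] by (auto simp: F_def)
    then show ?thesis by simp
  qed
  have kint: "integrable (lebesgue_on \<Omega>) (\<lambda>x. u x * k T x)" for T
  proof (rule integrable_times_box[OF u refl Q \<Omega>])
    show "continuous_on UNIV (k T)"
      unfolding k_def by (intro continuous_on_prod_components smooth1_continuous[OF Fsm])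
    show "k T x = 0" if "x \<notin> cube a r" for x
      using that Fout by (force simp: k_def mem_box_cart)
  qed
  have "\<bar>(LINT x|lebesgue_on \<Omega>. u x * k T x) - (LINT x|lebesgue_on \<Omega>. u x * k {} x)\<bar>
      \<le> card T * ((M / s) ^ (CARD('n) - 1) * I)" for T
  proof (induction T rule: finite_induct[OF finite])
    case (2 j T)
    \<comment> \<open>Under \<open>sub\<close> both steps are 0 to the left of the large interval
      and 1 to its right, so \<open>E\<close> is a primitive of the difference of the kernels with
      support in that interval.\<close>
    define E where "E t = \<theta> ((t - b$j) / s) - \<theta> ((t - a$j) / r)" for t
    define f where "f = (F T)(j := E)"
    define e where "e t = kern (b$j) s t - kern (a$j) r t" for t
    have dE: "(E has_real_derivative e t) (at t)" for t
      unfolding E_def e_def by (intro derivative_intros step_deriv)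
    have Eb: "\<bar>E t\<bar> \<le> 1" for t
      using \<theta>_bounds[of "(t - b$j) / s"] \<theta>_bounds[of "(t - a$j) / r"] by (auto simp: E_def)
    have Eout: "E t = 0" if out: "t \<notin> {a$j..a$j+r}" for t
    proof -
      consider "t < a$j" | "t > a$j + r" using out by (metis atLeastAtMost_iff not_le)
      then show ?thesis
      proof cases
        case 1
        then have "(t - b$j) / s \<le> 0" "(t - a$j) / r \<le> 0"
          using s sub[of j] by (auto simp: divide_nonpos_pos)
        then show ?thesis by (simp add: E_def \<theta>0)
      next
        case 2
        then have "(t - b$j) / s \<ge> 1" "(t - a$j) / r \<ge> 1"
          using s sub[of j] by (auto simp: field_simps)
        then show ?thesis by (simp add: E_def \<theta>1)
      qed
    qed
    have Esm: "smooth1 n E" for n unfolding E_def[abs_def] by (intro smooth1_diff smooth1_step)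
    have "k (insert j T) x - k T x = (\<Prod>i\<in>UNIV. (f(j := e)) i (x$i))" for x
    proof -
      have "k (insert j T) x = kern (b$j) s (x$j) * (\<Prod>i\<in>UNIV-{j}. F T i (x$i))"
        unfolding k_def by (subst prod.remove[of UNIV j]) (auto simp: F_def intro!: prod.cong)
      moreover have "k T x = kern (a$j) r (x$j) * (\<Prod>i\<in>UNIV-{j}. F T i (x$i))"
        unfolding k_def by (subst prod.remove[of UNIV j]) (use 2 in \<open>auto simp: F_def intro!: prod.cong\<close>)
      moreover have "(\<Prod>i\<in>UNIV. (f(j := e)) i (x$i)) = e (x$j) * (\<Prod>i\<in>UNIV-{j}. F T i (x$i))"
        by (subst prod.remove[of UNIV j]) (auto simp: f_def intro!: prod.cong)
      ultimately show ?thesis by (simp add: e_def algebra_simps)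
    qed
    then have "(LINT x|lebesgue_on \<Omega>. u x * k (insert j T) x) - (LINT x|lebesgue_on \<Omega>. u x * k T x)
       = (LINT x|lebesgue_on \<Omega>. u x * (\<Prod>i\<in>UNIV. (f(j := e)) i (x$i)))"
      by (subst Bochner_Integration.integral_diff[OF kint kint, symmetric]) (simp add: right_diff_distrib[symmetric])
    also have "\<bar>\<dots>\<bar> \<le> (M / s) ^ (CARD('n) - 1) * I"
      unfolding I_def
      by (rule weak_grad_product_bound[OF weak \<Omega> Q g])
         (use dE Eb Eout Esm Fsm Fout Fb M0 s in \<open>auto simp: f_def\<close>)
    finally show ?case using 2 by (simp add: algebra_simps)
  qed simp
  from this[of UNIV] show ?thesis
    by (simp add: k_def[abs_def] F_def bk_def[abs_def] I_def mult.assoc)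
qed


text \<open>\<open>t\<close> bounds the L^p mean of \<open>g\<close> over the cube. The averages
  \<open>U k\<close> over cubes shrinking to \<open>x\<close> telescope from the average on the
  whole cube to \<open>u x\<close>. One step costs a multiple of t * 2^(k n/p) * r/2^k: the local
  mean may grow by 2^(k n/p), but the shrinking side length wins because p > n. The constant is the
  sum of the geometric series.\<close>

lemma morrey:
  fixes a x :: "real^'n::finite"
  assumes weak: "weak_grad \<Omega> u g" and \<Omega>: "\<Omega> \<in> sets lebesgue" and Q: "cube a r \<subseteq> \<Omega>"
    and g: "integrable (lebesgue_on (cube a r)) g" and u: "continuous_on \<Omega> u"
    and p: "real CARD('n) < p" and gp: "integrable (lebesgue_on (cube a r)) (\<lambda>x. norm (g x) powr p)"
    and r: "0 < r" and t: "0 < t" and x: "x \<in> cube a r"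
    and le: "(LINT x|lebesgue_on (cube a r). norm (g x) powr p) \<le> t powr p * r ^ CARD('n)"
  shows "\<bar>u x - (LINT x|lebesgue_on \<Omega>. u x * bk a r x)\<bar>
     \<le> 2 * CARD('n) * (2 * M) ^ (CARD('n) - 1) / (1 - 2 powr (CARD('n) / p - 1)) * t * r"
proof -
  define n where "n = CARD('n)"
  have n: "n > 0" by (simp add: n_def)
  define q where "q = (2::real) powr (n / p - 1)"
  have p': "real n < p" "0 < p" "1 \<le> p"
  proof -
    have "1 \<le> real n" using n by simp
    moreover show "real n < p" using p by (simp add: n_def)
    ultimately show "0 < p" "1 \<le> p" by linarith+
  qed
  have q: "0 < q" "q < 1" using p' by (auto simp: q_def powr_less_one)
  define D where "D = 2 * n * (2 * M) ^ (n - 1)"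
  have D: "D \<ge> 0" using M0 by (simp add: D_def)
  define rk where "rk k = r / 2 ^ k" for k :: nat
  \<comment> \<open>The cube is contracted towards \<open>x\<close> by the factor 1/2^k:
    \<open>x\<close> keeps its relative position, hence stays inside, and the cubes are
    nested.\<close>
  define ak where "ak k = x - (1 / 2 ^ k) *\<^sub>R (x - a)" for k :: nat
  define U where "U k = (LINT x|lebesgue_on \<Omega>. u x * bk (ak k) (rk k) x)" for k
  have rk: "0 < rk k" for k using r by (simp add: rk_def)
  have xi: "a$i \<le> x$i" "x$i \<le> a$i + r" for i using x by (auto simp: mem_box_cart)
  have aki: "ak k $ i = x$i - (x$i - a$i) / 2 ^ k" for k i by (simp add: ak_def)
  have nest: "ak k $ i \<le> ak (Suc k) $ i \<and> ak (Suc k) $ i + rk (Suc k) \<le> ak k $ i + rk k" for k i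
  proof -
    define y where "y = (x$i - a$i) / 2 ^ k"
    have "0 \<le> y" "y \<le> rk k"
      unfolding y_def rk_def using xi[of i] by (auto intro!: divide_right_mono)
    then show ?thesis unfolding aki by (simp add: y_def rk_def field_simps)
  qed
  have sub1: "cube (ak (Suc k)) (rk (Suc k)) \<subseteq> cube (ak k) (rk k)" for k
  proof
    fix z assume "z \<in> cube (ak (Suc k)) (rk (Suc k))"
    then show "z \<in> cube (ak k) (rk k)"
      unfolding mem_box_cart vector_add_component vec_component
      using nest[of k] by (meson order_trans)
  qed
  have sub: "cube (ak k) (rk k) \<subseteq> cube a r" for k
  proof (induction k)
    case 0 show ?case by (simp add: ak_def rk_def)
  next
    case (Suc k) then show ?case using sub1 by blast
  qed
  have xk: "x \<in> cube (ak k) (rk k)" for k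
    unfolding mem_box_cart vector_add_component vec_component aki rk_def
  proof (intro allI conjI)
    fix i
    show "x$i - (x$i - a$i) / 2 ^ k \<le> x$i" using xi[of i] by simp
    have "(x$i - a$i) / 2 ^ k \<le> r / 2 ^ k" using xi[of i] by (intro divide_right_mono) auto
    then show "x$i \<le> x$i - (x$i - a$i) / 2 ^ k + r / 2 ^ k" by simp
  qed
  have gk: "integrable (lebesgue_on (cube (ak k) (rk k))) g" for k
    by (rule integrable_lebesgue_on_subset[OF g sub]) auto
  have step: "\<bar>U (Suc k) - U k\<bar> \<le> D * t * r * q ^ k" for k
  proof -
    \<comment> \<open>The level at which the bounds for both terms of \<open>lint_L1_le_Lp\<close>
      equal \<open>s * rk k ^ n\<close>; the power of 2 compensates for the smaller volume of the
      k-th cube.\<close>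
    define s where "s = t * 2 powr (k * n / p)"
    have s: "0 < s" using t by (simp add: s_def)
    have "(LINT x|lebesgue_on (cube (ak k) (rk k)). norm (g x))
       \<le> s * rk k ^ n + s powr (1 - p) * (LINT x|lebesgue_on (cube a r). norm (g x) powr p)"
      using lint_L1_le_Lp[OF _ sub _ g gp s p'(3), of k] measure_cube[of "rk k" "ak k"] rk[of k] by (simp add: n_def)
    also have "\<dots> \<le> s * rk k ^ n + s powr (1 - p) * (t powr p * r ^ n)"
      using le by (intro add_left_mono mult_left_mono) (auto simp: n_def)
    also have "s powr (1 - p) * (t powr p * r ^ n) = s * rk k ^ n"
    proof -
      have "s powr p = t powr p * 2 powr (k * n)"
        unfolding s_def using t p' by (simp add: powr_mult powr_powr)
      also have "(2::real) powr (k * n) = 2 ^ (k * n)"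
        using powr_realpow[of "2::real" "k * n"] by simp
      finally have "s powr p = t powr p * 2 ^ (k * n)" .
      moreover have "s powr (1 - p) = s / s powr p" using s by (simp add: powr_diff)
      ultimately have "s powr (1 - p) * (t powr p * r ^ n) = s * (t powr p * r ^ n) / (t powr p * 2 ^ (k * n))"
        by simp
      also have "\<dots> = s * rk k ^ n" using t by (simp add: rk_def power_divide power_mult)
      finally show ?thesis .
    qed
    finally have I: "(LINT x|lebesgue_on (cube (ak k) (rk k)). norm (g x)) \<le> 2 * s * rk k ^ n" by simp
    have "\<bar>U (Suc k) - U k\<bar> \<le> n * (M / rk (Suc k)) ^ (n - 1) * (LINT x|lebesgue_on (cube (ak k) (rk k)). norm (g x))"
      unfolding U_def n_def
      by (rule kernel_change[OF weak \<Omega> _ gk u]) (use sub Q nest rk in \<open>auto simp: rk_def field_simps r\<close>)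
    also have "\<dots> \<le> n * (M / rk (Suc k)) ^ (n - 1) * (2 * s * rk k ^ n)"
      using I M0 rk[of "Suc k"] by (intro mult_left_mono) auto
    also have "\<dots> = D * s * rk k"
    proof -
      have "M / rk (Suc k) = 2 * M / rk k" by (simp add: rk_def)
      moreover have "rk k ^ n = rk k ^ (n - 1) * rk k" using n by (cases n) auto
      ultimately show ?thesis using rk[of k] by (simp add: D_def power_divide)
    qed
    also have "\<dots> = D * t * r * q ^ k"
    proof -
      have "q ^ k = 2 powr (k * (n / p - 1))"
        using powr_realpow[of q k] q by (simp add: q_def powr_powr mult.commute)
      also have "\<dots> = 2 powr (k * n / p) / 2 ^ k"
        by (simp add: right_diff_distrib powr_diff powr_realpow)
      finally show ?thesis by (simp add: s_def rk_def)
    qed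
    finally show ?thesis .
  qed
  have tele: "\<bar>U k - U 0\<bar> \<le> D * t * r / (1 - q)" for k
  proof -
    have "\<bar>U k - U 0\<bar> = \<bar>\<Sum>i<k. U (Suc i) - U i\<bar>" by (simp add: sum_lessThan_telescope)
    also have "\<dots> \<le> (\<Sum>i<k. D * t * r * q ^ i)"
      by (intro order_trans[OF sum_abs] sum_mono step)
    also have "\<dots> = D * t * r * (\<Sum>i<k. q ^ i)" by (simp add: sum_distrib_left)
    also have "(\<Sum>i<k. q ^ i) = (1 - q ^ k) / (1 - q)" using q by (subst sum_gp_strict) auto
    also have "D * t * r * ((1 - q ^ k) / (1 - q)) \<le> D * t * r * (1 / (1 - q))"
      using q D t r by (intro mult_left_mono divide_right_mono) auto
    finally show ?thesis by simp
  qed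
  have lim: "U \<longlonglongrightarrow> u x"
  proof (rule LIMSEQ_I)
    fix e :: real assume e: "0 < e"
    have "x \<in> \<Omega>" using x Q by auto
    then obtain d where d: "d > 0" "\<And>z. z \<in> \<Omega> \<Longrightarrow> dist z x < d \<Longrightarrow> dist (u z) (u x) < e / 2"
      using u e unfolding continuous_on_iff by (metis half_gt_zero)
    have "(\<lambda>k. n * rk k) \<longlonglongrightarrow> n * (r * 0)"
      unfolding rk_def divide_inverse by (intro tendsto_intros LIMSEQ_inverse_realpow_zero) auto
    then have "\<forall>\<^sub>F k in sequentially. n * rk k < d" using d by (intro order_tendstoD(2)[where y = "n * (r * 0)"]) auto
    then obtain k0 where k0: "\<And>k. k \<ge> k0 \<Longrightarrow> n * rk k < d" by (auto simp: eventually_sequentially)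
    have "norm (U k - u x) < e" if kk: "k \<ge> k0" for k
    proof -
      have near: "\<bar>u z - u x\<bar> \<le> e / 2" if z: "z \<in> cube (ak k) (rk k)" for z
      proof -
        have "norm (z - x) \<le> (\<Sum>i\<in>UNIV. \<bar>(z - x) $ i\<bar>)" by (rule norm_le_l1_cart)
        also have "\<dots> \<le> (\<Sum>i\<in>(UNIV::'n set). rk k)"
        proof (rule sum_mono)
          fix i
          have "ak k $ i \<le> z $ i" "z $ i \<le> ak k $ i + rk k" "ak k $ i \<le> x $ i" "x $ i \<le> ak k $ i + rk k"
            using z xk[of k] by (auto simp: mem_box_cart)
          then show "\<bar>(z - x) $ i\<bar> \<le> rk k" by auto
        qed
        also have "\<dots> < d" using k0[OF kk] by (simp add: n_def)
        finally show ?thesis using d(2)[of z] z sub[of k] Q by (force simp: dist_norm)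
      qed
      have subO: "cube (ak k) (rk k) \<subseteq> \<Omega>" using sub Q by blast
      have "\<bar>U k - u x\<bar> \<le> e / 2"
        unfolding U_def
      proof (rule bk_average_close[OF _ \<Omega> rk subO near])
        show "integrable (lebesgue_on \<Omega>) (\<lambda>z. u z * bk (ak k) (rk k) z)"
          by (rule integrable_times_box[OF u refl subO \<Omega> bk_continuous]) (rule bk_outside[OF rk])
      qed
      then show ?thesis using e by simp
    qed
    then show "\<exists>k0. \<forall>k\<ge>k0. norm (U k - u x) < e" by blast
  qed
  have "(\<lambda>k. \<bar>U k - U 0\<bar>) \<longlonglongrightarrow> \<bar>u x - U 0\<bar>" by (intro tendsto_intros lim)
  then have "\<bar>u x - U 0\<bar> \<le> D * t * r / (1 - q)"
    by (rule LIMSEQ_le_const2) (use tele in auto)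
  moreover have "U 0 = (LINT x|lebesgue_on \<Omega>. u x * bk a r x)"
    by (simp add: U_def ak_def rk_def)
  ultimately show ?thesis by (simp add: D_def q_def n_def)
qed

end

section \<open>Lebesgue points\<close>

text \<open>Outer regularity gives open sets decreasing to \<open>A\<close> up to a null set. By
  dominated convergence the integrals over them tend to the integral over \<open>A\<close>, which is
  zero.\<close>

lemma ex_open_small_nn_integral:
  fixes f :: "'a::euclidean_space \<Rightarrow> real"
  assumes f: "integrable lebesgue f" "\<And>x. 0 \<le> f x" and A: "A \<in> sets lebesgue"
    and zero: "AE x in lebesgue. x \<in> A \<longrightarrow> f x = 0" and e: "0 < e"
  shows "\<exists>U. open U \<and> A \<subseteq> U \<and> (LINT x|lebesgue. indicator U x * f x) < e"
proof -
  have "\<exists>U. open U \<and> A \<subseteq> U \<and> U - A \<in> sets lebesgue \<and> emeasure lebesgue (U - A) < ennreal (1 / 2 ^ k)" for k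
    using sets_lebesgue_outer_open[OF A, of "1 / 2 ^ k"] by (metis fmeasurableD zero_less_divide_1_iff zero_less_numeral zero_less_power)
  then obtain U where U: "\<And>k. open (U k)" "\<And>k. A \<subseteq> U k" "\<And>k. U k - A \<in> sets lebesgue"
     "\<And>k. emeasure lebesgue (U k - A) < ennreal (1 / 2 ^ k)" by metis
  define V where "V k = (\<Inter>i\<le>k. U i)" for k :: nat
  have V: "open (V k)" "A \<subseteq> V k" for k using U by (auto simp: V_def intro!: open_INT)
  have null: "(\<Inter>k. V k) - A \<in> null_sets lebesgue"
  proof -
    have m: "(\<Inter>k. V k) - A \<in> sets lebesgue"
      using V(1) A by (auto intro!: sets.Diff sets.countable_INT)
    have "emeasure lebesgue ((\<Inter>k. V k) - A) \<le> ennreal (1 / 2 ^ k)" for k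
    proof -
      have "emeasure lebesgue ((\<Inter>k. V k) - A) \<le> emeasure lebesgue (U k - A)"
        by (rule emeasure_mono) (use U in \<open>auto simp: V_def\<close>)
      with U(4)[of k] show ?thesis by (simp add: order_less_imp_le order_le_less_trans)
    qed
    moreover have "(\<lambda>k. ennreal (1 / 2 ^ k)) \<longlonglongrightarrow> ennreal 0"
      by (intro tendsto_ennrealI) real_asymp
    ultimately have "emeasure lebesgue ((\<Inter>k. V k) - A) \<le> ennreal 0"
      by (intro LIMSEQ_le_const) auto
    then show ?thesis using m by auto
  qed
  have "(\<lambda>k. LINT x|lebesgue. indicator (V k) x * f x) \<longlonglongrightarrow> (LINT x|lebesgue. indicator (\<Inter>k. V k) x * f x)"
  proof (rule integral_dominated_convergence[where w = f])
    show "(\<lambda>x. indicator (\<Inter>k. V k) x * f x) \<in> borel_measurable lebesgue"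
      using f V(1) by (intro borel_measurable_times borel_measurable_indicator sets.countable_INT) auto
    show "(\<lambda>x. indicator (V k) x * f x) \<in> borel_measurable lebesgue" for k
      using f V(1) by (intro borel_measurable_times borel_measurable_indicator) auto
    show "AE x in lebesgue. (\<lambda>k. indicator (V k) x * f x) \<longlonglongrightarrow> indicator (\<Inter>k. V k) x * f x"
    proof (intro AE_I2 tendsto_mult tendsto_const)
      have "decseq V" by (auto simp: V_def decseq_def)
      then show "(\<lambda>k. indicator (V k) x :: real) \<longlonglongrightarrow> indicator (\<Inter>k. V k) x" for x
        by (rule LIMSEQ_indicator_decseq)
    qed
  qed (use f in \<open>auto simp: indicator_def\<close>)
  moreover have "(LINT x|lebesgue. indicator (\<Inter>k. V k) x * f x) = 0"
  proof (rule integral_eq_zero_AE)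
    show "AE x in lebesgue. indicator (\<Inter>k. V k) x * f x = 0"
      using zero AE_not_in[OF null] by eventually_elim (auto simp: indicator_def)
  qed
  ultimately have "\<forall>\<^sub>F k in sequentially. (LINT x|lebesgue. indicator (V k) x * f x) < e"
    using e by (intro order_tendstoD) auto
  then obtain k where "(LINT x|lebesgue. indicator (V k) x * f x) < e"
    by (auto simp: eventually_sequentially)
  then show ?thesis using V by blast
qed

text \<open>A covering argument instead of a maximal function: around a bad point arbitrarily small
  balls have mass above e * r^n, while such balls can be kept inside an open set that contains the
  zeros of \<open>f\<close> and has tiny mass. A disjoint Vitali subfamily then bounds the outer
  measure of the bad set.\<close>

lemma AE_zero_lebesgue_point:
  fixes f :: "'a::euclidean_space \<Rightarrow> real"
  assumes f: "integrable lebesgue f" "\<And>x. 0 \<le> f x"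
  shows "AE x in lebesgue. f x = 0 \<longrightarrow> (\<forall>e>0. \<exists>d>0. \<forall>r. 0 < r \<and> r < d \<longrightarrow>
     (LINT z|lebesgue. indicator (ball x r) z * f z) \<le> e * r ^ DIM('a))"
proof -
  define I where "I x r = (LINT z|lebesgue. indicator (ball x r) z * f z)" for x r
  define bad where "bad e = {x. f x = 0 \<and> (\<forall>d>0. \<exists>r. 0 < r \<and> r < d \<and> I x r > e * r ^ DIM('a))}" for e :: real
  have fm[measurable]: "f \<in> borel_measurable lebesgue" using f by auto
  have intf: "integrable lebesgue (\<lambda>z. indicator B z * f z)" if "B \<in> sets lebesgue" for B
    using integrable_real_mult_indicator[OF that f(1)] by (simp add: mult.commute)
  \<comment> \<open>The mass as a measure, so that adding up over disjoint balls is countable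
    additivity.\<close>
  define \<nu> where "\<nu> = density lebesgue (\<lambda>x. ennreal (f x))"
  have \<nu>: "emeasure \<nu> B = ennreal (LINT z|lebesgue. indicator B z * f z)" if "B \<in> sets lebesgue" for B
  proof -
    have "emeasure \<nu> B = (\<integral>\<^sup>+z. ennreal (indicator B z * f z) \<partial>lebesgue)"
      unfolding \<nu>_def using that by (subst emeasure_density) (auto intro!: nn_integral_cong simp: indicator_def)
    then show ?thesis using intf[OF that] f(2) by (simp add: nn_integral_eq_integral)
  qed
  have neg: "negligible (bad e)" if e: "0 < e" for e
  proof (rule negligible_outer_le[THEN iffD2], intro allI impI)
    fix \<epsilon> :: real assume \<epsilon>: "0 < \<epsilon>"
    \<comment> \<open>A ball of the family has volume at most \<omega> / e times its mass; therefore
      the open set is chosen with mass below e * \<epsilon> / \<omega>.\<close>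
    define \<omega> where "\<omega> = measure lborel (ball (0::'a) 1)"
    have \<omega>: "0 < \<omega>" by (simp add: \<omega>_def content_ball_pos)
    have "\<exists>U. open U \<and> {x. f x = 0} \<subseteq> U \<and> (LINT x|lebesgue. indicator U x * f x) < e * \<epsilon> / \<omega>"
    proof (rule ex_open_small_nn_integral[OF f])
      show "{x. f x = 0} \<in> sets lebesgue"
        using measurable_sets[OF fm, of "{0}"] by (simp add: vimage_def)
    qed (use e \<epsilon> \<omega> in auto)
    then obtain U where U: "open U" "{x. f x = 0} \<subseteq> U" "(LINT x|lebesgue. indicator U x * f x) < e * \<epsilon> / \<omega>"
      by blast
    define K where "K = {(x, r). 0 < r \<and> ball x r \<subseteq> U \<and> I x r > e * r ^ DIM('a)}"
    have "\<exists>i. i \<in> K \<and> x \<in> ball (fst i) (snd i) \<and> snd i < d" if x: "x \<in> bad e" and d: "0 < d" for x d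
    proof -
      have "x \<in> U" using x U by (auto simp: bad_def)
      then obtain d' where d': "d' > 0" "ball x d' \<subseteq> U" using U(1) by (meson openE)
      have "0 < min d d'" using d d' by simp
      then obtain r where r: "0 < r" "r < min d d'" "I x r > e * r ^ DIM('a)"
        using x unfolding bad_def by blast
      have "ball x r \<subseteq> U" using d'(2) r(2) subset_ball[of r d' x] by auto
      then have "(x, r) \<in> K" using r by (auto simp: K_def)
      then show ?thesis using r by (intro exI[of _ "(x, r)"]) auto
    qed
    then obtain C where C: "countable C" "C \<subseteq> K"
      "pairwise (\<lambda>i j. disjnt (ball (fst i) (snd i)) (ball (fst j) (snd j))) C"
      "negligible (bad e - (\<Union>i \<in> C. ball (fst i) (snd i)))"
      using Vitali_covering_theorem_balls[of "bad e" K fst snd] by blast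
    define B where "B i = ball (fst i) (snd i)" for i :: "'a \<times> real"
    have Bm: "B i \<in> sets lebesgue" for i by (simp add: B_def)
    have disj: "disjoint_family_on B C"
      using C(3) by (auto simp: disjoint_family_on_def pairwise_def disjnt_def B_def)
    have sm: "(\<Union>i\<in>C. B i) \<in> sets lebesgue" using C(1) Bm by (intro sets.countable_UN') auto
    have one: "emeasure lebesgue (B i) \<le> ennreal (\<omega> / e) * emeasure \<nu> (B i)" if "i \<in> C" for i
    proof -
      obtain x r where i: "i = (x, r)" by (cases i)
      have r: "0 < r" "I x r > e * r ^ DIM('a)" using C(2) that by (auto simp: K_def i)
      have "emeasure lebesgue (B i) = ennreal (r ^ DIM('a) * \<omega>)"
        using emeasure_lebesgue_ball_conv_unit_ball[of r x] content_ball_conv_unit_ball[of r x] r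
          emeasure_lborel_ball_finite[of x r]
        by (simp add: B_def i \<omega>_def emeasure_eq_ennreal_measure)
      also have "\<dots> \<le> ennreal (\<omega> / e * I x r)"
        using r e \<omega> by (intro ennreal_leI) (simp add: field_simps)
      also have "\<dots> = ennreal (\<omega> / e) * emeasure \<nu> (B i)"
        using e \<omega> ennreal_mult'[of "\<omega> / e" "I x r"] by (subst \<nu>) (auto simp: B_def i I_def)
      finally show ?thesis .
    qed
    have "emeasure lebesgue (\<Union>i\<in>C. B i) = (\<integral>\<^sup>+i. emeasure lebesgue (B i) \<partial>count_space C)"
      by (rule emeasure_UN_countable) (use C(1) Bm disj in auto)
    also have "\<dots> \<le> (\<integral>\<^sup>+i. ennreal (\<omega> / e) * emeasure \<nu> (B i) \<partial>count_space C)"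
      by (rule nn_integral_mono) (use one in auto)
    also have "\<dots> = ennreal (\<omega> / e) * (\<integral>\<^sup>+i. emeasure \<nu> (B i) \<partial>count_space C)"
      by (rule nn_integral_cmult) auto
    also have "(\<integral>\<^sup>+i. emeasure \<nu> (B i) \<partial>count_space C) = emeasure \<nu> (\<Union>i\<in>C. B i)"
      by (rule emeasure_UN_countable[symmetric]) (use C(1) Bm disj in \<open>auto simp: \<nu>_def\<close>)
    also have "\<dots> \<le> emeasure \<nu> U"
    proof (rule emeasure_mono)
      have "B i \<subseteq> U" if "i \<in> C" for i
      proof -
        have "i \<in> K" using that C(2) by blast
        then show ?thesis by (cases i) (simp add: B_def K_def)
      qed
      then show "(\<Union>i\<in>C. B i) \<subseteq> U" by blast
    qed (use U(1) in \<open>simp add: \<nu>_def\<close>)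
    also have "\<dots> = ennreal (LINT x|lebesgue. indicator U x * f x)" using U(1) by (subst \<nu>) auto
    also have "ennreal (\<omega> / e) * \<dots> \<le> ennreal (\<omega> / e) * ennreal (e * \<epsilon> / \<omega>)"
      using U(3) by (intro mult_left_mono ennreal_leI) auto
    also have "\<dots> = ennreal \<epsilon>" using e \<epsilon> \<omega> by (subst ennreal_mult'[symmetric]) auto
    finally have le: "emeasure lebesgue (\<Union>i\<in>C. B i) \<le> ennreal \<epsilon>" by (auto simp: mult_left_mono)
    then have lm: "(\<Union>i\<in>C. B i) \<in> lmeasurable"
      using sm by (intro fmeasurableI) (auto simp: ennreal_less_top le_less_trans)
    let ?T = "(\<Union>i\<in>C. B i) \<union> (bad e - (\<Union>i\<in>C. B i))"
    have N: "bad e - (\<Union>i\<in>C. B i) \<in> null_sets lebesgue"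
      using C(4) by (simp add: B_def negligible_iff_null_sets)
    have "emeasure lebesgue ?T = emeasure lebesgue (\<Union>i\<in>C. B i)"
      by (rule emeasure_Un_null_set[OF sm N])
    moreover have Ts: "?T \<in> sets lebesgue" using sm N by blast
    ultimately have "?T \<in> lmeasurable" "measure lebesgue ?T \<le> \<epsilon>"
      using le \<epsilon> lm by (auto intro!: fmeasurableI simp: fmeasurable_def measure_def enn2real_leI)
    then show "\<exists>T. bad e \<subseteq> T \<and> T \<in> lmeasurable \<and> measure lebesgue T \<le> \<epsilon>"
      by (intro exI[of _ ?T]) auto
  qed
  have "negligible (\<Union>k. bad (1 / Suc k))" by (rule negligible_Union_nat) (use neg in auto)
  then have "AE x in lebesgue. x \<notin> (\<Union>k. bad (1 / Suc k))"
    unfolding negligible_iff_null_sets by (rule AE_not_in)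
  then show ?thesis
  proof eventually_elim
    case (elim x)
    show ?case
    proof (intro impI allI)
      fix e :: real assume 0: "f x = 0" and e: "0 < e"
      obtain k where k: "1 / Suc k < e" using e nat_approx_posE by blast
      have nb: "x \<notin> bad (1 / Suc k)" using elim by blast
      then obtain d where d: "d > 0" "\<And>r. 0 < r \<Longrightarrow> r < d \<Longrightarrow> I x r \<le> 1 / Suc k * r ^ DIM('a)"
      proof -
        have "\<not> (\<forall>d>0. \<exists>r. 0 < r \<and> r < d \<and> I x r > 1 / Suc k * r ^ DIM('a))"
          using nb 0 unfolding bad_def by blast
        then show ?thesis using that by (meson not_less)
      qed
      have "I x r \<le> e * r ^ DIM('a)" if "0 < r" "r < d" for r
        using d(2)[OF that] mult_right_mono[OF less_imp_le[OF k], of "r ^ DIM('a)"] that by simp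
      then show "\<exists>d>0. \<forall>r. 0 < r \<and> r < d \<longrightarrow> (LINT z|lebesgue. indicator (ball x r) z * f z) \<le> e * r ^ DIM('a)"
        using d(1) unfolding I_def by blast
    qed
  qed
qed

lemma add_powr_le:
  fixes a b p :: real
  assumes "0 \<le> a" "0 \<le> b" "0 \<le> p"
  shows "(a + b) powr p \<le> 2 powr p * (a powr p + b powr p)"
proof -
  have "(a + b) powr p \<le> (2 * max a b) powr p"
    using assms by (intro powr_mono2) auto
  also have "\<dots> = 2 powr p * (max a b) powr p" using assms by (simp add: powr_mult)
  also have "(max a b) powr p \<le> a powr p + b powr p" by (auto simp: max_def)
  finally show ?thesis by (simp add: mult_left_mono)
qed

lemma integrable_powr_diff_const:
  fixes g :: "'a::euclidean_space \<Rightarrow> 'b::euclidean_space"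
  assumes \<Omega>: "\<Omega> \<in> lmeasurable" and gm: "g \<in> borel_measurable (lebesgue_on \<Omega>)"
    and gp: "integrable (lebesgue_on \<Omega>) (\<lambda>x. norm (g x) powr p)" and p: "0 \<le> p"
  shows "integrable (lebesgue_on \<Omega>) (\<lambda>z. norm (g z - q) powr p)"
proof (rule Bochner_Integration.integrable_bound)
  show "integrable (lebesgue_on \<Omega>) (\<lambda>z. 2 powr p * (norm (g z) powr p + norm q powr p))"
    using gp \<Omega> by (intro integrable_mult_right Bochner_Integration.integrable_add
        finite_measure.integrable_const finite_measure_lebesgue_on) auto
  show "(\<lambda>z. norm (g z - q) powr p) \<in> borel_measurable (lebesgue_on \<Omega>)"
    using gm by measurable
  have "norm (g z - q) powr p \<le> 2 powr p * (norm (g z) powr p + norm q powr p)" for z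
    using p add_powr_le[of "norm (g z)" "norm q" p] powr_mono2[of p "norm (g z - q)" "norm (g z) + norm q"]
      norm_triangle_ineq4[of "g z" q] by simp
  then show "AE x in lebesgue_on \<Omega>. norm (norm (g x - q) powr p) \<le> norm (2 powr p * (norm (g x) powr p + norm q powr p))"
    by (intro AE_I2) simp
qed

text \<open>Reduction to points where a nonnegative function vanishes. For each \<open>x\<close>
  some \<open>q\<close> in a countable dense set is so close to \<open>g x\<close> that the
  truncated function \<open>F q s\<close> vanishes at \<open>x\<close>; outside countably many null
  sets all these functions have small means there, and the truncation costs only
  \<open>s\<close>.\<close>

lemma AE_lebesgue_point:
  fixes g :: "'a::euclidean_space \<Rightarrow> 'b::euclidean_space"
  assumes \<Omega>: "open \<Omega>" "\<Omega> \<in> lmeasurable" and p: "1 \<le> p"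
    and gm: "g \<in> borel_measurable (lebesgue_on \<Omega>)"
    and gp: "integrable (lebesgue_on \<Omega>) (\<lambda>x. norm (g x) powr p)"
  shows "AE x in lebesgue_on \<Omega>. \<forall>e>0. \<exists>d>0. \<forall>r. 0 < r \<and> r < d \<longrightarrow> ball x r \<subseteq> \<Omega> \<and>
     integrable (lebesgue_on (ball x r)) (\<lambda>z. norm (g z - g x) powr p) \<and>
     (LINT z|lebesgue_on (ball x r). norm (g z - g x) powr p) \<le> e * r ^ DIM('a)"
proof -
  have \<Omega>s: "\<Omega> \<in> sets lebesgue" using \<Omega> by auto
  obtain D :: "'b set" where D: "countable D" "\<And>X. open X \<Longrightarrow> X \<noteq> {} \<Longrightarrow> \<exists>d\<in>D. d \<in> X"
    by (rule countable_dense_setE) blast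
  have intp: "integrable (lebesgue_on \<Omega>) (\<lambda>z. norm (g z - q) powr p)" for q
    using \<Omega>(2) gm gp p by (intro integrable_powr_diff_const) auto
  \<comment> \<open>\<open>F q s\<close> is zero where |g - q|^p is at most \<open>s\<close>, and on
    \<open>\<Omega>\<close> the bound |g - q|^p \<le> F q s + s holds.\<close>
  define F where "F q s z = indicator \<Omega> z * max (norm (g z - q) powr p - s) 0" for q and s :: real and z
  have Fint: "integrable lebesgue (F q s)" for q s
  proof -
    have "integrable (lebesgue_on \<Omega>) (\<lambda>z. max (norm (g z - q) powr p - s) 0)"
      using intp[of q] \<Omega>(2)
      by (intro integrable_max Bochner_Integration.integrable_diff finite_measure.integrable_const finite_measure_lebesgue_on) auto
    then show ?thesis using \<Omega>s by (simp add: F_def[abs_def] integrable_restrict_space)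
  qed
  define good where "good f x \<longleftrightarrow> f x = 0 \<longrightarrow> (\<forall>e>0. \<exists>d>0. \<forall>r. 0 < r \<and> r < d \<longrightarrow>
     (LINT z|lebesgue. indicator (ball x r) z * f z) \<le> e * r ^ DIM('a))" for f :: "'a \<Rightarrow> real" and x
  have "AE x in lebesgue. \<forall>i\<in>D \<times> (UNIV::nat set). good (F (fst i) (1 / Suc (snd i))) x"
  proof (rule AE_ball_countable')
    fix i
    show "AE x in lebesgue. good (F (fst i) (1 / Suc (snd i))) x"
      unfolding good_def by (rule AE_zero_lebesgue_point[OF Fint]) (simp add: F_def)
  qed (use D(1) in auto)
  then have "AE x in lebesgue_on \<Omega>. \<forall>i\<in>D \<times> (UNIV::nat set). good (F (fst i) (1 / Suc (snd i))) x"
    using \<Omega>s by (subst AE_restrict_space_iff) (auto elim: eventually_mono)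
  moreover have "AE x in lebesgue_on \<Omega>. x \<in> \<Omega>" using \<Omega>s by (auto intro!: AE_I2)
  ultimately show ?thesis
  proof eventually_elim
    case (elim x)
    show ?case
    proof (intro allI impI)
      fix e :: real assume e: "0 < e"
      define \<omega> where "\<omega> = measure lborel (ball (0::'a) 1)"
      have \<omega>: "0 < \<omega>" by (simp add: \<omega>_def content_ball_pos)
      define P where "P = (2::real) powr p"
      have P: "0 < P" by (simp add: P_def)
      \<comment> \<open>Half of \<open>e\<close> is reserved for the constant 2 s: one
        \<open>s\<close> comes from the truncation in \<open>F\<close>, one from the distance
        between \<open>q\<close> and \<open>g x\<close>.\<close>
      obtain m where m: "1 / Suc m < e / (4 * P * \<omega>)"
        using e \<omega> P nat_approx_posE[of "e / (4 * P * \<omega>)"] by auto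
      define s where "s = 1 / Suc m"
      have s: "0 < s" by (simp add: s_def)
      obtain q where q: "q \<in> D" "q \<in> ball (g x) (s powr (1/p))"
        using D(2)[of "ball (g x) (s powr (1/p))"] s by auto
      have qs: "norm (q - g x) powr p \<le> s"
      proof -
        have "norm (q - g x) powr p \<le> (s powr (1/p)) powr p"
          using q p by (intro powr_mono2) (auto simp: dist_norm norm_minus_commute)
        also have "\<dots> = s" using s p by (simp add: powr_powr)
        finally show ?thesis .
      qed
      have "good (F q s) x" using elim(1) q(1) by (force simp: s_def)
      moreover have "F q s x = 0" using qs by (simp add: F_def norm_minus_commute)
      moreover have "0 < e / (2 * P)" using e P by simp
      ultimately obtain d where d: "d > 0" "\<And>r. 0 < r \<Longrightarrow> r < d \<Longrightarrow>
          (LINT z|lebesgue. indicator (ball x r) z * F q s z) \<le> e / (2 * P) * r ^ DIM('a)"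
        unfolding good_def by blast
      obtain d' where d': "d' > 0" "ball x d' \<subseteq> \<Omega>" using elim(2) \<Omega>(1) by (meson openE)
      show "\<exists>d>0. \<forall>r. 0 < r \<and> r < d \<longrightarrow> ball x r \<subseteq> \<Omega> \<and>
        integrable (lebesgue_on (ball x r)) (\<lambda>z. norm (g z - g x) powr p) \<and>
        (LINT z|lebesgue_on (ball x r). norm (g z - g x) powr p) \<le> e * r ^ DIM('a)"
      proof (rule exI[of _ "min d d'"], intro conjI allI impI)
        show "min d d' > 0" using d d' by simp
        fix r assume r: "0 < r \<and> r < min d d'"
        show sub: "ball x r \<subseteq> \<Omega>" using d'(2) r subset_ball[of r d' x] by auto
        have "set_integrable lebesgue \<Omega> (\<lambda>z. norm (g z - g x) powr p)"
          using intp[of "g x"] \<Omega>s by (simp add: integrable_restrict_space set_integrable_def)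
        then have "set_integrable lebesgue (ball x r) (\<lambda>z. norm (g z - g x) powr p)"
          by (rule set_integrable_subset) (use sub in auto)
        then show i1: "integrable (lebesgue_on (ball x r)) (\<lambda>z. norm (g z - g x) powr p)"
          by (simp add: integrable_restrict_space set_integrable_def)
        have iF: "integrable (lebesgue_on (ball x r)) (F q s)"
          using integrable_real_mult_indicator[OF _ Fint[of q s], of "ball x r"]
          by (simp add: integrable_restrict_space mult.commute)
        have c: "integrable (lebesgue_on (ball x r)) (\<lambda>z. 2 * s)"
          by (intro finite_measure.integrable_const finite_measure_lebesgue_on) auto
        have "(LINT z|lebesgue_on (ball x r). norm (g z - g x) powr p) \<le> (LINT z|lebesgue_on (ball x r). P * (F q s z + 2 * s))"
        proof (rule integral_mono[OF i1 integrable_mult_right[OF Bochner_Integration.integrable_add[OF iF c]]])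
          fix z assume "z \<in> space (lebesgue_on (ball x r))"
          then have z: "z \<in> \<Omega>" using sub by auto
          have "norm (g z - g x) powr p \<le> (norm (g z - q) + norm (q - g x)) powr p"
            using p norm_triangle_ineq[of "g z - q" "q - g x"] by (intro powr_mono2) auto
          also have "\<dots> \<le> P * (norm (g z - q) powr p + norm (q - g x) powr p)"
            unfolding P_def using p by (intro add_powr_le) auto
          also have "\<dots> \<le> P * (F q s z + 2 * s)"
            using z qs P by (intro mult_left_mono) (auto simp: F_def)
          finally show "norm (g z - g x) powr p \<le> P * (F q s z + 2 * s)" .
        qed
        also have "\<dots> = P * ((LINT z|lebesgue_on (ball x r). F q s z) + 2 * s * measure lborel (ball x r))"
          using iF c by (simp add: measure_restrict_space)
        also have "(LINT z|lebesgue_on (ball x r). F q s z) = (LINT z|lebesgue. indicator (ball x r) z * F q s z)"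
          by (simp add: integral_restrict_space)
        also have "measure lborel (ball x r) = r ^ DIM('a) * \<omega>"
          using r content_ball_conv_unit_ball[of r x] by (simp add: \<omega>_def)
        also have "P * ((LINT z|lebesgue. indicator (ball x r) z * F q s z) + 2 * s * (r ^ DIM('a) * \<omega>))
           \<le> P * (e / (2 * P) * r ^ DIM('a) + 2 * (e / (4 * P * \<omega>)) * (r ^ DIM('a) * \<omega>))"
          using d(2)[of r] r m P \<omega> by (intro mult_left_mono add_mono mult_right_mono) (auto simp: s_def)
        also have "\<dots> = e * r ^ DIM('a)"
          using P \<omega> by (simp add: field_simps)
        finally show "(LINT z|lebesgue_on (ball x r). norm (g z - g x) powr p) \<le> e * r ^ DIM('a)" .
      qed
    qed
  qed
qed

section \<open>Change of variables for finite index types\<close>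

text \<open>A copy of a finite index type that is given a well-order along an injection into the
  naturals. The change of variables theorem \<open>has_measure_differentiable_image\<close> is
  applied over this copy and its conclusion is carried back along \<open>Rep_wo\<close>.\<close>

typedef (overloaded) ('a::finite) wo = "UNIV :: 'a set" by simp

instance wo :: (finite) finite
proof
  have "(UNIV :: 'a wo set) = Abs_wo ` UNIV"
    by (metis Abs_wo_cases UNIV_I UNIV_eq_I image_eqI)
  then show "finite (UNIV :: 'a wo set)" by (metis finite finite_imageI)
qed

definition wo_index :: "'a::finite wo \<Rightarrow> nat" where
  "wo_index = (SOME f. inj f)"

lemma inj_wo_index: "inj wo_index"
proof -
  have "\<exists>f :: 'a wo \<Rightarrow> nat. inj f"
    using finite_imp_inj_to_nat_seg[of "UNIV :: 'a wo set"] by auto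
  then show ?thesis unfolding wo_index_def by (rule someI_ex)
qed

instantiation wo :: (finite) wellorder
begin

definition less_eq_wo :: "'a wo \<Rightarrow> 'a wo \<Rightarrow> bool" where
  "less_eq_wo x y \<longleftrightarrow> wo_index x \<le> wo_index y"

definition less_wo :: "'a wo \<Rightarrow> 'a wo \<Rightarrow> bool" where
  "less_wo x y \<longleftrightarrow> wo_index x < wo_index y"

instance
proof
  fix P :: "'a wo \<Rightarrow> bool" and a
  assume *: "\<And>x. (\<And>y. y < x \<Longrightarrow> P y) \<Longrightarrow> P x"
  show "P a"
    by (induction a rule: measure_induct_rule[of wo_index]) (rule *, simp add: less_wo_def)
qed (use inj_wo_index in \<open>auto simp: less_eq_wo_def less_wo_def inj_def\<close>)

end

lemma bij_Rep_wo: "bij Rep_wo"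
  by (metis (full_types) Abs_wo_inverse Rep_wo_inverse UNIV_I bijI' )

text \<open>Conjugation respects composition and carries the transposition of two points to that of
  their preimages, so the sign survives each step of the induction over transpositions.\<close>

lemma sign_conj_bij:
  fixes g :: "'a::finite \<Rightarrow> 'b::finite"
  assumes g: "bij g" and p: "p permutes (UNIV :: 'b set)"
  shows "sign (inv g \<circ> p \<circ> g) = sign p"
  using p finite[of UNIV]
proof (induction p rule: permutes_induct)
  case id
  show ?case using g by (simp add: bij_is_inj)
next
  case (swap a b p)
  have gi: "g (inv g x) = x" "inv g (g y) = y" for x y
    using g by (simp_all add: bij_is_inj bij_is_surj surj_f_inv_f)
  have perm: "permutation q" if "bij q" for q :: "'c::finite \<Rightarrow> 'c"
    using that by (simp add: permutation)
  have bp: "bij p" using swap by (simp add: permutes_bij)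
  have "inv g \<circ> (Transposition.transpose a b \<circ> p) \<circ> g
      = Transposition.transpose (inv g a) (inv g b) \<circ> (inv g \<circ> p \<circ> g)"
    by (auto simp: fun_eq_iff Transposition.transpose_def gi) (metis gi)+
  moreover have "bij (inv g \<circ> p \<circ> g)"
    using g bp by (intro bij_comp bij_imp_bij_inv)
  moreover have "inv g a = inv g b \<longleftrightarrow> a = b" using gi by metis
  ultimately show ?case
    using swap bp by (simp only: sign_compose[OF perm perm] bij_swap_iff bij_id sign_swap_id bij_transpose)
qed

lemma det_reindex:
  fixes A :: "'c::comm_ring_1^'b^'b" and g :: "'a::finite \<Rightarrow> 'b::finite"
  assumes g: "bij g"
  shows "det (\<chi> i j. A $ g i $ g j) = det A"
proof -
  have gi: "g (inv g x) = x" "inv g (g y) = y" for x y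
    using g by (simp_all add: bij_is_inj bij_is_surj surj_f_inv_f)
  let ?c = "\<lambda>p. inv g \<circ> p \<circ> g"
  have bij: "bij_betw ?c {p. p permutes (UNIV::'b set)} {p. p permutes (UNIV::'a set)}"
  proof (rule bij_betw_byWitness[where f' = "\<lambda>q. g \<circ> q \<circ> inv g"])
    show "?c ` {p. p permutes UNIV} \<subseteq> {p. p permutes UNIV}"
      using g by (auto intro!: bij_imp_permutes bij_comp bij_imp_bij_inv dest: permutes_bij)
    show "(\<lambda>q. g \<circ> q \<circ> inv g) ` {p. p permutes UNIV} \<subseteq> {p. p permutes UNIV}"
      using g by (auto intro!: bij_imp_permutes bij_comp bij_imp_bij_inv dest: permutes_bij)
  qed (auto simp: fun_eq_iff gi)
  have "det (\<chi> i j. A $ g i $ g j) = (\<Sum>p | p permutes UNIV. of_int (sign p) * (\<Prod>i\<in>UNIV. A $ g i $ g (p i)))"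
    by (simp add: det_def)
  also have "\<dots> = (\<Sum>p | p permutes UNIV. of_int (sign (?c p)) * (\<Prod>i\<in>UNIV. A $ g i $ g (?c p i)))"
    by (rule sum.reindex_bij_betw[OF bij, symmetric])
  also have "\<dots> = (\<Sum>p | p permutes UNIV. of_int (sign p) * (\<Prod>i\<in>UNIV. A $ i $ p i))"
  proof (rule sum.cong[OF refl])
    fix p assume "p \<in> {p. p permutes (UNIV::'b set)}"
    then have "sign (?c p) = sign p" using sign_conj_bij[OF g] by auto
    moreover have "(\<Prod>i\<in>UNIV. A $ g i $ g (?c p i)) = (\<Prod>i\<in>UNIV. A $ i $ p i)"
      using prod.reindex_bij_betw[OF g, of "\<lambda>i. A $ i $ p i"] by (simp add: gi)
    ultimately show "of_int (sign (?c p)) * (\<Prod>i\<in>UNIV. A $ g i $ g (?c p i)) = of_int (sign p) * (\<Prod>i\<in>UNIV. A $ i $ p i)"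
      by simp
  qed
  finally show ?thesis by (simp add: det_def)
qed

section \<open>Integrals and measures under relabelling of the coordinates\<close>

definition reindex :: "('a \<Rightarrow> 'b) \<Rightarrow> 'c^'b \<Rightarrow> 'c^'a" where
  "reindex g x = (\<chi> i. x $ g i)"

lemma reindex_inverse:
  "bij g \<Longrightarrow> reindex g (reindex (inv g) x) = x"
  "bij g \<Longrightarrow> reindex (inv g) (reindex g y) = y"
  by (simp_all add: reindex_def vec_eq_iff bij_is_inj bij_is_surj surj_f_inv_f)

lemma linear_reindex: "linear (reindex g :: real^'b::finite \<Rightarrow> real^'a::finite)"
  by (rule linearI) (simp_all add: reindex_def vec_eq_iff)

lemma reindex_cbox:
  fixes g :: "'a::finite \<Rightarrow> 'b::finite" and u v :: "real^'b"
  assumes g: "bij g"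
  shows "reindex g ` cbox u v = cbox (reindex g u) (reindex g v)"
    and "measure lborel (reindex g ` cbox u v) = measure lborel (cbox u v)"
proof -
  have all: "(\<forall>i. P (g i)) \<longleftrightarrow> (\<forall>i. P i)" for P using g by (metis bij_pointE)
  have mem: "reindex g x \<in> cbox (reindex g u) (reindex g v) \<longleftrightarrow> x \<in> cbox u v" for x
    using all[of "\<lambda>i. u$i \<le> x$i \<and> x$i \<le> v$i"] by (simp add: mem_box_cart reindex_def)
  show eq: "reindex g ` cbox u v = cbox (reindex g u) (reindex g v)"
  proof (intro equalityI subsetI)
    fix y assume "y \<in> cbox (reindex g u) (reindex g v)"
    then have "reindex (inv g) y \<in> cbox u v" "y = reindex g (reindex (inv g) y)"
      using mem[of "reindex (inv g) y"] by (simp_all only: reindex_inverse(1)[OF g])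
    then show "y \<in> reindex g ` cbox u v" by blast
  qed (use mem in auto)
  show "measure lborel (reindex g ` cbox u v) = measure lborel (cbox u v)"
  proof (cases "cbox u v = {}")
    case False
    then have ne: "cbox (reindex g u) (reindex g v) \<noteq> {}" unfolding eq[symmetric] by simp
    have "(\<Prod>i\<in>UNIV. reindex g v $ i - reindex g u $ i) = (\<Prod>i\<in>UNIV. v $ i - u $ i)"
      using prod.reindex_bij_betw[OF g, of "\<lambda>i. v$i - u$i"] by (simp add: reindex_def)
    then show ?thesis
      unfolding eq content_cbox_cart[OF False] content_cbox_cart[OF ne] by simp
  qed simp
qed

text \<open>Relabelling coordinates maps boxes to boxes of the same content, which is what
  \<open>has_integral_twiddle\<close> asks for, with scaling factor 1.\<close>

lemma has_integral_reindex:
  fixes g :: "'a::finite \<Rightarrow> 'b::finite" and f :: "real^'b \<Rightarrow> real"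
  assumes g: "bij g" and f: "(f has_integral I) (cbox a b)"
  shows "((\<lambda>x. f (reindex (inv g) x)) has_integral I) (reindex g ` cbox a b)"
proof -
  have gi: "bij (inv g)" using g by (rule bij_imp_bij_inv)
  have "((\<lambda>x. f (reindex (inv g) x)) has_integral (1/1) *\<^sub>R I) (reindex g ` cbox a b)"
  proof (rule has_integral_twiddle)
    show "(f has_integral I) (cbox a b)" by (rule f)
    show "isCont (reindex (inv g) :: real^'a \<Rightarrow> real^'b) x" for x
      using linear_continuous_at[OF linear_linear[THEN iffD2, OF linear_reindex]] by (simp add: isCont_def continuous_at)
    show "\<exists>w z. reindex (inv g) ` cbox u v = cbox w z" for u v :: "real^'a"
      using reindex_cbox(1)[OF gi] by blast
    show "\<exists>w z. reindex g ` cbox u v = cbox w z" for u v :: "real^'b"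
      using reindex_cbox(1)[OF g] by blast
    show "measure lborel (reindex (inv g) ` cbox u v) = 1 * measure lborel (cbox u v)" for u v :: "real^'a"
      using reindex_cbox(2)[OF gi] by simp
  qed (simp_all add: reindex_inverse[OF g])
  then show ?thesis by simp
qed

lemma has_integral_reindex_bounded:
  fixes g :: "'a::finite \<Rightarrow> 'b::finite" and f :: "real^'b \<Rightarrow> real"
  assumes g: "bij g" and f: "(f has_integral I) S" and S: "bounded S"
  shows "((\<lambda>x. f (reindex (inv g) x)) has_integral I) (reindex g ` S)"
proof -
  obtain a b where ab: "S \<subseteq> cbox a b" using bounded_subset_cbox_symmetric[OF S] by blast
  then have "((\<lambda>x. if x \<in> S then f x else 0) has_integral I) (cbox a b)"
    using f by (simp add: has_integral_restrict)
  from has_integral_reindex[OF g this]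
  have "((\<lambda>x. if reindex (inv g) x \<in> S then f (reindex (inv g) x) else 0) has_integral I) (reindex g ` cbox a b)" .
  moreover have "reindex (inv g) x \<in> S \<longleftrightarrow> x \<in> reindex g ` S" for x
  proof
    assume "reindex (inv g) x \<in> S"
    then have "reindex g (reindex (inv g) x) \<in> reindex g ` S" by (rule imageI)
    then show "x \<in> reindex g ` S" by (simp only: reindex_inverse(1)[OF g])
  next
    assume "x \<in> reindex g ` S"
    then obtain y where "y \<in> S" "x = reindex g y" by blast
    then show "reindex (inv g) x \<in> S" by (simp only: reindex_inverse(2)[OF g])
  qed
  ultimately have "((\<lambda>x. if x \<in> reindex g ` S then f (reindex (inv g) x) else 0) has_integral I) (reindex g ` cbox a b)"
    by simp
  then show ?thesis using ab by (subst (asm) has_integral_restrict) auto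
qed

lemma has_integral_reindex_iff:
  fixes g :: "'a::finite \<Rightarrow> 'b::finite" and f :: "real^'b \<Rightarrow> real"
  assumes g: "bij g" and S: "bounded S"
  shows "((\<lambda>x. f (reindex (inv g) x)) has_integral I) (reindex g ` S) \<longleftrightarrow> (f has_integral I) S"
proof
  have gi: "bij (inv g)" using g by (rule bij_imp_bij_inv)
  have b: "bounded (reindex g ` S)" 
    using S linear_reindex[of g] by (simp add: bounded_linear_image linear_linear)
  assume "((\<lambda>x. f (reindex (inv g) x)) has_integral I) (reindex g ` S)"
  from has_integral_reindex_bounded[OF gi this b]
  show "(f has_integral I) S"
    unfolding image_comp o_def inv_inv_eq[OF g] reindex_inverse(2)[OF g] by simp
qed (rule has_integral_reindex_bounded[OF g _ S])

lemma lmeasurable_reindex: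
  fixes g :: "'a::finite \<Rightarrow> 'b::finite" and S :: "(real^'b) set"
  assumes g: "bij g" and S: "bounded S"
  shows "(reindex g ` S \<in> lmeasurable \<and> measure lebesgue (reindex g ` S) = m) \<longleftrightarrow> (S \<in> lmeasurable \<and> measure lebesgue S = m)"
proof -
  have *: "T \<in> lmeasurable \<and> measure lebesgue T = m \<longleftrightarrow> ((\<lambda>x. 1::real) has_integral m) T" for T :: "(real^'c::finite) set"
    by (metis has_integral_integrable_integral lmeasurable_iff_integrable_on lmeasure_integral)
  show ?thesis unfolding * using has_integral_reindex_iff[OF assms, of "\<lambda>x. 1" m] by simp
qed

text \<open>The library has this for index types of class \<open>wellorder\<close> only.\<close>

lemma has_measure_differentiable_image_finite:
  fixes f :: "real^'n::finite \<Rightarrow> real^'n"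
  assumes S: "S \<in> sets lebesgue" "bounded S" and b: "bounded (f ` S)"
    and f': "\<And>x. x \<in> S \<Longrightarrow> (f has_derivative f' x) (at x within S)"
    and inj: "inj_on f S"
  shows "f ` S \<in> lmeasurable \<and> measure lebesgue (f ` S) = m
     \<longleftrightarrow> ((\<lambda>x. \<bar>det (matrix (f' x))\<bar>) has_integral m) S"
proof -
  define P where "P = (reindex Rep_wo :: real^'n \<Rightarrow> real^'n wo)"
  define Q where "Q = (reindex (inv Rep_wo) :: real^'n wo \<Rightarrow> real^'n)"
  note g = bij_Rep_wo[where 'a = 'n]
  have QP: "Q (P x) = x" for x
    using reindex_inverse[OF g] by (simp add: P_def Q_def)
  have blP: "bounded_linear P" and blQ: "bounded_linear Q"
    by (simp_all add: P_def Q_def linear_reindex linear_linear)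
  \<comment> \<open>The map in relabelled coordinates. Relabelling rows and columns alike leaves the
    determinant unchanged.\<close>
  define F where "F = P \<circ> f \<circ> Q"
  define F' where "F' x = P \<circ> f' (Q x) \<circ> Q" for x
  have img: "F ` (P ` S) = P ` (f ` S)" by (auto simp: F_def QP image_comp o_def)
  have Sm: "S \<in> lmeasurable" using S by (simp add: bounded_set_imp_lmeasurable)
  have PS: "P ` S \<in> sets lebesgue"
    using lmeasurable_reindex[OF g S(2), of "measure lebesgue S"] Sm by (auto simp: P_def)
  have der: "(F has_derivative F' x) (at x within P ` S)" if x: "x \<in> P ` S" for x
  proof -
    have Qx: "Q x \<in> S" "Q ` P ` S = S" using x QP by (auto simp: image_comp o_def)
    have "(f \<circ> Q has_derivative f' (Q x) \<circ> Q) (at x within P ` S)"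
      by (rule diff_chain_within) (use f'[OF Qx(1)] Qx(2) bounded_linear_imp_has_derivative[OF blQ] in auto)
    from diff_chain_within[OF this bounded_linear_imp_has_derivative[OF blP]]
    show ?thesis by (simp add: F_def F'_def o_assoc)
  qed
  have injF: "inj_on F (P ` S)"
    using inj by (auto simp: inj_on_def F_def QP) (metis QP)
  have det: "det (matrix (F' (P x))) = det (matrix (f' x))" if "x \<in> S" for x
  proof -
    have "matrix (F' (P x)) = (\<chi> i j. matrix (f' x) $ Rep_wo i $ Rep_wo j)"
    proof -
      have Qax: "Q (axis j 1) = axis (Rep_wo j) 1" for j
        using g by (auto simp: Q_def reindex_def axis_def vec_eq_iff) 
           (metis bij_inv_eq_iff)+
      have "P v $ i = v $ Rep_wo i" for v i by (simp add: P_def reindex_def)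
      then show ?thesis by (simp add: matrix_def F'_def QP vec_eq_iff Qax)
    qed
    then show ?thesis using det_reindex[OF g] by simp
  qed
  have "f ` S \<in> lmeasurable \<and> measure lebesgue (f ` S) = m \<longleftrightarrow>
      F ` (P ` S) \<in> lmeasurable \<and> measure lebesgue (F ` (P ` S)) = m"
    unfolding img unfolding P_def by (rule lmeasurable_reindex[OF g b, symmetric])
  also have "\<dots> \<longleftrightarrow> ((\<lambda>x. \<bar>det (matrix (F' x))\<bar>) has_integral m) (P ` S)"
    by (rule has_measure_differentiable_image[OF PS der injF])
  also have "\<dots> \<longleftrightarrow> ((\<lambda>x. \<bar>det (matrix (f' (Q x)))\<bar>) has_integral m) (P ` S)"
    by (rule has_integral_cong) (auto simp: det QP)
  also have "\<dots> \<longleftrightarrow> ((\<lambda>x. \<bar>det (matrix (f' x))\<bar>) has_integral m) S"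
    unfolding P_def Q_def by (rule has_integral_reindex_iff[OF g S(2)])
  finally show ?thesis .
qed

section \<open>Weak gradients\<close>

lemma integrable_times_compact:
  fixes f :: "'a::euclidean_space \<Rightarrow> real"
  assumes "continuous_on K f" "compact K" "K \<subseteq> \<Omega>" "\<Omega> \<in> sets lebesgue" "\<And>x. x \<in> \<Omega> - K \<Longrightarrow> f x = 0"
  shows "integrable (lebesgue_on \<Omega>) f"
proof -
  have K: "K \<in> sets lebesgue" using assms(2) by (simp add: lmeasurable_compact fmeasurableD)
  have "integrable lborel (\<lambda>x. indicator K x *\<^sub>R f x)"
    by (rule borel_integrable_compact[OF assms(2,1)])
  then have "integrable lebesgue (\<lambda>x. indicator K x *\<^sub>R f x)" by (simp add: integrable_completion)
  then have "integrable (lebesgue_on K) f" using K by (simp add: integrable_restrict_space)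
  then show ?thesis
    by (subst integrable_lebesgue_on_support[of K]) (use assms K in auto)
qed

lemma test_functionD:
  fixes \<phi> :: "real^'n::finite \<Rightarrow> real"
  assumes "test_function \<Omega> \<phi>"
  shows test_function_differentiable: "\<phi> differentiable (at x)"
    and test_function_continuous: "continuous_on S \<phi>"
    and test_function_continuous_deriv: "continuous_on S (partial_deriv j \<phi>)"
    and test_function_support: "\<exists>K. compact K \<and> K \<subseteq> \<Omega> \<and> (\<forall>x. x \<notin> K \<longrightarrow> \<phi> x = 0 \<and> (\<forall>j. partial_deriv j \<phi> x = 0))"
proof -
  have td: "times_differentiable k \<phi>" for k using assms by (simp add: test_function_def)
  have d: "\<phi> differentiable (at x)" for x using td[of "Suc 0"] by simp
  then show "\<phi> differentiable (at x)" .
  show "continuous_on S \<phi>"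
    using d by (intro differentiable_imp_continuous_on) (auto simp: differentiable_on_def differentiable_at_withinI)
  have "partial_deriv j \<phi> differentiable (at x)" for x using td[of "Suc (Suc 0)"] by simp
  then show "continuous_on S (partial_deriv j \<phi>)"
    by (intro differentiable_imp_continuous_on) (auto simp: differentiable_on_def differentiable_at_withinI)
  let ?K = "closure {x. \<phi> x \<noteq> 0}"
  have 0: "\<phi> x = 0" if "x \<notin> ?K" for x using that closure_subset[of "{x. \<phi> x \<noteq> 0}"] by blast
  have pd0: "partial_deriv j \<phi> x = 0" if "x \<notin> ?K" for x j
  proof -
    have "frechet_derivative \<phi> (at x) = frechet_derivative (\<lambda>x. 0) (at x)"
    proof (rule frechet_derivative_transform_within_open[OF d])
      show "open (- ?K)" by (rule open_Compl) (rule closed_closure)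
      show "x \<in> - ?K" using that by simp
      show "\<phi> z = 0" if "z \<in> - ?K" for z using 0[of z] that by simp
    qed
    then show ?thesis by (simp add: partial_deriv_def)
  qed
  then show "\<exists>K. compact K \<and> K \<subseteq> \<Omega> \<and> (\<forall>x. x \<notin> K \<longrightarrow> \<phi> x = 0 \<and> (\<forall>j. partial_deriv j \<phi> x = 0))"
  proof (intro exI[of _ ?K] conjI allI impI)
    show "compact ?K" "?K \<subseteq> \<Omega>" using assms by (simp_all add: test_function_def)
    fix x j assume "x \<notin> ?K"
    then show "\<phi> x = 0" "partial_deriv j \<phi> x = 0" by (rule 0, rule pd0)
  qed
qed

lemma partial_deriv_along_line:
  fixes \<psi> :: "real^'n::finite \<Rightarrow> real"
  assumes "\<psi> differentiable (at (x + s *\<^sub>R axis j 1))"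
  shows "((\<lambda>s. \<psi> (x + s *\<^sub>R axis j 1)) has_real_derivative partial_deriv j \<psi> (x + s *\<^sub>R axis j 1)) (at s)"
proof -
  have 1: "((\<lambda>s. x + s *\<^sub>R axis j 1) has_derivative (\<lambda>s. s *\<^sub>R axis j (1::real))) (at s)"
    by (auto intro!: derivative_eq_intros)
  have 2: "(\<psi> has_derivative frechet_derivative \<psi> (at (x + s *\<^sub>R axis j 1))) (at (x + s *\<^sub>R axis j 1))"
    using assms frechet_derivative_works by blast
  have lin: "linear (frechet_derivative \<psi> (at (x + s *\<^sub>R axis j 1)))"
    by (rule linear_frechet_derivative[OF assms])
  show ?thesis
    using has_derivative_compose[OF 1 2]
    by (simp add: has_field_derivative_def partial_deriv_def linear_scale[OF lin] mult.commute[of _ "frechet_derivative _ _ _"])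
qed

text \<open>Difference quotients have integral zero by translation invariance and converge,
  dominated, to the partial derivative. No iterated integral is involved.\<close>

lemma lint_partial_deriv_eq_0:
  fixes \<psi> :: "real^'n::finite \<Rightarrow> real"
  assumes d: "\<And>x. \<psi> differentiable (at x)" and c: "continuous_on UNIV (partial_deriv j \<psi>)"
    and R: "\<And>x. norm x > R \<Longrightarrow> \<psi> x = 0"
  shows "(LINT x|lborel. partial_deriv j \<psi> x) = 0"
proof -
  let ?e = "axis j (1::real) :: real^'n"
  have cont: "continuous_on UNIV \<psi>"
    using d by (intro differentiable_imp_continuous_on) (auto simp: differentiable_on_def)
  have "compact (partial_deriv j \<psi> ` cball 0 (R + 2))"
    by (intro compact_continuous_image continuous_on_subset[OF c]) auto
  then obtain B where B: "\<And>x. norm x \<le> R + 2 \<Longrightarrow> \<bar>partial_deriv j \<psi> x\<bar> \<le> B"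
    using compact_imp_bounded bounded_iff by (metis imageI mem_cball_0 real_norm_def)
  have intpsi: "integrable lborel \<psi>"
  proof -
    have "integrable lborel (\<lambda>x. indicator (cball 0 R) x *\<^sub>R \<psi> x)"
      by (intro borel_integrable_compact continuous_on_subset[OF cont]) auto
    also have "(\<lambda>x. indicator (cball 0 R) x *\<^sub>R \<psi> x) = \<psi>"
      using R by (auto simp: indicator_def fun_eq_iff not_le)
    finally show ?thesis .
  qed
  define f where "f k x = (\<psi> (x + (1 / Suc k) *\<^sub>R ?e) - \<psi> x) / (1 / Suc k)" for k :: nat and x
  have tr: "integrable lborel (\<lambda>x. \<psi> (x + v)) \<and> (LINT x|lborel. \<psi> (x + v)) = (LINT x|lborel. \<psi> x)" for v
  proof -
    have m: "\<psi> \<in> borel_measurable borel" using cont by (rule borel_measurable_continuous_onI)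
    have "integrable (distr lborel borel ((+) v)) \<psi>" unfolding lborel_distr_plus by (rule intpsi)
    then have "integrable lborel (\<lambda>x. \<psi> (v + x))" by (subst (asm) integrable_distr_eq) (use m in auto)
    moreover have "(LINT x|distr lborel borel ((+) v). \<psi> x) = (LINT x|lborel. \<psi> (v + x))"
      by (rule integral_distr) (use m in auto)
    ultimately show ?thesis by (simp add: lborel_distr_plus add.commute)
  qed
  have f0: "(LINT x|lborel. f k x) = 0" for k
    unfolding f_def using tr[of "(1 / Suc k) *\<^sub>R ?e"] intpsi by simp
  have "(\<lambda>k. LINT x|lborel. f k x) \<longlonglongrightarrow> (LINT x|lborel. partial_deriv j \<psi> x)"
  \<comment> \<open>The shifts have length at most 1: the quotients vanish outside radius R + 1, and
    inside it the mean value theorem evaluates the derivative within radius R + 2, where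
    \<open>B\<close> bounds it.\<close>
  proof (rule integral_dominated_convergence[where w = "\<lambda>x. indicator (cball 0 (R+1)) x *\<^sub>R B"])
    show "partial_deriv j \<psi> \<in> borel_measurable lborel"
      using borel_measurable_continuous_onI[OF c] by simp
    show "f k \<in> borel_measurable lborel" for k
      using tr[of "(1 / Suc k) *\<^sub>R ?e"] intpsi unfolding f_def by (intro borel_measurable_divide borel_measurable_diff) auto
    show "integrable lborel (\<lambda>x. indicator (cball 0 (R+1)) x *\<^sub>R B)"
      by (intro borel_integrable_compact) auto
    show "AE x in lborel. (\<lambda>k. f k x) \<longlonglongrightarrow> partial_deriv j \<psi> x"
    proof (intro AE_I2)
      fix x
      have "((\<lambda>s. \<psi> (x + s *\<^sub>R ?e)) has_real_derivative partial_deriv j \<psi> (x + 0 *\<^sub>R ?e)) (at 0)"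
        by (rule partial_deriv_along_line) (simp add: d)
      then have "((\<lambda>h. (\<psi> (x + h *\<^sub>R ?e) - \<psi> x) / h) \<longlongrightarrow> partial_deriv j \<psi> x) (at 0)"
        by (simp add: DERIV_def)
      moreover have "filterlim (\<lambda>k. 1 / real (Suc k)) (at 0) sequentially"
        unfolding filterlim_at using LIMSEQ_inverse_real_of_nat by (auto simp: inverse_eq_divide)
      ultimately show "(\<lambda>k. f k x) \<longlonglongrightarrow> partial_deriv j \<psi> x"
        unfolding f_def by (rule filterlim_compose)
    qed
    show "AE x in lborel. norm (f k x) \<le> indicator (cball 0 (R+1)) x *\<^sub>R B" for k
    proof (intro AE_I2)
      fix x :: "real^'n"
      define s where "s = 1 / real (Suc k)"
      have s: "0 < s" "s \<le> 1" by (auto simp: s_def)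
      have fk: "f k x = (\<psi> (x + s *\<^sub>R ?e) - \<psi> x) / s" by (simp only: f_def s_def)
      have ns: "norm (z *\<^sub>R ?e) = \<bar>z\<bar>" for z by simp
      show "norm (f k x) \<le> indicator (cball 0 (R+1)) x *\<^sub>R B"
      proof (cases "norm x \<le> R + 1")
        case True
        have "((\<lambda>s. \<psi> (x + s *\<^sub>R ?e)) has_real_derivative partial_deriv j \<psi> (x + z *\<^sub>R ?e)) (at z)" for z
          by (rule partial_deriv_along_line) (rule d)
        then obtain z where z: "0 < z" "z < s" "\<psi> (x + s *\<^sub>R ?e) - \<psi> (x + 0 *\<^sub>R ?e) = (s - 0) * partial_deriv j \<psi> (x + z *\<^sub>R ?e)"
          using MVT2[of 0 s "\<lambda>s. \<psi> (x + s *\<^sub>R ?e)" "\<lambda>z. partial_deriv j \<psi> (x + z *\<^sub>R ?e)"] s by auto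
        have "norm (x + z *\<^sub>R ?e) \<le> R + 2"
          using norm_triangle_ineq[of x "z *\<^sub>R ?e"] ns[of z] z s True by simp
        then have "\<bar>partial_deriv j \<psi> (x + z *\<^sub>R ?e)\<bar> \<le> B" by (rule B)
        moreover have "f k x = partial_deriv j \<psi> (x + z *\<^sub>R ?e)"
          unfolding fk using z(3) s by simp
        ultimately show ?thesis using True by simp
      next
        case False
        have "norm x - norm (s *\<^sub>R ?e) \<le> norm (x + s *\<^sub>R ?e)" by (rule norm_diff_ineq)
        then have "\<psi> (x + s *\<^sub>R ?e) = 0" "\<psi> x = 0" using False R ns[of s] s by auto
        then show ?thesis using False by (simp add: fk)
      qed
    qed
  qed
  then have "(\<lambda>k. 0::real) \<longlonglongrightarrow> (LINT x|lborel. partial_deriv j \<psi> x)" by (simp only: f0)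
  then show ?thesis using LIMSEQ_unique[OF tendsto_const] by force
qed

text \<open>The product of the affine function with \<open>\<phi>\<close> is compactly supported, so
  its partial derivative integrates to zero; the product rule splits this integral into the two
  sides.\<close>

lemma weak_grad_affine:
  fixes \<Omega> :: "(real^'n::finite) set"
  assumes \<Omega>: "\<Omega> \<in> sets lebesgue"
  shows "weak_grad \<Omega> (\<lambda>x. q \<bullet> x + c) (\<lambda>x. q)"
  unfolding weak_grad_def
proof (intro allI impI)
  fix \<phi> :: "real^'n \<Rightarrow> real" and j
  assume t: "test_function \<Omega> \<phi>"
  obtain K where K: "compact K" "K \<subseteq> \<Omega>" "\<And>x. x \<notin> K \<Longrightarrow> \<phi> x = 0" "\<And>x j. x \<notin> K \<Longrightarrow> partial_deriv j \<phi> x = 0"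
    using test_function_support[OF t] by blast
  define \<psi> where "\<psi> x = (q \<bullet> x + c) * \<phi> x" for x
  have der: "(\<psi> has_derivative (\<lambda>v. (q \<bullet> x + c) * frechet_derivative \<phi> (at x) v + (q \<bullet> v) * \<phi> x)) (at x)" for x
    unfolding \<psi>_def
    using frechet_derivative_works[THEN iffD1, OF test_function_differentiable[OF t, of x]]
    by (auto intro!: derivative_eq_intros)
  have pd: "partial_deriv j \<psi> = (\<lambda>x. (q \<bullet> x + c) * partial_deriv j \<phi> x + q $ j * \<phi> x)"
    by (rule ext) (simp add: partial_deriv_def frechet_derivative_at[OF der, symmetric] inner_axis)
  have cpd: "continuous_on S (\<lambda>x. (q \<bullet> x + c) * partial_deriv j \<phi> x)" for S
    by (intro continuous_intros test_function_continuous_deriv[OF t])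
  have cp: "continuous_on S (\<lambda>x. q $ j * \<phi> x)" for S
    by (intro continuous_intros test_function_continuous[OF t])
  obtain R where R: "R > 0" "\<And>x. x \<in> K \<Longrightarrow> norm x \<le> R"
    using compact_imp_bounded[OF K(1)] by (auto simp: bounded_pos)
  have "(LINT x|lborel. partial_deriv j \<psi> x) = 0"
  proof (rule lint_partial_deriv_eq_0[where R = R])
    show "\<psi> differentiable at x" for x using der[of x] by (auto simp: differentiable_def)
    show "continuous_on UNIV (partial_deriv j \<psi>)" unfolding pd using cpd cp by (intro continuous_on_add)
    show "\<psi> x = 0" if "norm x > R" for x
      using that R(2)[of x] K(3)[of x] by (auto simp: \<psi>_def)
  qed
  moreover have "(LINT x|lborel. partial_deriv j \<psi> x) = (LINT x|lebesgue_on UNIV. partial_deriv j \<psi> x)"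
    unfolding lebesgue_on_UNIV_eq pd using cpd cp
    by (intro integral_completion[symmetric]) (auto intro!: borel_measurable_continuous_onI continuous_on_add)
  moreover have "(LINT x|lebesgue_on UNIV. partial_deriv j \<psi> x) = (LINT x|lebesgue_on \<Omega>. partial_deriv j \<psi> x)"
    proof (rule lint_lebesgue_on_support)
    show "partial_deriv j \<psi> x = 0" if "x \<in> UNIV - \<Omega>" for x
    proof -
      have "x \<notin> K" using that K(2) by blast
      then show ?thesis by (simp add: pd K(3,4))
    qed
  qed (use \<Omega> in auto)
  moreover have "(LINT x|lebesgue_on \<Omega>. partial_deriv j \<psi> x) = 
      (LINT x|lebesgue_on \<Omega>. (q \<bullet> x + c) * partial_deriv j \<phi> x) + (LINT x|lebesgue_on \<Omega>. q $ j * \<phi> x)"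
    unfolding pd
    by (intro Bochner_Integration.integral_add integrable_times_compact[OF _ K(1,2) \<Omega>] cpd cp) (use K in auto)
  ultimately show "(LINT x|lebesgue_on \<Omega>. (q \<bullet> x + c) * partial_deriv j \<phi> x) = - (LINT x|lebesgue_on \<Omega>. q $ j * \<phi> x)"
    by linarith
qed

lemma integrable_times_test_function:
  fixes g :: "real^'n::finite \<Rightarrow> real"
  assumes g: "locally_integrable \<Omega> g" and \<Omega>: "\<Omega> \<in> sets lebesgue" and t: "test_function \<Omega> \<phi>"
  shows "integrable (lebesgue_on \<Omega>) (\<lambda>x. g x * \<phi> x)"
proof -
  obtain K where K0: "compact K \<and> K \<subseteq> \<Omega> \<and> (\<forall>x. x \<notin> K \<longrightarrow> \<phi> x = 0 \<and> (\<forall>j. partial_deriv j \<phi> x = 0))"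
    using test_function_support[OF t] by (rule exE)
  then have K: "compact K" "K \<subseteq> \<Omega>" "\<And>x. x \<notin> K \<Longrightarrow> \<phi> x = 0" by simp_all
  have Ks: "K \<in> sets lebesgue" using K(1) by (simp add: lmeasurable_compact fmeasurableD)
  have gK: "integrable (lebesgue_on K) g" using g K by (auto simp: locally_integrable_def)
  have "bounded (\<phi> ` K)" by (intro compact_imp_bounded compact_continuous_image test_function_continuous[OF t] K)
  then obtain B where B: "\<And>x. x \<in> K \<Longrightarrow> \<bar>\<phi> x\<bar> \<le> B" by (auto simp: bounded_iff)
  have "integrable (lebesgue_on K) (\<lambda>x. g x * \<phi> x)"
  proof (rule Bochner_Integration.integrable_bound[OF integrable_mult_left[OF integrable_norm[OF gK], of B]])
    show "(\<lambda>x. g x * \<phi> x) \<in> borel_measurable (lebesgue_on K)"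
      by (rule borel_measurable_times[OF borel_measurable_integrable[OF gK]])
         (intro continuous_imp_measurable_on_sets_lebesgue test_function_continuous[OF t] Ks)
    show "AE x in lebesgue_on K. norm (g x * \<phi> x) \<le> norm (norm (g x) * B)"
    proof (intro AE_I2)
      fix x assume "x \<in> space (lebesgue_on K)"
      then have "\<bar>\<phi> x\<bar> \<le> B" using B by simp
      then show "norm (g x * \<phi> x) \<le> norm (norm (g x) * B)"
        by (simp add: abs_mult mult_left_mono)
    qed
  qed
  then show ?thesis
    by (subst integrable_lebesgue_on_support[of K]) (use K \<Omega> Ks in auto)
qed

lemma integrable_times_test_function_deriv:
  fixes \<Omega> :: "(real^'n::finite) set"
  assumes u: "continuous_on \<Omega> u" and \<Omega>: "\<Omega> \<in> sets lebesgue" and t: "test_function \<Omega> \<phi>"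
  shows "integrable (lebesgue_on \<Omega>) (\<lambda>x. u x * partial_deriv j \<phi> x)"
proof -
  obtain K where K0: "compact K \<and> K \<subseteq> \<Omega> \<and> (\<forall>x. x \<notin> K \<longrightarrow> \<phi> x = 0 \<and> (\<forall>j. partial_deriv j \<phi> x = 0))"
    using test_function_support[OF t] by (rule exE)
  then have K: "compact K" "K \<subseteq> \<Omega>" "\<And>x j. x \<notin> K \<Longrightarrow> partial_deriv j \<phi> x = 0" by simp_all
  show ?thesis
    by (intro integrable_times_compact[OF _ K(1,2) \<Omega>] continuous_intros test_function_continuous_deriv[OF t]
         continuous_on_subset[OF u K(2)]) (use K in auto)
qed

lemma locally_integrable_bounded_linear:
  assumes "bounded_linear T" "locally_integrable \<Omega> g"
  shows "locally_integrable \<Omega> (\<lambda>x. T (g x))"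
  using assms(2) unfolding locally_integrable_def by (auto intro: integrable_bounded_linear[OF assms(1)])

lemmas locally_integrable_component = locally_integrable_bounded_linear[OF bounded_linear_vec_nth]

text \<open>Subtracting a linear function shifts the gradient by a constant, so that Morrey's
  inequality controls first-order Taylor remainders.\<close>

lemma weak_grad_diff_affine:
  fixes \<Omega> :: "(real^'n::finite) set"
  assumes weak: "weak_grad \<Omega> u g" and u: "continuous_on \<Omega> u" and g: "locally_integrable \<Omega> g"
    and \<Omega>: "\<Omega> \<in> sets lebesgue"
  shows "weak_grad \<Omega> (\<lambda>x. u x - q \<bullet> x) (\<lambda>x. g x - q)"
  unfolding weak_grad_def
proof (intro allI impI)
  fix \<phi> :: "real^'n \<Rightarrow> real" and j
  assume t: "test_function \<Omega> \<phi>"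
  have aff: "weak_grad \<Omega> (\<lambda>x. q \<bullet> x) (\<lambda>x. q)" using weak_grad_affine[OF \<Omega>, of q 0] by simp
  have li: "locally_integrable \<Omega> (\<lambda>x. q $ j)"
    unfolding locally_integrable_def
    by (auto intro!: finite_measure.integrable_const finite_measure_lebesgue_on lmeasurable_compact)
  have cq: "continuous_on \<Omega> (\<lambda>x. q \<bullet> x)" by (intro continuous_intros)
  have "(LINT x|lebesgue_on \<Omega>. (u x - q \<bullet> x) * partial_deriv j \<phi> x)
    = (LINT x|lebesgue_on \<Omega>. u x * partial_deriv j \<phi> x) - (LINT x|lebesgue_on \<Omega>. (q \<bullet> x) * partial_deriv j \<phi> x)"
    unfolding left_diff_distrib
    by (rule Bochner_Integration.integral_diff) (intro integrable_times_test_function_deriv u cq \<Omega> t)+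
  also have "\<dots> = - ((LINT x|lebesgue_on \<Omega>. g x $ j * \<phi> x) - (LINT x|lebesgue_on \<Omega>. q $ j * \<phi> x))"
    using weak aff t by (simp add: weak_grad_def)
  also have "(LINT x|lebesgue_on \<Omega>. g x $ j * \<phi> x) - (LINT x|lebesgue_on \<Omega>. q $ j * \<phi> x)
     = (LINT x|lebesgue_on \<Omega>. (g x - q) $ j * \<phi> x)"
    unfolding vector_minus_component left_diff_distrib
    by (rule Bochner_Integration.integral_diff[symmetric]) (intro integrable_times_test_function locally_integrable_component g li \<Omega> t)+
  finally show "(LINT x|lebesgue_on \<Omega>. (u x - q \<bullet> x) * partial_deriv j \<phi> x) = - (LINT x|lebesgue_on \<Omega>. (g x - q) $ j * \<phi> x)" .
qed

lemma ex_smooth_step_locale: "\<exists>\<theta> \<eta> M. smooth_step \<theta> \<eta> M"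
proof -
  obtain \<theta> \<eta> M where "(\<forall>k. smooth1 k \<theta>) \<and> (\<forall>k. smooth1 k \<eta>) \<and> (\<forall>t. (\<theta> has_real_derivative \<eta> t) (at t)) \<and>
     (\<forall>t. 0 \<le> \<eta> t \<and> \<eta> t \<le> M) \<and> (\<forall>t. t \<notin> {0<..<1} \<longrightarrow> \<eta> t = 0) \<and>
     (\<forall>t\<le>0. \<theta> t = 0) \<and> (\<forall>t\<ge>1. \<theta> t = 1)"
    using ex_smooth_step by blast
  then have "smooth_step \<theta> \<eta> M" by unfold_locales blast+
  then show ?thesis by blast
qed

section \<open>Differentiability almost everywhere and the area formula\<close>

lemma weak_grad_component:
  "has_weak_gradient \<Omega> y G \<Longrightarrow> weak_grad \<Omega> (\<lambda>x. y x $ i) (\<lambda>x. G x $ i)"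
  by (auto simp: has_weak_gradient_def weak_grad_def)

lemma integrable_powr_component:
  fixes F :: "'a::euclidean_space \<Rightarrow> real^'n::finite^'k::finite"
  assumes m: "F \<in> borel_measurable M" and i: "integrable M (\<lambda>x. norm (F x) powr p)" and p: "0 \<le> p"
  shows "integrable M (\<lambda>x. norm (F x $ i) powr p)"
    and "(LINT x|M. norm (F x $ i) powr p) \<le> (LINT x|M. norm (F x) powr p)"
proof -
  have mi: "(\<lambda>x. F x $ i) \<in> borel_measurable M"
    using m by (rule borel_measurable_continuous_on[OF linear_continuous_on[OF bounded_linear_vec_nth]])
  have le: "norm (F x $ i) powr p \<le> norm (F x) powr p" for x
    using p by (intro powr_mono2 Finite_Cartesian_Product.norm_nth_le) auto
  show 1: "integrable M (\<lambda>x. norm (F x $ i) powr p)"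
    by (rule Bochner_Integration.integrable_bound[OF i]) (use mi le in \<open>auto intro!: AE_I2\<close>)
  show "(LINT x|M. norm (F x $ i) powr p) \<le> (LINT x|M. norm (F x) powr p)"
    by (rule integral_mono[OF 1 i]) (rule le)
qed

lemma cube_center_subset_ball:
  fixes x :: "real^'n::finite"
  assumes "0 < r"
  shows "cube (x - vec (r / 2)) r \<subseteq> ball x (real CARD('n) * r)"
proof
  fix z assume z: "z \<in> cube (x - vec (r / 2)) r"
  have "norm (z - x) \<le> (\<Sum>i\<in>UNIV. \<bar>(z - x) $ i\<bar>)" by (rule norm_le_l1_cart)
  also have "\<dots> \<le> (\<Sum>i\<in>(UNIV::'n set). r / 2)"
  proof (rule sum_mono)
    fix i
    have "x $ i - r / 2 \<le> z $ i" "z $ i \<le> x $ i - r / 2 + r" using z by (auto simp: mem_box_cart)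
    then show "\<bar>(z - x) $ i\<bar> \<le> r / 2" unfolding vector_minus_component by linarith
  qed
  also have "\<dots> < real CARD('n) * r" using assms by simp
  finally show "z \<in> ball x (real CARD('n) * r)" by (simp add: dist_norm norm_minus_commute)
qed

context
  fixes \<Omega> :: "(real^'n::finite) set" and y :: "real^'n \<Rightarrow> real^'k::finite" and G p
  assumes \<Omega>: "open \<Omega>" "bounded \<Omega>" and y: "continuous_on \<Omega> y" and weak: "has_weak_gradient \<Omega> y G"
    and Gp: "in_Lp p \<Omega> G" and p: "real CARD('n) < p"
begin

lemma domain_sets: "\<Omega> \<in> sets lebesgue" "\<Omega> \<in> lmeasurable"
  using \<Omega> by (auto simp: lmeasurable_open)

lemma one_le_p: "1 \<le> p"
proof -
  have "1 \<le> real CARD('n)" using zero_less_card_finite[where 'a = 'n] by linarith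
  then show ?thesis using p by linarith
qed

lemma gradient_measurable: "G \<in> borel_measurable (lebesgue_on \<Omega>)"
  and gradient_integrable_powr: "integrable (lebesgue_on \<Omega>) (\<lambda>x. norm (G x) powr p)"
  using Gp by (auto simp: in_Lp_def)

lemma locally_integrable_gradient_row: "locally_integrable \<Omega> (\<lambda>x. G x $ i)"
  using weak unfolding has_weak_gradient_def by (intro locally_integrable_component) blast

lemma gradient_cube:
  assumes "cube a r \<subseteq> \<Omega>"
  shows "G \<in> borel_measurable (lebesgue_on (cube a r))"
    and "integrable (lebesgue_on (cube a r)) (\<lambda>x. G x $ i)"
    and "continuous_on \<Omega> (\<lambda>x. y x $ i)"
proof -
  show "G \<in> borel_measurable (lebesgue_on (cube a r))"
    using gradient_measurable assms by (rule measurable_restrict_mono)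
  show "integrable (lebesgue_on (cube a r)) (\<lambda>x. G x $ i)"
    using locally_integrable_gradient_row assms by (auto simp: locally_integrable_def)
  show "continuous_on \<Omega> (\<lambda>x. y x $ i)" using y by (intro continuous_intros)
qed

text \<open>Morrey's inequality for the components of y - A x, comparing both points with the same
  average. It is used twice: A = G x0 gives differentiability at \<open>x0\<close>, A = 0 gives
  condition (N).\<close>

lemma W1p_oscillation:
  obtains C where "C > 0" "\<And>A a r t x x' i. \<lbrakk>cube a r \<subseteq> \<Omega>; 0 < r; 0 < t;
      (LINT x|lebesgue_on (cube a r). norm (G x - A) powr p) \<le> t powr p * r ^ CARD('n);
      x \<in> cube a r; x' \<in> cube a r\<rbrakk> \<Longrightarrow> \<bar>(y x - A *v x) $ i - (y x' - A *v x') $ i\<bar> \<le> C * t * r"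
proof -
  obtain \<theta> \<eta> M where "smooth_step \<theta> \<eta> M" using ex_smooth_step_locale by blast
  then interpret smooth_step \<theta> \<eta> M .
  define C where "C = 2 * CARD('n) * (2 * M) ^ (CARD('n) - 1) / (1 - 2 powr (CARD('n) / p - 1))"
  show ?thesis
  proof (rule that[of "2 * \<bar>C\<bar> + 1"])
    fix A a r t x x' i
    assume Q: "cube a r \<subseteq> \<Omega>" and rt: "0 < r" "0 < t"
      and le: "(LINT x|lebesgue_on (cube a r). norm (G x - A) powr p) \<le> t powr p * r ^ CARD('n)"
      and x: "x \<in> cube a r" "x' \<in> cube a r"
    have p0: "0 \<le> p" using one_le_p by simp
    define u where "u z = y z $ i - A $ i \<bullet> z" for z
    have Gm: "(\<lambda>z. G z - A) \<in> borel_measurable (lebesgue_on (cube a r))"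
      using gradient_cube(1)[OF Q] by (intro borel_measurable_diff) auto
    have Gi: "integrable (lebesgue_on (cube a r)) (\<lambda>z. norm (G z - A) powr p)"
      by (rule integrable_lebesgue_on_subset[OF integrable_powr_diff_const[OF domain_sets(2) gradient_measurable gradient_integrable_powr p0] Q])
         (use domain_sets in auto)
    note ip = integrable_powr_component[OF Gm Gi p0, of i, unfolded vector_minus_component]
    have "\<bar>u z - (LINT x|lebesgue_on \<Omega>. u x * bk a r x)\<bar> \<le> C * t * r" if z: "z \<in> cube a r" for z
      unfolding C_def
    proof (rule morrey[OF _ domain_sets(1) Q _ _ p ip(1) rt z order_trans[OF ip(2) le]])
      show "weak_grad \<Omega> u (\<lambda>x. G x $ i - A $ i)"
        unfolding u_def[abs_def]
        by (rule weak_grad_diff_affine[OF weak_grad_component[OF weak] gradient_cube(3)[OF Q] locally_integrable_gradient_row domain_sets(1)])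
      show "integrable (lebesgue_on (cube a r)) (\<lambda>x. G x $ i - A $ i)"
        by (intro Bochner_Integration.integrable_diff gradient_cube(2)[OF Q]
            finite_measure.integrable_const finite_measure_lebesgue_on) auto
      show "continuous_on \<Omega> u" unfolding u_def[abs_def]
        by (intro continuous_on_diff gradient_cube(3)[OF Q] continuous_on_inner continuous_on_const continuous_on_id)
    qed
    from this[OF x(1)] this[OF x(2)] have "\<bar>u x - u x'\<bar> \<le> 2 * (C * t * r)" by linarith
    also have "\<dots> \<le> (2 * \<bar>C\<bar> + 1) * t * r"
    proof -
      have "C * (t * r) \<le> \<bar>C\<bar> * (t * r)" using rt by (intro mult_right_mono) auto
      moreover have "0 \<le> t * r" using rt by simp
      ultimately show ?thesis by (simp add: algebra_simps)
    qed
    finally show "\<bar>(y x - A *v x) $ i - (y x' - A *v x') $ i\<bar> \<le> (2 * \<bar>C\<bar> + 1) * t * r"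
      by (simp add: u_def matrix_vector_mul_component)
  qed auto
qed

text \<open>At an L^p Lebesgue point \<open>x0\<close> of \<open>G\<close> the mean of |G - G x0|^p
  over small cubes is small, so the oscillation of the Taylor remainder on a cube around
  \<open>x0\<close> that contains \<open>x\<close> is a small multiple of the distance of
  \<open>x\<close> to \<open>x0\<close>.\<close>

lemma AE_has_derivative_weak_gradient:
  "AE x in lebesgue_on \<Omega>. (y has_derivative (\<lambda>v. G x *v v)) (at x)"
proof -
  obtain C where C: "C > 0" "\<And>A a r t x x' i. \<lbrakk>cube a r \<subseteq> \<Omega>; 0 < r; 0 < t;
      (LINT x|lebesgue_on (cube a r). norm (G x - A) powr p) \<le> t powr p * r ^ CARD('n);
      x \<in> cube a r; x' \<in> cube a r\<rbrakk> \<Longrightarrow> \<bar>(y x - A *v x) $ i - (y x' - A *v x') $ i\<bar> \<le> C * t * r"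
    by (rule W1p_oscillation) (rule that)
  define n where "n = real CARD('n)"
  have n: "n > 0" by (simp add: n_def)
  show ?thesis
    using AE_lebesgue_point[OF \<Omega>(1) domain_sets(2) one_le_p gradient_measurable gradient_integrable_powr]
  proof eventually_elim
    case (elim x0)
    have comp: "((\<lambda>x. y x $ i) has_derivative (\<lambda>v. (G x0 *v v) $ i)) (at x0)" for i
      unfolding has_derivative_at_alt
    proof (intro conjI allI impI)
      show "bounded_linear (\<lambda>v. (G x0 *v v) $ i)"
        by (intro bounded_linear_compose[OF bounded_linear_vec_nth] matrix_vector_mul_bounded_linear)
      fix e :: real assume e: "0 < e"
      \<comment> \<open>With side length r = 2 |x - x0| this makes the oscillation bound C t r equal
        to e |x - x0|.\<close>
      define t where "t = e / (2 * C)"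
      have t: "t > 0" using e C by (simp add: t_def)
      \<comment> \<open>Lebesgue points speak of balls, Morrey of cubes: the cube of side
        \<open>r\<close> lies in the ball of radius n r, and \<epsilon> (n r)^n = t^p r^n.\<close>
      define \<epsilon> where "\<epsilon> = t powr p / n ^ CARD('n)"
      have "\<epsilon> > 0" using t n by (simp add: \<epsilon>_def)
      then obtain d where d: "d > 0" "\<And>r. 0 < r \<and> r < d \<Longrightarrow> ball x0 r \<subseteq> \<Omega> \<and>
         integrable (lebesgue_on (ball x0 r)) (\<lambda>z. norm (G z - G x0) powr p) \<and>
         (LINT z|lebesgue_on (ball x0 r). norm (G z - G x0) powr p) \<le> \<epsilon> * r ^ DIM(real^'n)"
        using elim by blast
      show "\<exists>d>0. \<forall>x. norm (x - x0) < d \<longrightarrow>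
         norm (y x $ i - y x0 $ i - (G x0 *v (x - x0)) $ i) \<le> e * norm (x - x0)"
      proof (rule exI[of _ "d / (2 * n)"], intro conjI allI impI)
        show "d / (2 * n) > 0" using d n by simp
        fix x assume x: "norm (x - x0) < d / (2 * n)"
        show "norm (y x $ i - y x0 $ i - (G x0 *v (x - x0)) $ i) \<le> e * norm (x - x0)"
        proof (cases "x = x0")
          case False
          define r where "r = 2 * norm (x - x0)"
          have r: "r > 0" using False by (simp add: r_def)
          have nr: "n * r < d" using x n by (simp add: r_def field_simps)
          define a where "a = x0 - vec (r / 2)"
          have ballO: "ball x0 (n * r) \<subseteq> \<Omega>"
            and ballI: "integrable (lebesgue_on (ball x0 (n * r))) (\<lambda>z. norm (G z - G x0) powr p)"
            and ballL: "(LINT z|lebesgue_on (ball x0 (n * r)). norm (G z - G x0) powr p) \<le> \<epsilon> * (n * r) ^ CARD('n)"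
            using d(2)[of "n * r"] nr n r by auto
          have sub: "cube a r \<subseteq> ball x0 (n * r)"
            unfolding a_def n_def by (rule cube_center_subset_ball[OF r])
          have subO: "cube a r \<subseteq> \<Omega>" using sub ballO by blast
          have mem: "x \<in> cube a r" "x0 \<in> cube a r"
          proof -
            have "\<bar>(x - x0) $ j\<bar> \<le> r / 2" for j using component_le_norm_cart[of "x - x0" j] by (simp add: r_def)
            then have c: "\<bar>x $ j - x0 $ j\<bar> \<le> r / 2" for j by simp
            have "x0 $ j - r / 2 \<le> x $ j \<and> x $ j \<le> x0 $ j - r / 2 + r" for j
              using c[of j] by linarith
            then show "x \<in> cube a r" by (simp add: mem_box_cart a_def)
            show "x0 \<in> cube a r" using r by (simp add: mem_box_cart a_def)
          qed
          have "(LINT x|lebesgue_on (cube a r). norm (G x - G x0) powr p)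
             \<le> (LINT z|lebesgue_on (ball x0 (n * r)). norm (G z - G x0) powr p)"
            by (rule lint_lebesgue_on_mono_set[OF ballI sub]) auto
          also have "\<dots> \<le> \<epsilon> * (n * r) ^ CARD('n)" by (rule ballL)
          also have "\<dots> = t powr p * r ^ CARD('n)" using n by (simp add: \<epsilon>_def power_mult_distrib)
          finally have "\<bar>(y x - G x0 *v x) $ i - (y x0 - G x0 *v x0) $ i\<bar> \<le> C * t * r"
            by (rule C(2)[OF subO r t _ mem])
          also have "C * t * r = e * norm (x - x0)" using C by (simp add: t_def r_def)
          finally show ?thesis by (simp add: matrix_vector_mult_diff_distrib algebra_simps)
        qed simp
      qed
    qed
    show "(y has_derivative (\<lambda>v. G x0 *v v)) (at x0)"
      unfolding has_derivative_componentwise_within[of y]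
      using comp by (auto simp: Basis_vec_def inner_axis)
  qed
qed

end

text \<open>\<open>N\<close> is covered by non-overlapping dyadic cubes inside an open set on which
  1 + |G|^p has a small integral. By \<open>W1p_oscillation\<close> the image of each cube lies in a
  cube whose volume is at most (2 C)^n times the integral of 1 + |G|^p over the original, and these
  bounds add up.\<close>

lemma negligible_image_W1p:
  fixes \<Omega> :: "(real^'n::finite) set" and y :: "real^'n \<Rightarrow> real^'n"
  assumes \<Omega>: "open \<Omega>" "bounded \<Omega>" and y: "continuous_on \<Omega> y" and weak: "has_weak_gradient \<Omega> y G"
    and Gp: "in_Lp p \<Omega> G" and p: "real CARD('n) < p"
    and N: "negligible N" "N \<subseteq> \<Omega>"
  shows "negligible (y ` N)"
proof -
  note A = \<Omega> y weak Gp p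
  have \<Omega>s: "\<Omega> \<in> sets lebesgue" "\<Omega> \<in> lmeasurable" by (rule domain_sets[OF A])+
  have p1: "1 \<le> p" by (rule one_le_p[OF A])
  obtain C where C: "C > 0" "\<And>A a r t x x' i. \<lbrakk>cube a r \<subseteq> \<Omega>; 0 < r; 0 < t;
      (LINT x|lebesgue_on (cube a r). norm (G x - A) powr p) \<le> t powr p * r ^ CARD('n);
      x \<in> cube a r; x' \<in> cube a r\<rbrakk> \<Longrightarrow> \<bar>(y x - A *v x) $ i - (y x' - A *v x') $ i\<bar> \<le> C * t * r"
    by (rule W1p_oscillation[OF A]) (rule that)
  define n where "n = CARD('n)"
  have n: "n > 0" by (simp add: n_def)
  \<comment> \<open>The summand 1 lets the integral pay for the volume of a cube as well, so that
    \<open>t\<close> can be kept at least 1.\<close>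
  define w where "w x = indicator \<Omega> x * (1 + norm (G x) powr p)" for x
  have gI: "integrable (lebesgue_on \<Omega>) (\<lambda>x. norm (G x) powr p)" by (rule gradient_integrable_powr[OF A])
  have wI: "integrable lebesgue w"
  proof -
    have "integrable (lebesgue_on \<Omega>) (\<lambda>x. 1 + norm (G x) powr p)"
      using gI \<Omega>s by (intro Bochner_Integration.integrable_add finite_measure.integrable_const finite_measure_lebesgue_on)
    then show ?thesis using \<Omega>s by (simp add: w_def[abs_def] integrable_restrict_space)
  qed
  have w0: "0 \<le> w x" for x by (simp add: w_def)
  obtain B where B: "B > 0" "\<Omega> \<subseteq> cbox (vec (-B)) (vec B)"
  proof -
    obtain b where b: "b > 0" "\<And>x. x \<in> \<Omega> \<Longrightarrow> norm x \<le> b" using \<Omega>(2) by (auto simp: bounded_pos)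
    have "x \<in> cbox (vec (-b)) (vec b)" if "x \<in> \<Omega>" for x
    proof -
      have "\<bar>x $ i\<bar> \<le> b" for i using component_le_norm_cart[of x i] b(2)[OF that] by linarith
      then show ?thesis by (auto simp: mem_box_cart abs_le_iff minus_le_iff)
    qed
    then show ?thesis using that b(1) by blast
  qed
  show ?thesis
  proof (rule negligible_outer_le[THEN iffD2], intro allI impI)
    fix e :: real assume e: "0 < e"
    have "AE x in lebesgue. x \<in> N \<longrightarrow> w x = 0"
      using N(1) AE_not_in[of N lebesgue] by (simp add: negligible_iff_null_sets) (auto elim: eventually_mono)
    moreover have "0 < e / (2 * C) ^ n" using e C(1) by simp
    ultimately obtain U where U: "open U" "N \<subseteq> U" "(LINT x|lebesgue. indicator U x * w x) < e / (2 * C) ^ n"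
      using ex_open_small_nn_integral[OF wI w0 negligible_imp_sets[OF N(1)]] by blast
    define V where "V = U \<inter> \<Omega>"
    have V: "open V" "N \<subseteq> V" using U \<Omega> N by (auto simp: V_def)
    \<comment> \<open>The gauge forces every cube that is tagged by a point of \<open>N\<close> into
      \<open>V\<close>.\<close>
    define \<gamma> where "\<gamma> x = (if x \<in> V then V else UNIV)" for x :: "real^'n"
    have g: "gauge \<gamma>" using V by (auto simp: gauge_def \<gamma>_def)
    have NB: "N \<subseteq> cbox (vec (-B)) (vec B)" using N B by blast
    have bne: "box (vec (-B)) (vec B :: real^'n) \<noteq> {}" using B by (simp add: interval_ne_empty_cart)
    obtain \<D> where \<D>: "countable \<D>" "\<Union>\<D> \<subseteq> cbox (vec (-B)) (vec B)"
      "\<And>K. K \<in> \<D> \<Longrightarrow> interior K \<noteq> {} \<and> (\<exists>c d. K = cbox c d)"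
      "pairwise (\<lambda>A B. interior A \<inter> interior B = {}) \<D>"
      "\<And>K. K \<in> \<D> \<Longrightarrow> \<exists>x \<in> N \<inter> K. K \<subseteq> \<gamma> x"
      "\<And>u v. cbox u v \<in> \<D> \<Longrightarrow> \<exists>n. \<forall>i \<in> Basis. v \<bullet> i - u \<bullet> i = (vec B \<bullet> i - vec (-B) \<bullet> i) / 2^n"
      "N \<subseteq> \<Union>\<D>"
    proof (rule covering_lemma[OF NB bne g], goal_cases)
      case (1 \<D>)
      show ?case by (rule 1(1)[OF 1(2) 1(3) 1(4) 1(5) 1(6) 1(7) 1(8)])
    qed
    have KV: "K \<subseteq> V" if KD: "K \<in> \<D>" for K
    proof -
      obtain x where "x \<in> N \<inter> K" "K \<subseteq> \<gamma> x" using \<D>(5)[OF KD] by blast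
      moreover from this V(2) have "x \<in> V" by blast
      ultimately show ?thesis by (simp add: \<gamma>_def)
    qed
    have Kcube: "\<exists>c s. K = cube c s \<and> 0 < s" if K: "K \<in> \<D>" for K
    proof -
      obtain c d where cd: "K = cbox c d" using \<D>(3)[OF K] by blast
      then obtain m where m: "\<And>i. i \<in> Basis \<Longrightarrow> d \<bullet> i - c \<bullet> i = (vec B \<bullet> i - vec (-B) \<bullet> i) / 2^m"
        using \<D>(6) K by blast
      have "d $ i - c $ i = 2 * B / 2 ^ m" for i
        using m[of "axis i 1"] by (simp add: inner_axis)
      then have "d = c + vec (2 * B / 2 ^ m)" by (simp add: vec_eq_iff) (metis diff_add_cancel add.commute)
      then show ?thesis using cd B(1) by (intro exI[of _ c] exI[of _ "2 * B / 2 ^ m"]) auto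
    qed
    have "\<exists>T. y ` K \<subseteq> T \<and> T \<in> lmeasurable \<and> measure lebesgue T \<le> (2 * C) ^ n * (LINT x|lebesgue. indicator (interior K) x * w x)"
      if K: "K \<in> \<D>" for K
    proof -
      obtain c s where cs: "K = cube c s" "0 < s" using Kcube[OF K] by blast
      have subO: "cube c s \<subseteq> \<Omega>" using KV[OF K] by (auto simp: cs V_def)
      have gK: "integrable (lebesgue_on (cube c s)) (\<lambda>x. norm (G x) powr p)"
        by (rule integrable_lebesgue_on_subset[OF gI subO]) (use \<Omega>s in auto)
      define I where "I = (LINT x|lebesgue_on (cube c s). norm (G x) powr p)"
      have I0: "0 \<le> I" by (simp add: I_def)
      \<comment> \<open>t^p is the mean of 1 + |G|^p over the cube. As \<open>t\<close> is at least
        1 and p > n, the volume factor t^n is at most t^p.\<close>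
      define t where "t = (1 + I / s ^ n) powr (1 / p)"
      have t1: "1 \<le> t" unfolding t_def using I0 cs(2) p1 by (intro ge_one_powr_ge_zero) auto
      have tp: "t powr p = 1 + I / s ^ n" using I0 cs(2) p1 by (simp add: t_def powr_powr add_nonneg_nonneg)
      have osc: "\<bar>y x $ i - y c $ i\<bar> \<le> C * t * s" if x: "x \<in> cube c s" for x i
      proof -
        have "I \<le> t powr p * s ^ CARD('n)" unfolding tp using cs(2) by (simp add: n_def field_simps)
        moreover have "c \<in> cube c s" using cs(2) by (simp add: mem_box_cart)
        ultimately show ?thesis using C(2)[OF subO cs(2) _ _ x, of t 0 c i] t1 by (simp add: I_def)
      qed
      let ?T = "cube (y c - vec (C * t * s)) (2 * C * t * s)"
      have "y ` K \<subseteq> ?T"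
      proof
        fix z assume "z \<in> y ` K"
        then obtain x where x: "x \<in> cube c s" "z = y x" by (auto simp: cs)
        have "y c $ i - C * t * s \<le> y x $ i" "y x $ i \<le> y c $ i + C * t * s" for i
          using osc[OF x(1), of i] by linarith+
        then show "z \<in> ?T" by (simp add: mem_box_cart x(2) algebra_simps)
      qed
      moreover have "measure lebesgue ?T \<le> (2 * C) ^ n * (LINT x|lebesgue. indicator (interior K) x * w x)"
      proof -
        have "measure lebesgue ?T = (2 * C) ^ n * (t ^ n * s ^ n)"
          using measure_cube[of "2 * C * t * s" "y c - vec (C * t * s)"] C(1) t1 cs(2)
          by (simp add: n_def power_mult_distrib)
        also have "\<dots> \<le> (2 * C) ^ n * (t powr p * s ^ n)"
        proof -
          have "t ^ n = t powr n" using t1 powr_realpow[of t n] by simp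
          also have "\<dots> \<le> t powr p" using t1 p by (intro powr_mono) (auto simp: n_def)
          finally show ?thesis using C(1) cs(2) by (intro mult_left_mono mult_right_mono) auto
        qed
        also have "t powr p * s ^ n = s ^ n + I" unfolding tp using cs(2) by (simp add: field_simps)
        also have "s ^ n + I = (LINT x|lebesgue_on (cube c s). 1 + norm (G x) powr p)"
        proof -
          have "integrable (lebesgue_on (cube c s)) (\<lambda>x. 1::real)"
            by (intro finite_measure.integrable_const finite_measure_lebesgue_on) auto
          from Bochner_Integration.integral_add[OF this gK] show ?thesis
            using measure_cube[of s c] cs(2) by (simp add: I_def n_def measure_restrict_space)
        qed
        also have "\<dots> = (LINT x|lebesgue. indicator (cube c s) x * (1 + norm (G x) powr p))"
          by (simp add: integral_restrict_space)
        \<comment> \<open>Passing to the interior costs a null set and makes the domains of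
          integration disjoint.\<close>
        also have "\<dots> = (LINT x|lebesgue. indicator (interior K) x * w x)"
        proof (rule integral_cong_AE)
          have "AE x in lebesgue. x \<notin> cube c s - box c (c + vec s)"
            by (rule AE_not_in) (use negligible_frontier_interval in \<open>auto simp: negligible_iff_null_sets\<close>)
          then show "AE x in lebesgue. indicator (cube c s) x * (1 + norm (G x) powr p) = indicator (interior K) x * w x"
          proof eventually_elim
            case (elim x)
            have "x \<in> \<Omega>" if "x \<in> cube c s" using that subO by blast
            moreover have "x \<in> interior K \<longleftrightarrow> x \<in> cube c s"
              using elim box_subset_cbox[of c "c + vec s"] by (auto simp: cs)
            ultimately show ?case by (simp add: indicator_def w_def cs(1))
          qed
          have "integrable lebesgue (\<lambda>x. indicator (cube c s) x *\<^sub>R (1 + norm (G x) powr p))"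
          proof -
            have "integrable (lebesgue_on (cube c s)) (\<lambda>x. 1 + norm (G x) powr p)"
              using gK by (intro Bochner_Integration.integrable_add finite_measure.integrable_const finite_measure_lebesgue_on) auto
            then show ?thesis by (simp add: integrable_restrict_space)
          qed
          then show "(\<lambda>x. indicator (cube c s) x * (1 + norm (G x) powr p)) \<in> borel_measurable lebesgue" by auto
          show "(\<lambda>x. indicator (interior K) x * w x) \<in> borel_measurable lebesgue"
            using wI by (intro borel_measurable_times borel_measurable_indicator) auto
        qed
        finally show ?thesis .
      qed
      ultimately show ?thesis by (intro exI[of _ ?T]) auto
    qed
    then have "\<forall>K\<in>\<D>. \<exists>T. y ` K \<subseteq> T \<and> T \<in> lmeasurable \<and> measure lebesgue T \<le> (2 * C) ^ n * (LINT x|lebesgue. indicator (interior K) x * w x)"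
      by (rule ballI)
    from bchoice[OF this] obtain T where "\<forall>K\<in>\<D>. y ` K \<subseteq> T K \<and> T K \<in> lmeasurable \<and> measure lebesgue (T K) \<le> (2 * C) ^ n * (LINT x|lebesgue. indicator (interior K) x * w x)"
      by (rule exE)
    then have T: "\<And>K. K \<in> \<D> \<Longrightarrow> y ` K \<subseteq> T K" "\<And>K. K \<in> \<D> \<Longrightarrow> T K \<in> lmeasurable"
      "\<And>K. K \<in> \<D> \<Longrightarrow> measure lebesgue (T K) \<le> (2 * C) ^ n * (LINT x|lebesgue. indicator (interior K) x * w x)"
      by (simp_all only:)
    have iK: "integrable lebesgue (\<lambda>x. indicator S x * w x)" if "S \<in> sets lebesgue" for S
      using integrable_real_mult_indicator[OF that wI] by (simp add: mult.commute)
    have fin: "measure lebesgue (\<Union>K\<in>F. T K) \<le> e" if F: "F \<subseteq> \<D>" "finite F" for F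
    proof -
      have "measure lebesgue (\<Union>K\<in>F. T K) \<le> (\<Sum>K\<in>F. measure lebesgue (T K))"
        by (rule measure_UNION_le) (use F T(2) in auto)
      also have "\<dots> \<le> (\<Sum>K\<in>F. (2 * C) ^ n * (LINT x|lebesgue. indicator (interior K) x * w x))"
        by (rule sum_mono) (use F T(3) in auto)
      also have "\<dots> = (2 * C) ^ n * (LINT x|lebesgue. (\<Sum>K\<in>F. indicator (interior K) x * w x))"
        by (subst Bochner_Integration.integral_sum) (auto simp: sum_distrib_left intro!: iK)
      also have "(LINT x|lebesgue. (\<Sum>K\<in>F. indicator (interior K) x * w x)) \<le> (LINT x|lebesgue. indicator U x * w x)"
      proof (rule integral_mono)
        show "integrable lebesgue (\<lambda>x. \<Sum>K\<in>F. indicator (interior K) x * w x)"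
          by (intro Bochner_Integration.integrable_sum iK) auto
        show "integrable lebesgue (\<lambda>x. indicator U x * w x)" using U(1) by (intro iK) auto
        fix x
        have "(\<Sum>K\<in>F. indicator (interior K) x :: real) = indicator (\<Union>K\<in>F. interior K) x"
        proof (rule indicator_UN_disjoint[symmetric])
          show "disjoint_family_on interior F"
            using \<D>(4) F(1) by (auto simp: disjoint_family_on_def pairwise_def)
        qed (use F in auto)
        also have "\<dots> \<le> indicator U x"
        proof -
          have "(\<Union>K\<in>F. interior K) \<subseteq> U"
            using KV F(1) interior_subset unfolding V_def by blast
          then show ?thesis by (auto simp: indicator_def)
        qed
        finally show "(\<Sum>K\<in>F. indicator (interior K) x * w x) \<le> indicator U x * w x"
          using w0[of x] by (simp add: sum_distrib_right[symmetric] mult_right_mono)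
      qed
      also have "(2 * C) ^ n * (LINT x|lebesgue. indicator U x * w x) \<le> (2 * C) ^ n * (e / (2 * C) ^ n)"
        using U(3) C(1) by (intro mult_left_mono) auto
      also have "\<dots> = e" using C(1) by simp
      finally show ?thesis using C(1) by (simp add: mult_left_mono)
    qed
    have "(\<Union>K\<in>\<D>. T K) \<in> lmeasurable" "measure lebesgue (\<Union>K\<in>\<D>. T K) \<le> e"
      using fmeasurable_UN_bound[OF \<D>(1) T(2) fin] measure_UN_bound[OF \<D>(1) T(2) fin] by auto
    moreover have "y ` N \<subseteq> (\<Union>K\<in>\<D>. T K)" 
    proof
      fix z assume "z \<in> y ` N"
      then obtain x where x: "x \<in> N" "z = y x" by blast
      then obtain K where K: "K \<in> \<D>" "x \<in> K" using \<D>(7) by blast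
      have "z \<in> y ` K" using x(2) K(2) by simp
      then have "z \<in> T K" using T(1)[OF K(1)] by (rule rev_subsetD)
      then show "z \<in> (\<Union>K\<in>\<D>. T K)" using K(1) by (rule UN_I[rotated])
    qed
    ultimately show "\<exists>T. y ` N \<subseteq> T \<and> T \<in> lmeasurable \<and> measure lebesgue T \<le> e" by blast
  qed
qed

lemma borel_measurable_det:
  fixes G :: "'a \<Rightarrow> real^'n::finite^'n"
  assumes "G \<in> borel_measurable M"
  shows "(\<lambda>x. det (G x)) \<in> borel_measurable M"
proof -
  have "(\<lambda>x. G x $ i $ j) \<in> borel_measurable M" for i j
  proof -
    have "continuous_on UNIV (\<lambda>A::real^'n^'n. A $ i $ j)" by (intro continuous_intros)
    from borel_measurable_continuous_on[OF this assms] show ?thesis .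
  qed
  then show ?thesis unfolding det_def
    by (intro borel_measurable_sum borel_measurable_times borel_measurable_const borel_measurable_prod)
qed

text \<open>Stated for every measurable \<open>E\<close>: the whole domain gives the integral of the
  determinant, and balls give the volumes of their images in the rigidity argument.\<close>

theorem area_formula_W1p:
  fixes \<Omega> :: "(real^'n::finite) set" and y :: "real^'n \<Rightarrow> real^'n"
  assumes \<Omega>: "open \<Omega>" "bounded \<Omega>" and y: "continuous_on \<Omega> y" and weak: "has_weak_gradient \<Omega> y G"
    and Gp: "in_Lp p \<Omega> G" and p: "real CARD('n) < p"
    and inj: "inj_on y \<Omega>" and b: "bounded (y ` \<Omega>)" and E: "E \<in> sets lebesgue" "E \<subseteq> \<Omega>"
  shows "integrable (lebesgue_on E) (\<lambda>x. \<bar>det (G x)\<bar>)"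
    and "(LINT x|lebesgue_on E. \<bar>det (G x)\<bar>) = measure lebesgue (y ` E)"
    and "y ` E \<in> lmeasurable"
proof -
  note A = \<Omega> y weak Gp p
  have \<Omega>s: "\<Omega> \<in> sets lebesgue" "\<Omega> \<in> lmeasurable" by (rule domain_sets[OF A])+
  have "AE x in lebesgue. x \<in> \<Omega> \<longrightarrow> (y has_derivative (\<lambda>v. G x *v v)) (at x)"
    using AE_has_derivative_weak_gradient[OF A] \<Omega>s by (simp add: AE_restrict_space_iff)
  then obtain N where N2: "\<And>x. x \<in> space lebesgue - N \<Longrightarrow> x \<in> \<Omega> \<longrightarrow> (y has_derivative (\<lambda>v. G x *v v)) (at x)"
    and N: "N \<in> null_sets lebesgue"
    by (rule AE_E3) blast
  define S where "S = E - N"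
  have S: "S \<in> sets lebesgue" "S \<subseteq> \<Omega>" using E N by (auto simp: S_def)
  have der: "(y has_derivative (\<lambda>v. G x *v v)) (at x within S)" if "x \<in> S" for x
  proof -
    have "(y has_derivative (\<lambda>v. G x *v v)) (at x)" using that S(2) N2[of x] by (auto simp: S_def)
    then show ?thesis by (rule has_derivative_at_withinI)
  qed
  have bS: "bounded S" "bounded (y ` S)"
    by (rule bounded_subset[OF \<Omega>(2) S(2)], rule bounded_subset[OF b image_mono[OF S(2)]])
  have "y differentiable_on S" using der by (auto simp: differentiable_on_def differentiable_def)
  then have "y ` S \<in> sets lebesgue" using S(1) by (intro differentiable_image_in_sets_lebesgue) auto
  then have yS: "y ` S \<in> lmeasurable" using bS(2) by (simp add: bounded_set_imp_lmeasurable)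
  have "((\<lambda>x. \<bar>det (matrix (\<lambda>v. G x *v v))\<bar>) has_integral (measure lebesgue (y ` S))) S"
    using has_measure_differentiable_image_finite[OF S(1) bS der inj_on_subset[OF inj S(2)]] yS by blast
  then have hi: "((\<lambda>x. \<bar>det (G x)\<bar>) has_integral (measure lebesgue (y ` S))) S" by simp
  then have "(\<lambda>x. \<bar>det (G x)\<bar>) absolutely_integrable_on S"
    by (subst absolutely_integrable_on_iff_nonneg) (auto simp: integrable_on_def)
  then have iS: "integrable lebesgue (\<lambda>x. indicator S x *\<^sub>R \<bar>det (G x)\<bar>)" 
    and lS: "(LINT x|lebesgue. indicator S x *\<^sub>R \<bar>det (G x)\<bar>) = measure lebesgue (y ` S)"
    using set_lebesgue_integral_eq_integral(2)[of S "\<lambda>x. \<bar>det (G x)\<bar>"] integral_unique[OF hi]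
    by (auto simp: set_integrable_def set_lebesgue_integral_def)
  have mE: "(\<lambda>x. indicator E x *\<^sub>R \<bar>det (G x)\<bar>) \<in> borel_measurable lebesgue"
  proof -
    have "(\<lambda>x. \<bar>det (G x)\<bar>) \<in> borel_measurable (lebesgue_on E)"
      using measurable_restrict_mono[OF gradient_measurable[OF A] E(2)]
      by (intro borel_measurable_abs borel_measurable_det)
    then show ?thesis using E(1) by (simp add: borel_measurable_restrict_space_iff mult.commute)
  qed
  have AE: "AE x in lebesgue. indicator S x *\<^sub>R \<bar>det (G x)\<bar> = indicator E x *\<^sub>R \<bar>det (G x)\<bar>"
    using AE_not_in[OF N] by eventually_elim (auto simp: S_def indicator_def)
  have iE: "integrable lebesgue (\<lambda>x. indicator E x *\<^sub>R \<bar>det (G x)\<bar>)"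
    by (rule integrable_cong_AE_imp[OF iS mE]) (use AE in \<open>auto elim: eventually_mono\<close>)
  then show "integrable (lebesgue_on E) (\<lambda>x. \<bar>det (G x)\<bar>)" using E(1) by (simp add: integrable_restrict_space)
  have neg: "negligible (y ` (E \<inter> N))"
    by (rule negligible_image_W1p[OF A]) (use N E in \<open>auto simp: negligible_iff_null_sets intro: null_sets_subset\<close>)
  have un: "y ` E = y ` S \<union> y ` (E \<inter> N)" by (auto simp: S_def)
  show "y ` E \<in> lmeasurable" unfolding un using yS negligible_imp_measurable[OF neg] by (rule fmeasurable.Un)
  have "measure lebesgue (y ` E) = measure lebesgue (y ` S)"
    unfolding un using neg yS by (intro measure_Un_null_set) (auto simp: negligible_iff_null_sets)
  moreover have "(LINT x|lebesgue. indicator E x *\<^sub>R \<bar>det (G x)\<bar>) = (LINT x|lebesgue. indicator S x *\<^sub>R \<bar>det (G x)\<bar>)"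
    using AE iS mE by (intro integral_cong_AE) (auto elim: eventually_mono)
  ultimately show "(LINT x|lebesgue_on E. \<bar>det (G x)\<bar>) = measure lebesgue (y ` E)"
    using E(1) lS by (simp add: integral_restrict_space)
qed

section \<open>Uniqueness of weak gradients\<close>

context smooth_step
begin

lemma bk_le: "0 < r \<Longrightarrow> bk a r (x :: real^'n::finite) \<le> (M / r) ^ CARD('n)"
proof -
  assume r: "0 < r"
  have "bk a r x \<le> (\<Prod>i\<in>(UNIV::'n set). M / r)"
    unfolding bk_def using r by (intro prod_mono conjI kern_nonneg kern_le) auto
  then show ?thesis by simp
qed

lemma bk_test_function: "0 < r \<Longrightarrow> cube a r \<subseteq> \<Omega> \<Longrightarrow> test_function \<Omega> (bk a r)"
  unfolding bk_def[abs_def]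
  by (rule test_function_prod[where a = a and b = "a + vec r"]) (auto intro: smooth1_kern kern_outside)

lemma bk_shift: "bk (a + w) r z = bk a r (z - w)"
  by (simp add: bk_def kern_def algebra_simps)

text \<open>Along the segment from the kernel at \<open>a\<close> to the kernel at a + v, the
  derivative of the average of \<open>u\<close> is the average of \<open>g \<bullet> v\<close>, by
  the definition of the weak gradient. A kernel of mass 1 keeps the bound \<open>L\<close>, and the
  mean value inequality integrates it over the unit interval.\<close>

lemma bk_shift_bound:
  fixes v :: "real^'n::finite"
  assumes weak: "weak_grad \<Omega> u g" and u: "continuous_on \<Omega> u" and g: "locally_integrable \<Omega> g"
    and \<Omega>: "\<Omega> \<in> sets lebesgue" and r: "0 < r" and box: "cbox \<alpha> \<beta> \<subseteq> \<Omega>"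
    and sub: "\<And>s. s \<in> {0..1} \<Longrightarrow> cube (a + s *\<^sub>R v) r \<subseteq> cbox \<alpha> \<beta>"
    and L: "AE x in lebesgue_on \<Omega>. \<bar>g x \<bullet> v\<bar> \<le> L"
  shows "\<bar>(LINT z|lebesgue_on \<Omega>. u z * bk (a + v) r z) - (LINT z|lebesgue_on \<Omega>. u z * bk a r z)\<bar> \<le> L"
proof -
  let ?\<Phi> = "bk a r"
  have tfU: "test_function UNIV ?\<Phi>" by (rule bk_test_function[OF r]) simp
  have tf: "test_function \<Omega> (bk (a + s *\<^sub>R v) r)" if "s \<in> {0..1}" for s
    using bk_test_function[OF r, of "a + s *\<^sub>R v" \<Omega>] sub[OF that] box by blast
  define p0 where "p0 j = partial_deriv j ?\<Phi>" for j
  have p0c: "continuous_on UNIV (p0 j)" for j unfolding p0_def by (rule test_function_continuous_deriv[OF tfU])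
  have fd: "(?\<Phi> has_derivative frechet_derivative ?\<Phi> (at x)) (at x)" for x
    using test_function_differentiable[OF tfU] frechet_derivative_works by blast
  have lin: "linear (frechet_derivative ?\<Phi> (at x))" for x
    by (rule linear_frechet_derivative[OF test_function_differentiable[OF tfU]])
  have pd: "partial_deriv j (bk (a + w) r) z = p0 j (z - w)" for j z w
  proof -
    have "((\<lambda>z. ?\<Phi> (z - w)) has_derivative (\<lambda>h. frechet_derivative ?\<Phi> (at (z - w)) h)) (at z)"
      by (rule has_derivative_compose[of "\<lambda>z. z - w" "\<lambda>h. h", OF _ fd]) (auto intro!: derivative_eq_intros)
    then show ?thesis
      unfolding partial_deriv_def p0_def bk_shift[abs_def] by (subst frechet_derivative_at[symmetric]) auto
  qed
  have ds: "((\<lambda>s. ?\<Phi> (z - s *\<^sub>R v)) has_real_derivative - (\<Sum>j\<in>UNIV. v $ j * p0 j (z - s *\<^sub>R v))) (at s within S)" for z s S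
  proof -
    have 1: "((\<lambda>s. z - s *\<^sub>R v) has_derivative (\<lambda>h. - (h *\<^sub>R v))) (at s within S)"
      by (auto intro!: derivative_eq_intros)
    have "((\<lambda>s. ?\<Phi> (z - s *\<^sub>R v)) has_derivative (\<lambda>h. frechet_derivative ?\<Phi> (at (z - s *\<^sub>R v)) (- (h *\<^sub>R v)))) (at s within S)"
      by (rule has_derivative_compose[OF 1 fd])
    moreover have "frechet_derivative ?\<Phi> (at x) (- (h *\<^sub>R v)) = - (\<Sum>j\<in>UNIV. v $ j * p0 j x) * h" for x h
    proof -
      have "frechet_derivative ?\<Phi> (at x) v = frechet_derivative ?\<Phi> (at x) (\<Sum>j\<in>UNIV. v $ j *\<^sub>R axis j 1)"
        by (simp add: basis_expansion[of v, unfolded scalar_mult_eq_scaleR])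
      also have "\<dots> = (\<Sum>j\<in>UNIV. v $ j * p0 j x)"
        by (simp add: linear_sum[OF lin] linear_scale[OF lin] p0_def partial_deriv_def)
      finally show ?thesis by (simp add: linear_neg[OF lin] linear_scale[OF lin] mult.commute)
    qed
    ultimately show ?thesis unfolding has_field_derivative_def by (simp only:)
  qed
  \<comment> \<open>The integral is taken over one box that contains all shifted supports, so that
    the Leibniz rule applies.\<close>
  define F where "F s = integral (cbox \<alpha> \<beta>) (\<lambda>z. u z * bk (a + s *\<^sub>R v) r z)" for s
  define D where "D s z = u z * - (\<Sum>j\<in>UNIV. v $ j * p0 j (z - s *\<^sub>R v))" for s z
  have ub: "continuous_on (cbox \<alpha> \<beta>) u" using u box by (rule continuous_on_subset)
  have toint: "(LINT z|lebesgue_on \<Omega>. f z) = integral (cbox \<alpha> \<beta>) f"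
    if "continuous_on (cbox \<alpha> \<beta>) f" "\<And>z. z \<notin> cbox \<alpha> \<beta> \<Longrightarrow> f z = 0" for f :: "real^'n \<Rightarrow> real"
  proof -
    have "(LINT z|lebesgue_on \<Omega>. f z) = (LINT z|lebesgue_on (cbox \<alpha> \<beta>). f z)"
      by (rule lint_lebesgue_on_support) (use that box \<Omega> in auto)
    also have "\<dots> = integral (cbox \<alpha> \<beta>) f"
      by (rule lebesgue_integral_eq_integral) (use continuous_imp_integrable[OF that(1)] in auto)
    finally show ?thesis .
  qed
  have out: "bk (a + s *\<^sub>R v) r z = 0" if "s \<in> {0..1}" "z \<notin> cbox \<alpha> \<beta>" for s z
    using bk_outside[OF r, of z "a + s *\<^sub>R v"] sub[OF that(1)] that(2) by blast
  have Fs: "F s = (LINT z|lebesgue_on \<Omega>. u z * bk (a + s *\<^sub>R v) r z)" if "s \<in> {0..1}" for s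
    unfolding F_def by (rule toint[symmetric]) (auto intro!: continuous_intros ub bk_continuous simp: out[OF that])
  have dF: "(F has_real_derivative integral (cbox \<alpha> \<beta>) (D s)) (at s within {0..1})" if "s \<in> {0..1}" for s
    unfolding F_def
  proof (rule leibniz_rule_field_derivative)
    fix s z
    show "((\<lambda>s. u z * bk (a + s *\<^sub>R v) r z) has_real_derivative D s z) (at s within {0..1})"
      unfolding bk_shift D_def by (rule DERIV_cmult[OF ds])
  next
    fix s :: real
    show "(\<lambda>z. u z * bk (a + s *\<^sub>R v) r z) integrable_on cbox \<alpha> \<beta>"
      by (intro integrable_continuous continuous_intros ub bk_continuous)
  next
    show "continuous_on ({0..1} \<times> cbox \<alpha> \<beta>) (\<lambda>(s, z). D s z)"
    proof -
      have 1: "continuous_on ({0..1} \<times> cbox \<alpha> \<beta>) (\<lambda>x. u (snd x))"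
        by (rule continuous_on_compose2[OF ub]) (auto intro!: continuous_intros)
      have 2: "continuous_on ({0..1::real} \<times> cbox \<alpha> \<beta>) (\<lambda>x. p0 j (snd x - fst x *\<^sub>R v))" for j
        by (rule continuous_on_compose2[OF p0c]) (auto intro!: continuous_intros)
      show ?thesis unfolding D_def case_prod_beta by (intro continuous_intros 1 2)
    qed
  qed (use that in auto)
  have bD: "norm (integral (cbox \<alpha> \<beta>) (D s)) \<le> L" if s: "s \<in> {0..1}" for s
  proof -
    note t = tf[OF s]
    let ?b = "bk (a + s *\<^sub>R v) r"
    have bsub: "cube (a + s *\<^sub>R v) r \<subseteq> \<Omega>" using sub[OF s] box by blast
    have pout: "p0 j (z - s *\<^sub>R v) = 0" if "z \<notin> cbox \<alpha> \<beta>" for j z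
    proof -
      have "frechet_derivative ?b (at z) = frechet_derivative (\<lambda>z. 0) (at z)"
        by (rule frechet_derivative_transform_within_open[OF test_function_differentiable[OF t], of "- cbox \<alpha> \<beta>"])
           (use that out[OF s] in \<open>auto simp: open_Compl closed_cbox\<close>)
      then show ?thesis unfolding pd[symmetric] by (simp add: partial_deriv_def)
    qed
    have "integral (cbox \<alpha> \<beta>) (D s) = (LINT z|lebesgue_on \<Omega>. D s z)"
    proof (rule toint[symmetric])
      have "continuous_on (cbox \<alpha> \<beta>) (\<lambda>z. p0 j (z - s *\<^sub>R v))" for j
        by (rule continuous_on_compose2[OF p0c]) (auto intro!: continuous_intros)
      then show "continuous_on (cbox \<alpha> \<beta>) (D s)" unfolding D_def by (intro continuous_intros ub)
      show "D s z = 0" if "z \<notin> cbox \<alpha> \<beta>" for z by (simp add: D_def pout[OF that])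
    qed
    also have "\<dots> = (LINT z|lebesgue_on \<Omega>. (\<Sum>j\<in>UNIV. - v $ j * (u z * partial_deriv j ?b z)))"
      unfolding D_def pd by (simp add: sum_negf sum_distrib_left mult_ac)
    also have "\<dots> = (\<Sum>j\<in>UNIV. - v $ j * (LINT z|lebesgue_on \<Omega>. u z * partial_deriv j ?b z))"
      by (subst Bochner_Integration.integral_sum)
         (auto intro!: integrable_mult_right integrable_times_test_function_deriv[OF u \<Omega> t])
    \<comment> \<open>The sign from moving the kernel cancels the sign from integration by
      parts.\<close>
    also have "\<dots> = (\<Sum>j\<in>UNIV. v $ j * (LINT z|lebesgue_on \<Omega>. g z $ j * ?b z))"
      using weak t by (simp add: weak_grad_def)
    also have "\<dots> = (LINT z|lebesgue_on \<Omega>. (g z \<bullet> v) * ?b z)"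
    proof -
      have "(LINT z|lebesgue_on \<Omega>. (\<Sum>j\<in>UNIV. v $ j * (g z $ j * ?b z))) = (\<Sum>j\<in>UNIV. v $ j * (LINT z|lebesgue_on \<Omega>. g z $ j * ?b z))"
        by (subst Bochner_Integration.integral_sum)
           (auto intro!: integrable_mult_right integrable_times_test_function locally_integrable_component g \<Omega> t)
      moreover have "(\<Sum>j\<in>UNIV. v $ j * (g z $ j * ?b z)) = (g z \<bullet> v) * ?b z" for z
        by (simp add: inner_vec_def sum_distrib_right) (simp add: mult_ac)
      ultimately show ?thesis by simp
    qed
    finally have eq: "integral (cbox \<alpha> \<beta>) (D s) = (LINT z|lebesgue_on \<Omega>. (g z \<bullet> v) * ?b z)" .
    have gi: "integrable (lebesgue_on \<Omega>) (\<lambda>z. (g z \<bullet> v) * ?b z)"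
    proof (rule integrable_times_test_function[OF _ \<Omega> t])
      show "locally_integrable \<Omega> (\<lambda>z. g z \<bullet> v)"
        using g unfolding locally_integrable_def by (auto intro: integrable_inner_left)
    qed
    have bi: "integrable (lebesgue_on \<Omega>) (\<lambda>z. L * ?b z)"
      by (rule integrable_times_box[OF continuous_on_const refl bsub \<Omega> bk_continuous]) (rule bk_outside[OF r])
    have "norm (LINT z|lebesgue_on \<Omega>. (g z \<bullet> v) * ?b z) \<le> (LINT z|lebesgue_on \<Omega>. norm ((g z \<bullet> v) * ?b z))"
      by (rule integral_norm_bound)
    also have "\<dots> \<le> (LINT z|lebesgue_on \<Omega>. L * ?b z)"
    proof (rule integral_mono_AE[OF integrable_norm[OF gi] bi])
      show "AE z in lebesgue_on \<Omega>. norm ((g z \<bullet> v) * ?b z) \<le> L * ?b z"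
        using L
      proof eventually_elim
        case (elim z)
        have "norm ((g z \<bullet> v) * ?b z) = \<bar>g z \<bullet> v\<bar> * ?b z" by (simp add: abs_mult abs_of_nonneg[OF bk_nonneg[OF r]])
        also have "\<dots> \<le> L * ?b z" using elim bk_nonneg[OF r] by (rule mult_right_mono)
        finally show ?case .
      qed
    qed
    also have "\<dots> = L" by (simp add: bk_lint[OF r bsub \<Omega>])
    finally show ?thesis unfolding eq .
  qed
  have "norm (F 1 - F 0) \<le> L * norm (1 - 0 :: real)"
    by (rule field_differentiable_bound[of "{0..1}"]) (use dF bD in auto)
  then show ?thesis using Fs[of 1] Fs[of 0] by simp
qed

text \<open>At a Lebesgue point the kernel average of \<open>f\<close>, which is zero, differs from
  \<open>f x\<close> by at most (M n)^n e: the kernel has height at most (M/r)^n and is supported in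
  the ball of radius n r.\<close>

lemma AE_zero_if_weakly_zero_bounded:
  fixes f :: "real^'n::finite \<Rightarrow> real"
  assumes \<Omega>: "open \<Omega>" "\<Omega> \<in> lmeasurable" and f: "integrable (lebesgue_on \<Omega>) f"
    and 0: "\<And>\<phi>. test_function \<Omega> \<phi> \<Longrightarrow> (LINT x|lebesgue_on \<Omega>. f x * \<phi> x) = 0"
  shows "AE x in lebesgue_on \<Omega>. f x = 0"
proof -
  have \<Omega>s: "\<Omega> \<in> sets lebesgue" using \<Omega> by auto
  have fp: "integrable (lebesgue_on \<Omega>) (\<lambda>x. norm (f x) powr 1)" using integrable_norm[OF f] by simp
  have "AE x in lebesgue_on \<Omega>. \<forall>e>0. \<exists>d>0. \<forall>r. 0 < r \<and> r < d \<longrightarrow> ball x r \<subseteq> \<Omega> \<and>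
     integrable (lebesgue_on (ball x r)) (\<lambda>z. norm (f z - f x) powr 1) \<and>
     (LINT z|lebesgue_on (ball x r). norm (f z - f x) powr 1) \<le> e * r ^ DIM(real^'n)"
    by (rule AE_lebesgue_point[OF \<Omega> _ borel_measurable_integrable[OF f] fp]) simp
  then show ?thesis
  proof eventually_elim
    case (elim x)
    define n where "n = real CARD('n)"
    have n: "n > 0" by (simp add: n_def)
    have "\<bar>f x\<bar> \<le> (M * n) ^ CARD('n) * e" if e: "0 < e" for e
    proof -
      obtain d where d: "d > 0" "\<And>r. 0 < r \<and> r < d \<Longrightarrow> ball x r \<subseteq> \<Omega> \<and>
         integrable (lebesgue_on (ball x r)) (\<lambda>z. norm (f z - f x) powr 1) \<and>
         (LINT z|lebesgue_on (ball x r). norm (f z - f x) powr 1) \<le> e * r ^ DIM(real^'n)"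
        using elim e by blast
      define r where "r = d / (2 * n)"
      have r: "r > 0" "n * r < d" using d(1) n by (auto simp: r_def)
      have B: "ball x (n * r) \<subseteq> \<Omega>"
         "integrable (lebesgue_on (ball x (n * r))) (\<lambda>z. \<bar>f z - f x\<bar>)"
         "(LINT z|lebesgue_on (ball x (n * r)). \<bar>f z - f x\<bar>) \<le> e * (n * r) ^ CARD('n)"
        using d(2)[of "n * r"] r n by auto
      define a where "a = x - vec (r / 2)"
      have sub: "cube a r \<subseteq> ball x (n * r)"
        unfolding a_def n_def by (rule cube_center_subset_ball[OF r(1)])
      have subO: "cube a r \<subseteq> \<Omega>" using sub B(1) by blast
      have t: "test_function \<Omega> (bk a r)" by (rule bk_test_function[OF r(1) subO])
      have li: "locally_integrable \<Omega> f"
        using integrable_lebesgue_on_subset[OF f _ _ \<Omega>s]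
        by (auto simp: locally_integrable_def lmeasurable_compact fmeasurableD)
      have i1: "integrable (lebesgue_on \<Omega>) (\<lambda>z. f z * bk a r z)"
        by (rule integrable_times_test_function[OF li \<Omega>s t])
      have i2: "integrable (lebesgue_on \<Omega>) (\<lambda>z. f x * bk a r z)"
        by (rule integrable_times_box[OF continuous_on_const refl subO \<Omega>s bk_continuous]) (rule bk_outside[OF r(1)])
      have "- f x = (LINT z|lebesgue_on \<Omega>. f z * bk a r z) - (LINT z|lebesgue_on \<Omega>. f x * bk a r z)"
        using 0[OF t] bk_lint[OF r(1) subO \<Omega>s] by simp
      also have "\<dots> = (LINT z|lebesgue_on \<Omega>. f z * bk a r z - f x * bk a r z)"
        by (rule Bochner_Integration.integral_diff[OF i1 i2, symmetric])
      also have "\<dots> = (LINT z|lebesgue_on (ball x (n * r)). f z * bk a r z - f x * bk a r z)"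
      proof (rule lint_lebesgue_on_support[OF B(1) _ \<Omega>s])
        fix z assume "z \<in> \<Omega> - ball x (n * r)"
        then have "z \<notin> cube a r" using sub by blast
        then show "f z * bk a r z - f x * bk a r z = 0" by (simp add: bk_outside[OF r(1)])
      qed simp
      finally have "\<bar>f x\<bar> = \<bar>LINT z|lebesgue_on (ball x (n * r)). f z * bk a r z - f x * bk a r z\<bar>"
        by (metis abs_minus_cancel)
      also have "\<dots> \<le> (LINT z|lebesgue_on (ball x (n * r)). norm (f z * bk a r z - f x * bk a r z))"
        using integral_norm_bound[of "lebesgue_on (ball x (n * r))" "\<lambda>z. f z * bk a r z - f x * bk a r z"] by (simp only: real_norm_def)
      also have "\<dots> \<le> (LINT z|lebesgue_on (ball x (n * r)). \<bar>f z - f x\<bar> * (M / r) ^ CARD('n))"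
      proof (rule integral_mono)
        show "integrable (lebesgue_on (ball x (n * r))) (\<lambda>z. norm (f z * bk a r z - f x * bk a r z))"
          by (intro integrable_norm Bochner_Integration.integrable_diff integrable_lebesgue_on_subset[OF i1 B(1) _ \<Omega>s]
               integrable_lebesgue_on_subset[OF i2 B(1) _ \<Omega>s]) auto
        show "integrable (lebesgue_on (ball x (n * r))) (\<lambda>z. \<bar>f z - f x\<bar> * (M / r) ^ CARD('n))"
          by (intro integrable_mult_left B(2))
        show "norm (f z * bk a r z - f x * bk a r z) \<le> \<bar>f z - f x\<bar> * (M / r) ^ CARD('n)" for z
        proof -
          have "norm (f z * bk a r z - f x * bk a r z) = \<bar>f z - f x\<bar> * bk a r z"
            by (simp add: left_diff_distrib[symmetric] abs_mult abs_of_nonneg[OF bk_nonneg[OF r(1)]])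
          also have "\<dots> \<le> \<bar>f z - f x\<bar> * (M / r) ^ CARD('n)" by (intro mult_left_mono bk_le r(1)) simp
          finally show ?thesis .
        qed
      qed
      also have "\<dots> = (LINT z|lebesgue_on (ball x (n * r)). \<bar>f z - f x\<bar>) * (M / r) ^ CARD('n)" by simp
      also have "\<dots> \<le> (e * (n * r) ^ CARD('n)) * (M / r) ^ CARD('n)"
        using B(3) M0 r(1) by (intro mult_right_mono) auto
      also have "\<dots> = (M * n) ^ CARD('n) * e" using r(1) by (simp add: power_mult_distrib power_divide)
      finally show ?thesis .
    qed
    note le = this
    define k where "k = (M * n) ^ CARD('n)"
    have k: "0 \<le> k" using M0 n by (simp add: k_def)
    have "\<bar>f x\<bar> \<le> e" if "0 < e" for e
    proof -
      have "\<bar>f x\<bar> \<le> k * (e / (1 + k))" unfolding k_def by (rule le) (use that k k_def in auto)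
      also have "\<dots> \<le> e" using k that by (simp add: field_simps)
      finally show ?thesis .
    qed
    then have "\<bar>f x\<bar> \<le> 0" by (meson field_le_epsilon add_0 dense_ge)
    then show ?case by simp
  qed
qed

end

text \<open>Local integrability is enough: by Lindelof countably many balls with closure in
  \<open>\<Omega>\<close> cover it, \<open>f\<close> is integrable on each, and test functions on a
  ball are test functions on \<open>\<Omega>\<close>.\<close>

lemma AE_zero_if_weakly_zero:
  fixes f :: "real^'n::finite \<Rightarrow> real"
  assumes \<Omega>: "open \<Omega>" and f: "locally_integrable \<Omega> f"
    and 0: "\<And>\<phi>. test_function \<Omega> \<phi> \<Longrightarrow> (LINT x|lebesgue_on \<Omega>. f x * \<phi> x) = 0"
  shows "AE x in lebesgue_on \<Omega>. f x = 0"
proof -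
  obtain \<theta> \<eta> M where "smooth_step \<theta> \<eta> M" using ex_smooth_step_locale by blast
  then interpret smooth_step \<theta> \<eta> M .
  have \<Omega>s: "\<Omega> \<in> sets lebesgue" using \<Omega> by auto
  define \<B> where "\<B> = {ball x r | x r. cball x r \<subseteq> \<Omega>}"
  have "\<Union>\<B> = \<Omega>"
  proof
    show "\<Union>\<B> \<subseteq> \<Omega>" using ball_subset_cball by (fastforce simp: \<B>_def)
    show "\<Omega> \<subseteq> \<Union>\<B>"
    proof
      fix x assume "x \<in> \<Omega>"
      then obtain e where "e > 0" "cball x e \<subseteq> \<Omega>" using \<Omega> open_contains_cball by blast
      then show "x \<in> \<Union>\<B>" unfolding \<B>_def by (intro UnionI[of "ball x e"]) auto
    qed
  qed
  moreover obtain \<B>' where \<B>': "\<B>' \<subseteq> \<B>" "countable \<B>'" "\<Union>\<B>' = \<Union>\<B>"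
    by (rule Lindelof[of \<B>]) (auto simp: \<B>_def)
  ultimately have un: "\<Union>\<B>' = \<Omega>" by simp
  have "AE x in lebesgue. x \<in> B \<longrightarrow> f x = 0" if B: "B \<in> \<B>'" for B
  proof -
    obtain c r where cr: "B = ball c r" "cball c r \<subseteq> \<Omega>" using B \<B>'(1) by (auto simp: \<B>_def)
    have sub: "B \<subseteq> \<Omega>" using cr ball_subset_cball by blast
    have "integrable (lebesgue_on (cball c r)) f" using f cr(2) by (auto simp: locally_integrable_def)
    then have fB: "integrable (lebesgue_on B) f"
      by (rule integrable_lebesgue_on_subset) (auto simp: cr ball_subset_cball)
    have "AE x in lebesgue_on B. f x = 0"
    proof (rule AE_zero_if_weakly_zero_bounded[OF _ _ fB])
      fix \<phi> assume t: "test_function B \<phi>"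
      then have t': "test_function \<Omega> \<phi>" using sub by (auto simp: test_function_def)
      obtain K where K: "compact K \<and> K \<subseteq> B \<and> (\<forall>x. x \<notin> K \<longrightarrow> \<phi> x = 0 \<and> (\<forall>j. partial_deriv j \<phi> x = 0))"
        using test_function_support[OF t] by (rule exE)
      have "(LINT x|lebesgue_on \<Omega>. f x * \<phi> x) = (LINT x|lebesgue_on B. f x * \<phi> x)"
      proof (rule lint_lebesgue_on_support[OF sub _ \<Omega>s])
        fix x assume "x \<in> \<Omega> - B"
        then have "x \<notin> K" using K by blast
        then show "f x * \<phi> x = 0" using K by simp
      qed (simp add: cr)
      then show "(LINT x|lebesgue_on B. f x * \<phi> x) = 0" using 0[OF t'] by simp
    qed (auto simp: cr)
    then show ?thesis by (simp add: AE_restrict_space_iff cr)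
  qed
  then have "AE x in lebesgue. \<forall>B\<in>\<B>'. x \<in> B \<longrightarrow> f x = 0"
    by (intro AE_ball_countable'[OF _ \<B>'(2)])
  then have "AE x in lebesgue. x \<in> \<Omega> \<longrightarrow> f x = 0"
    by eventually_elim (use un in blast)
  then show ?thesis using \<Omega>s by (simp add: AE_restrict_space_iff)
qed

text \<open>\<open>weak_gradient\<close> is a choice that need not be the L^p representative
  provided by \<open>in_W1p\<close>; almost everywhere the two agree.\<close>

lemma weak_gradient_unique:
  fixes y :: "real^'n::finite \<Rightarrow> real^'k::finite"
  assumes \<Omega>: "open \<Omega>" and G: "has_weak_gradient \<Omega> y G" and H: "has_weak_gradient \<Omega> y H"
  shows "AE x in lebesgue_on \<Omega>. G x = H x"
proof -
  have \<Omega>s: "\<Omega> \<in> sets lebesgue" using \<Omega> by auto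
  have li: "locally_integrable \<Omega> (\<lambda>x. A x $ i $ j)" if "has_weak_gradient \<Omega> y A" for A i j
    using that unfolding has_weak_gradient_def by (intro locally_integrable_component) blast
  have "AE x in lebesgue_on \<Omega>. G x $ i $ j - H x $ i $ j = 0" for i j
  proof (rule AE_zero_if_weakly_zero[OF \<Omega>])
    show "locally_integrable \<Omega> (\<lambda>x. G x $ i $ j - H x $ i $ j)"
      using li[OF G, of i j] li[OF H, of i j] by (auto simp: locally_integrable_def)
    fix \<phi> assume t: "test_function \<Omega> \<phi>"
    have "(LINT x|lebesgue_on \<Omega>. (G x $ i $ j - H x $ i $ j) * \<phi> x)
      = (LINT x|lebesgue_on \<Omega>. G x $ i $ j * \<phi> x) - (LINT x|lebesgue_on \<Omega>. H x $ i $ j * \<phi> x)"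
      unfolding left_diff_distrib
      by (intro Bochner_Integration.integral_diff integrable_times_test_function[OF _ \<Omega>s t] li G H)
    also have "\<dots> = 0"
      using G H t unfolding has_weak_gradient_def by (metis (no_types, lifting) add.inverse_inverse diff_self)
    finally show "(LINT x|lebesgue_on \<Omega>. (G x $ i $ j - H x $ i $ j) * \<phi> x) = 0" .
  qed
  then have "AE x in lebesgue_on \<Omega>. \<forall>i j. G x $ i $ j - H x $ i $ j = 0"
    by (simp add: AE_all_countable)
  then show ?thesis by eventually_elim (simp add: vec_eq_iff)
qed

section \<open>Rigidity\<close>

lemma weak_grad_inner:
  fixes y :: "real^'n::finite \<Rightarrow> real^'k::finite"
  assumes \<Omega>: "\<Omega> \<in> sets lebesgue" and y: "continuous_on \<Omega> y" and weak: "has_weak_gradient \<Omega> y G"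
  shows "weak_grad \<Omega> (\<lambda>z. w \<bullet> y z) (\<lambda>z. w v* G z)"
  unfolding weak_grad_def
proof (intro allI impI)
  fix \<phi> :: "real^'n \<Rightarrow> real" and j assume t: "test_function \<Omega> \<phi>"
  have yi: "continuous_on \<Omega> (\<lambda>x. y x $ i)" for i using y by (intro continuous_intros)
  have li: "locally_integrable \<Omega> (\<lambda>x. G x $ i $ j)" for i
    using weak unfolding has_weak_gradient_def by (intro locally_integrable_component) blast
  have "(LINT x|lebesgue_on \<Omega>. (w \<bullet> y x) * partial_deriv j \<phi> x)
     = (LINT x|lebesgue_on \<Omega>. (\<Sum>i\<in>UNIV. w $ i * (y x $ i * partial_deriv j \<phi> x)))"
    by (simp add: inner_vec_def sum_distrib_right mult.assoc)
  also have "\<dots> = (\<Sum>i\<in>UNIV. w $ i * (LINT x|lebesgue_on \<Omega>. y x $ i * partial_deriv j \<phi> x))"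
    by (subst Bochner_Integration.integral_sum)
       (auto intro!: integrable_mult_right integrable_times_test_function_deriv[OF yi \<Omega> t])
  also have "\<dots> = - (\<Sum>i\<in>UNIV. w $ i * (LINT x|lebesgue_on \<Omega>. G x $ i $ j * \<phi> x))"
    using weak t by (simp add: has_weak_gradient_def sum_negf)
  also have "(\<Sum>i\<in>UNIV. w $ i * (LINT x|lebesgue_on \<Omega>. G x $ i $ j * \<phi> x))
     = (LINT x|lebesgue_on \<Omega>. (\<Sum>i\<in>UNIV. w $ i * (G x $ i $ j * \<phi> x)))"
    by (subst Bochner_Integration.integral_sum)
       (auto intro!: integrable_mult_right integrable_times_test_function[OF li \<Omega> t])
  also have "\<dots> = (LINT x|lebesgue_on \<Omega>. (w v* G x) $ j * \<phi> x)"
    by (simp add: vector_matrix_mult_def sum_distrib_right mult.assoc)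
  finally show "(LINT x|lebesgue_on \<Omega>. (w \<bullet> y x) * partial_deriv j \<phi> x) = - (LINT x|lebesgue_on \<Omega>. (w v* G x) $ j * \<phi> x)" .
qed

lemma norm_conformal_matrix:
  fixes A :: "real^'n::finite^'n"
  assumes "transpose A ** A = mat (l\<^sup>2)" "0 \<le> l"
  shows "norm (A *v v) = l * norm v"
proof -
  have "(A *v v) \<bullet> (A *v v) = v \<bullet> ((transpose A ** A) *v v)"
    by (metis dot_lmul_matrix matrix_vector_mul_assoc vector_transpose_matrix transpose_transpose inner_commute)
  also have "(transpose A ** A) *v v = l\<^sup>2 *\<^sub>R v"
    unfolding assms(1) by (simp add: vec_eq_iff matrix_vector_mult_def mat_def if_distrib[of "\<lambda>z. z * _"] if_distribR cong: if_cong)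
  finally have "(norm (A *v v))\<^sup>2 = (l * norm v)\<^sup>2"
    by (simp add: power2_norm_eq_inner power_mult_distrib)
  then show ?thesis using assms(2) by (simp add: power2_eq_iff_nonneg)
qed

lemma cube_center_subset:
  fixes c x :: "real^'n::finite"
  assumes "x \<in> ball c (R / 4)" "0 < r" "r \<le> R / 2"
  shows "cube (x - vec (r / 2)) r \<subseteq> cube (c - vec (R / 2)) R"
proof
  fix z assume z: "z \<in> cube (x - vec (r / 2)) r"
  have "c $ i - R / 2 \<le> z $ i \<and> z $ i \<le> c $ i - R / 2 + R" for i
  proof -
    have "x $ i - r / 2 \<le> z $ i" "z $ i \<le> x $ i - r / 2 + r" using z by (auto simp: mem_box_cart)
    moreover have "\<bar>x $ i - c $ i\<bar> \<le> R / 4"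
      using component_le_norm_cart[of "x - c" i] assms(1) by (simp add: dist_norm norm_minus_commute)
    ultimately show ?thesis using assms(2,3) by linarith
  qed
  then show "z \<in> cube (c - vec (R / 2)) R" by (simp add: mem_box_cart)
qed

text \<open>\<open>y\<close> is tested against its own increment w = y x - y x'. The gradient of w
  \<bullet> y in direction v = x - x' is bounded by |w| l |v|, because a conformal matrix stretches
  \<open>v\<close> by exactly \<open>l\<close>. Hence |w|^2 \<le> |w| l |v|, and |w| cancels. The
  almost everywhere bound thus becomes a bound for every pair of points.\<close>

lemma conformal_gradient_lipschitz:
  fixes y :: "real^'n::finite \<Rightarrow> real^'n"
  assumes \<Omega>: "\<Omega> \<in> sets lebesgue" and y: "continuous_on \<Omega> y" and weak: "has_weak_gradient \<Omega> y G"
    and conf: "AE x in lebesgue_on \<Omega>. transpose (G x) ** G x = mat (l\<^sup>2)" and l: "0 \<le> l"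
    and R: "0 < R" and Q: "cube (c - vec (R / 2)) R \<subseteq> \<Omega>"
    and x: "x \<in> ball c (R / 4)" "x' \<in> ball c (R / 4)"
  shows "norm (y x - y x') \<le> l * norm (x - x')"
proof -
  obtain \<theta> \<eta> M where "smooth_step \<theta> \<eta> M" using ex_smooth_step_locale by blast
  then interpret smooth_step \<theta> \<eta> M .
  define w where "w = y x - y x'"
  define v where "v = x - x'"
  define u where "u z = w \<bullet> y z" for z
  define L where "L = norm w * (l * norm v)"
  have u: "continuous_on \<Omega> u" unfolding u_def using y by (intro continuous_intros)
  have ug: "weak_grad \<Omega> u (\<lambda>z. w v* G z)" unfolding u_def by (rule weak_grad_inner[OF \<Omega> y weak])
  have "bounded_linear (\<lambda>A::real^'n^'n. w v* A)"
    unfolding linear_conv_bounded_linear[symmetric]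
    by (rule linearI) (simp_all add: vector_matrix_mult_def vec_eq_iff distrib_left sum.distrib sum_distrib_left mult_ac)
  then have gli: "locally_integrable \<Omega> (\<lambda>z. w v* G z)"
    by (rule locally_integrable_bounded_linear) (use weak in \<open>simp add: has_weak_gradient_def\<close>)
  have gL: "AE z in lebesgue_on \<Omega>. \<bar>(w v* G z) \<bullet> v\<bar> \<le> L"
    using conf
  proof eventually_elim
    case (elim z)
    have "\<bar>(w v* G z) \<bullet> v\<bar> = \<bar>w \<bullet> (G z *v v)\<bar>" by (simp add: dot_lmul_matrix)
    also have "\<dots> \<le> norm w * norm (G z *v v)" by (rule Cauchy_Schwarz_ineq2)
    finally show ?case unfolding L_def norm_conformal_matrix[OF elim l] .
  qed
  \<comment> \<open>By continuity, averages over small cubes centred at \<open>q\<close> recover the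
    value of \<open>u\<close> at \<open>q\<close>.\<close>
  have near: "\<exists>d>0. \<forall>r. 0 < r \<and> r < d \<longrightarrow> \<bar>(LINT z|lebesgue_on \<Omega>. u z * bk (q - vec (r / 2)) r z) - u q\<bar> \<le> e"
    if q: "q \<in> ball c (R / 4)" and e: "0 < e" for q e
  proof -
    have n: "real CARD('n) > 0" by simp
    have "q \<in> cube (c - vec (R / 2)) R"
    proof -
      have "q \<in> cube (q - vec (R / 2 / 2)) (R / 2)" using R by (simp add: mem_box_cart)
      then show ?thesis using cube_center_subset[OF q, of "R / 2"] R by auto
    qed
    then have "q \<in> \<Omega>" using Q by blast
    then obtain d where d: "d > 0" "\<And>z. z \<in> \<Omega> \<Longrightarrow> dist z q < d \<Longrightarrow> dist (u z) (u q) < e"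
      using u e unfolding continuous_on_iff by metis
    show ?thesis
    proof (rule exI[of _ "min (R / 2) (d / CARD('n))"], intro conjI allI impI)
      show "0 < min (R / 2) (d / CARD('n))" using R d n by simp
      fix r assume r: "0 < r \<and> r < min (R / 2) (d / CARD('n))"
      have sub: "cube (q - vec (r / 2)) r \<subseteq> \<Omega>" using cube_center_subset[OF q, of r] r Q by force
      have nr: "CARD('n) * r < d" using r n by (simp add: field_simps)
      show "\<bar>(LINT z|lebesgue_on \<Omega>. u z * bk (q - vec (r / 2)) r z) - u q\<bar> \<le> e"
      proof (rule bk_average_close)
        show "integrable (lebesgue_on \<Omega>) (\<lambda>z. u z * bk (q - vec (r / 2)) r z)"
          by (rule integrable_times_box[OF u refl sub \<Omega> bk_continuous]) (use bk_outside r in auto)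
        fix z assume z: "z \<in> cube (q - vec (r / 2)) r"
        then have "dist z q < d" using cube_center_subset_ball[of r q] r nr by (force simp: dist_commute)
        then show "\<bar>u z - u q\<bar> \<le> e" using d(2)[of z] z sub by (auto simp: dist_real_def)
      qed (use \<Omega> sub r in auto)
    qed
  qed
  have "\<bar>u x - u x'\<bar> \<le> L + e" if e: "0 < e" for e
  proof -
    obtain d1 where d1: "d1 > 0" "\<And>r. 0 < r \<and> r < d1 \<Longrightarrow> \<bar>(LINT z|lebesgue_on \<Omega>. u z * bk (x - vec (r / 2)) r z) - u x\<bar> \<le> e / 2"
      using near[OF x(1), of "e / 2"] e by auto
    obtain d2 where d2: "d2 > 0" "\<And>r. 0 < r \<and> r < d2 \<Longrightarrow> \<bar>(LINT z|lebesgue_on \<Omega>. u z * bk (x' - vec (r / 2)) r z) - u x'\<bar> \<le> e / 2"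
      using near[OF x(2), of "e / 2"] e by auto
    define r where "r = min (min d1 d2) R / 2"
    have r: "0 < r" "r < d1" "r < d2" "r \<le> R / 2" using d1(1) d2(1) R by (auto simp: r_def)
    have "\<bar>(LINT z|lebesgue_on \<Omega>. u z * bk ((x' - vec (r / 2)) + v) r z) - (LINT z|lebesgue_on \<Omega>. u z * bk (x' - vec (r / 2)) r z)\<bar> \<le> L"
    \<comment> \<open>The kernel around \<open>x\<close> is the one around \<open>x'\<close> moved
      by \<open>v\<close>. Convexity of the ball keeps the centres of all intermediate cubes in it,
      hence the cubes in the large cube.\<close>
    proof (rule bk_shift_bound[OF ug u gli \<Omega> r(1) Q _ gL])
      fix s :: real assume s: "s \<in> {0..1}"
      have "(1 - s) *\<^sub>R x' + s *\<^sub>R x \<in> ball c (R / 4)"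
        using convex_ball[of c "R / 4"] x s unfolding convex_alt by auto
      moreover have "(x' - vec (r / 2)) + s *\<^sub>R v = ((1 - s) *\<^sub>R x' + s *\<^sub>R x) - vec (r / 2)"
        by (simp add: v_def algebra_simps)
      ultimately show "cube ((x' - vec (r / 2)) + s *\<^sub>R v) r \<subseteq> cube (c - vec (R / 2)) R"
        using cube_center_subset r by metis
    qed
    moreover have "(x' - vec (r / 2)) + v = x - vec (r / 2)" by (simp add: v_def)
    ultimately have "\<bar>(LINT z|lebesgue_on \<Omega>. u z * bk (x - vec (r / 2)) r z) - (LINT z|lebesgue_on \<Omega>. u z * bk (x' - vec (r / 2)) r z)\<bar> \<le> L"
      by (simp only:)
    moreover have "\<bar>(LINT z|lebesgue_on \<Omega>. u z * bk (x - vec (r / 2)) r z) - u x\<bar> \<le> e / 2"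
      "\<bar>(LINT z|lebesgue_on \<Omega>. u z * bk (x' - vec (r / 2)) r z) - u x'\<bar> \<le> e / 2"
      by (rule d1(2), use r in simp, rule d2(2), use r in simp)
    ultimately show ?thesis by linarith
  qed
  then have "\<bar>u x - u x'\<bar> \<le> L" by (rule field_le_epsilon)
  moreover have "u x - u x' = norm w * norm w"
    by (simp add: u_def w_def inner_diff_right[symmetric] dot_square_norm power2_eq_square)
  ultimately have "norm w * norm w \<le> norm w * (l * norm v)" by (simp add: L_def)
  then show ?thesis
    using l by (cases "norm w = 0") (auto simp: w_def v_def)
qed

lemma lipschitz_measure_scaling_isometry:
  fixes y :: "real^'n::finite \<Rightarrow> real^'n"
  assumes lip: "\<And>x x'. x \<in> ball c \<rho> \<Longrightarrow> x' \<in> ball c \<rho> \<Longrightarrow> norm (y x - y x') \<le> l * norm (x - x')"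
    and l: "0 < l" and inj: "inj_on y (ball c \<rho>)"
    and meas: "\<And>a r. 0 < r \<Longrightarrow> ball a r \<subseteq> ball c \<rho> \<Longrightarrow> y ` ball a r \<in> lmeasurable \<and>
       measure lebesgue (y ` ball a r) = l ^ CARD('n) * measure lebesgue (ball a r)"
    and ab: "a \<in> ball c (\<rho> / 2)" "b \<in> ball c (\<rho> / 2)"
  shows "norm (y a - y b) = l * norm (a - b)"
proof (rule ccontr)
  assume ne: "norm (y a - y b) \<noteq> l * norm (a - b)"
  have ab': "a \<in> ball c \<rho>" "b \<in> ball c \<rho>" using ab zero_le_dist[of c a] zero_le_dist[of c b] unfolding mem_ball by linarith+
  have lt: "norm (y a - y b) < l * norm (a - b)" using lip[OF ab'] ne by simp
  \<comment> \<open>Half the distance: the open balls touch without meeting. This radius is below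
    \<rho> / 2, so around centres in the half ball they stay inside
    \<open>ball c \<rho>\<close>.\<close>
  define r where "r = norm (a - b) / 2"
  have r: "0 < r" using lt l by (auto simp: r_def)
  have rr: "r < \<rho> / 2"
    using ab norm_triangle_ineq4[of "a - c" "b - c"] by (simp add: r_def dist_norm norm_minus_commute)
  have sub: "ball q r \<subseteq> ball c \<rho>" if "q \<in> ball c (\<rho> / 2)" for q
  proof
    fix z assume "z \<in> ball q r"
    then show "z \<in> ball c \<rho>" using that rr dist_triangle[of c z q] by simp
  qed
  have img: "y ` ball q r \<subseteq> ball (y q) (l * r)" if q: "q \<in> ball c (\<rho> / 2)" for q
  proof
    fix z assume "z \<in> y ` ball q r"
    then obtain x where x: "x \<in> ball q r" "z = y x" by blast
    have "norm (y q - y x) \<le> l * norm (q - x)" using r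
      by (intro lip subsetD[OF sub[OF q]] x(1)) simp
    also have "\<dots> < l * r" using x(1) l by (simp add: dist_norm)
    finally show "z \<in> ball (y q) (l * r)" by (simp add: x(2) dist_norm)
  qed
  have ballm: "measure lebesgue (ball (p :: real^'n) (l * s)) = l ^ CARD('n) * measure lebesgue (ball q s)" if "0 < s" for p q :: "real^'n" and s
    using content_ball_conv_unit_ball[of "l * s" p] content_ball_conv_unit_ball[of s q] that l
    by (simp add: power_mult_distrib)
  let ?A = "y ` ball a r" and ?B = "y ` ball b r"
  let ?A1 = "ball (y a) (l * r)" and ?B1 = "ball (y b) (l * r)"
  have mA: "?A \<in> lmeasurable" "measure lebesgue ?A = measure lebesgue ?A1"
    using meas[OF r sub[OF ab(1)]] ballm[OF r, of "y a" a] by auto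
  have mB: "?B \<in> lmeasurable" "measure lebesgue ?B = measure lebesgue ?B1"
    using meas[OF r sub[OF ab(2)]] ballm[OF r, of "y b" b] by auto
  have disj0: "ball a r \<inter> ball b r = {}"
    by (rule disjoint_ballI) (simp add: r_def dist_norm)
  have disj: "?A \<inter> ?B = {}"
    using inj_on_image_Int[OF inj sub[OF ab(1)] sub[OF ab(2)]] disj0 by simp
  define m where "m = midpoint (y a) (y b)"
  have "m \<in> ?A1 \<inter> ?B1"
  proof -
    have "dist (y a) m = norm (y a - y b) / 2" "dist (y b) m = norm (y a - y b) / 2"
      by (simp_all only: m_def dist_midpoint) (simp_all add: dist_norm)
    then show ?thesis using lt by (simp add: r_def)
  qed
  then have "?A1 \<inter> ?B1 \<noteq> {}" by blast
  then have "\<not> negligible (?A1 \<inter> ?B1)" by (intro open_not_negligible) auto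
  then have pos: "0 < measure lebesgue (?A1 \<inter> ?B1)"
    using negligible_iff_measure0[of "?A1 \<inter> ?B1"] measure_nonneg[of lebesgue "?A1 \<inter> ?B1"]
    by (auto simp: less_le fmeasurable.Int)
  \<comment> \<open>The disjoint images have the full volumes of \<open>?A1\<close> and
    \<open>?B1\<close> but lie in their union, whose volume is smaller by that of the
    overlap.\<close>
  have "measure lebesgue (?A \<union> ?B) = measure lebesgue ?A + measure lebesgue ?B"
    using mA(1) mB(1) disj by (intro measure_Un_AE) auto
  moreover have "measure lebesgue (?A \<union> ?B) \<le> measure lebesgue (?A1 \<union> ?B1)"
    using img[OF ab(1)] img[OF ab(2)] mA(1) mB(1) by (intro measure_mono_fmeasurable) auto
  moreover have "measure lebesgue (?A1 \<union> ?B1) = measure lebesgue ?A1 + measure lebesgue ?B1 - measure lebesgue (?A1 \<inter> ?B1)"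
    by (rule measure_Un3) auto
  ultimately show False using mA(2) mB(2) pos by linarith
qed

text \<open>After normalisation \<open>f\<close> fixes 0 and preserves distances, hence inner
  products by polarisation. The images of the coordinate vectors, shortened to length
  \<open>e\<close> to fit into the ball, give an orthonormal basis, and the coordinates of
  \<open>f x\<close> in it are those of \<open>x\<close>.\<close>

lemma ball_isometry_affine:
  fixes y :: "real^'n::finite \<Rightarrow> real^'n"
  assumes iso: "\<And>a b. a \<in> ball c \<rho> \<Longrightarrow> b \<in> ball c \<rho> \<Longrightarrow> norm (y a - y b) = l * norm (a - b)"
    and l: "0 < l" and \<rho>: "0 < \<rho>"
  shows "\<exists>R. orthogonal_matrix R \<and> (\<forall>x\<in>ball c \<rho>. y x = y c + l *\<^sub>R (R *v (x - c)))"
proof -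
  define f where "f x = (y (c + x) - y c) /\<^sub>R l" for x
  have nf: "norm (f x - f z) = norm (x - z)" if "norm x < \<rho>" "norm z < \<rho>" for x z
  proof -
    have "f x - f z = (y (c + x) - y (c + z)) /\<^sub>R l" by (simp add: f_def scaleR_diff_right)
    moreover have "norm (y (c + x) - y (c + z)) = l * norm (x - z)"
      using iso[of "c + x" "c + z"] that by (simp add: dist_norm)
    ultimately show ?thesis using l by simp
  qed
  have f0: "f 0 = 0" by (simp add: f_def)
  have n: "norm (f x) = norm x" if "norm x < \<rho>" for x using nf[OF that, of 0] \<rho> by (simp add: f0)
  have inn: "f x \<bullet> f z = x \<bullet> z" if "norm x < \<rho>" "norm z < \<rho>" for x z
    using nf[OF that] n[OF that(1)] n[OF that(2)] dot_norm_neg[of "f x" "f z"] dot_norm_neg[of x z] by simp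
  define e where "e = \<rho> / 2"
  have e: "0 < e" "e < \<rho>" using \<rho> by (auto simp: e_def)
  define b where "b j = f (e *\<^sub>R axis j 1) /\<^sub>R e" for j :: 'n
  have ne: "norm (e *\<^sub>R axis j (1::real) :: real^'n) < \<rho>" for j using e by simp
  have bb: "b i \<bullet> b j = (if i = j then 1 else 0)" for i j
    using inn[OF ne ne, of i j] e by (auto simp: b_def inner_axis_axis field_simps)
  define R where "R = (\<chi> i j. b j $ i)"
  have col: "column j R = b j" for j by (simp add: R_def column_def)
  have orth: "orthogonal_matrix R"
    unfolding orthogonal_matrix_orthonormal_columns col
    by (auto simp: norm_eq_1 bb orthogonal_def)
  have fR: "f x = R *v x" if x: "norm x < \<rho>" for x
  proof -
    have "(transpose R *v f x) $ j = x $ j" for j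
    proof -
      have "(transpose R *v f x) $ j = b j \<bullet> f x"
        by (simp add: matrix_vector_mult_def transpose_def R_def inner_vec_def)
      also have "\<dots> = x $ j"
        using inn[OF ne x, of j] e by (simp add: b_def inner_axis')
      finally show ?thesis .
    qed
    then have "transpose R *v f x = x" by (simp add: vec_eq_iff)
    then have "R *v x = R *v (transpose R *v f x)" by simp
    also have "\<dots> = f x" using orth by (simp only: matrix_vector_mul_assoc orthogonal_matrix_def matrix_vector_mul_lid)
    finally show ?thesis by simp
  qed
  have "y x = y c + l *\<^sub>R (R *v (x - c))" if "x \<in> ball c \<rho>" for x
  proof -
    have "norm (x - c) < \<rho>" using that by (simp add: dist_norm norm_minus_commute)
    from fR[OF this] have "(y x - y c) /\<^sub>R l = R *v (x - c)" by (simp add: f_def)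
    then have "l *\<^sub>R ((y x - y c) /\<^sub>R l) = l *\<^sub>R (R *v (x - c))" by simp
    then show ?thesis using l by (simp add: algebra_simps)
  qed
  then show ?thesis using orth by blast
qed

text \<open>Isometries of balls leave reflections possible; the sign of the determinant excludes
  them. As the determinant is known only almost everywhere and only for \<open>G\<close>, it is
  transferred to the orthogonal matrix at one point of each ball where \<open>G\<close> is the
  derivative of \<open>y\<close>.\<close>

theorem conformal_homeomorphism_rigidity:
  fixes \<Omega> :: "(real^'n::finite) set" and y :: "real^'n \<Rightarrow> real^'n"
  assumes \<Omega>: "open \<Omega>" "bounded \<Omega>" and conn: "connected \<Omega>" "\<Omega> \<noteq> {}"
    and y: "continuous_on \<Omega> y" and weak: "has_weak_gradient \<Omega> y G"
    and Gp: "in_Lp p \<Omega> G" and p: "real CARD('n) < p"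
    and inj: "inj_on y \<Omega>" and b: "bounded (y ` \<Omega>)" and l: "0 < l"
    and conf: "AE x in lebesgue_on \<Omega>. transpose (G x) ** G x = mat (l\<^sup>2) \<and> det (G x) = l ^ CARD('n)"
  shows "\<exists>a R. rotation_matrix R \<and> (\<forall>x\<in>\<Omega>. y x = a + l *\<^sub>R (R *v x))"
proof -
  note A = \<Omega> y weak Gp p
  have \<Omega>s: "\<Omega> \<in> sets lebesgue" "\<Omega> \<in> lmeasurable" by (rule domain_sets[OF A])+
  have conf1: "AE x in lebesgue_on \<Omega>. transpose (G x) ** G x = mat (l\<^sup>2)" using conf by (auto elim: eventually_mono)
  have der: "AE x in lebesgue_on \<Omega>. (y has_derivative (\<lambda>v. G x *v v)) (at x)"
    by (rule AE_has_derivative_weak_gradient[OF A])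
  have meas: "y ` ball a r \<in> lmeasurable \<and> measure lebesgue (y ` ball a r) = l ^ CARD('n) * measure lebesgue (ball a r)"
    if sub: "ball a r \<subseteq> \<Omega>" for a r
  proof -
    note ar = area_formula_W1p[OF A inj b _ sub]
    have "AE x in lebesgue_on (ball a r). \<bar>det (G x)\<bar> = l ^ CARD('n)"
    proof -
      have "AE x in lebesgue. x \<in> \<Omega> \<longrightarrow> det (G x) = l ^ CARD('n)"
        using conf \<Omega>s by (simp add: AE_restrict_space_iff)
      then have "AE x in lebesgue. x \<in> ball a r \<longrightarrow> \<bar>det (G x)\<bar> = l ^ CARD('n)"
      proof eventually_elim
        case (elim x)
        then show ?case using sub l by auto
      qed
      then show ?thesis by (simp add: AE_restrict_space_iff)
    qed
    then have "(LINT x|lebesgue_on (ball a r). \<bar>det (G x)\<bar>) = (LINT x|lebesgue_on (ball a r). l ^ CARD('n))"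
      using ar(1) by (intro integral_cong_AE) auto
    also have "\<dots> = l ^ CARD('n) * measure lebesgue (ball a r)" by (simp add: measure_restrict_space)
    finally show ?thesis using ar(2,3) by simp
  qed
  have loc: "\<exists>\<rho>>0. \<exists>R. rotation_matrix R \<and> ball c \<rho> \<subseteq> \<Omega> \<and> (\<forall>x\<in>ball c \<rho>. y x = y c + l *\<^sub>R (R *v (x - c)))"
    if c: "c \<in> \<Omega>" for c
  proof -
    obtain d where d: "d > 0" "ball c d \<subseteq> \<Omega>" using \<Omega>(1) c by (meson openE)
    \<comment> \<open>The cube of side \<open>Q\<close> around \<open>c\<close> fits into the ball
      of radius \<open>d\<close>. The Lipschitz bound then holds on the ball of radius Q/4 and the
      isometry on half of it, whence \<open>\<rho>\<close> = Q/8.\<close>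
    define Q where "Q = d / CARD('n)"
    have Q: "Q > 0" using d(1) by (simp add: Q_def)
    have cubeO: "cube (c - vec (Q / 2)) Q \<subseteq> \<Omega>"
      using cube_center_subset_ball[OF Q, of c] d(2) by (auto simp: Q_def)
    define \<rho> where "\<rho> = Q / 8"
    have \<rho>: "\<rho> > 0" using Q by (simp add: \<rho>_def)
    have "2 * \<rho> \<le> d"
    proof -
      have "Q \<le> d" using d(1) by (simp add: Q_def field_simps) 
      then show ?thesis using Q by (simp add: \<rho>_def)
    qed
    then have ball2: "ball c (2 * \<rho>) \<subseteq> \<Omega>" using d(2) subset_ball by blast
    have iso: "norm (y a - y b) = l * norm (a - b)" if "a \<in> ball c \<rho>" "b \<in> ball c \<rho>" for a b
    proof (rule lipschitz_measure_scaling_isometry[of c "2 * \<rho>"])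
      fix x x' assume "x \<in> ball c (2 * \<rho>)" "x' \<in> ball c (2 * \<rho>)"
      then show "norm (y x - y x') \<le> l * norm (x - x')"
        using l by (intro conformal_gradient_lipschitz[OF \<Omega>s(1) y weak conf1 _ Q cubeO]) (auto simp: \<rho>_def)
    next
      show "inj_on y (ball c (2 * \<rho>))" using inj ball2 by (rule inj_on_subset)
    next
      fix q r assume "ball q r \<subseteq> ball c (2 * \<rho>)"
      then show "y ` ball q r \<in> lmeasurable \<and> measure lebesgue (y ` ball q r) = l ^ CARD('n) * measure lebesgue (ball q r)"
        using ball2 by (intro meas) blast
    qed (use that l in auto)
    obtain R where R: "orthogonal_matrix R" "\<And>x. x \<in> ball c \<rho> \<Longrightarrow> y x = y c + l *\<^sub>R (R *v (x - c))"
      using ball_isometry_affine[OF iso l \<rho>] by blast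
    have sub: "ball c \<rho> \<subseteq> \<Omega>" using ball2 \<rho> subset_ball[of \<rho> "2 * \<rho>" c] by auto
    have derR: "(y has_derivative (\<lambda>v. (l *\<^sub>R R) *v v)) (at x)" if "x \<in> ball c \<rho>" for x
    proof -
      have "((\<lambda>x. y c + l *\<^sub>R (R *v (x - c))) has_derivative (\<lambda>v. l *\<^sub>R (R *v v))) (at x)"
        by (auto intro!: derivative_eq_intros bounded_linear.has_derivative[OF matrix_vector_mul_bounded_linear] simp: matrix_vector_mult_diff_distrib)
      then have "(y has_derivative (\<lambda>v. l *\<^sub>R (R *v v))) (at x)"
        by (rule has_derivative_transform_within_open[of _ _ _ _ "ball c \<rho>"]) (use that R(2) in auto)
      then show ?thesis by (simp add: scaleR_matrix_vector_assoc)
    qed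
    have "\<exists>x\<in>ball c \<rho>. (y has_derivative (\<lambda>v. G x *v v)) (at x) \<and> det (G x) = l ^ CARD('n)"
    proof (rule ccontr)
      assume no: "\<not> ?thesis"
      have "AE x in lebesgue. x \<in> \<Omega> \<longrightarrow> (y has_derivative (\<lambda>v. G x *v v)) (at x) \<and> det (G x) = l ^ CARD('n)"
        using der conf \<Omega>s by (simp add: AE_restrict_space_iff) (elim eventually_elim2, auto)
      then have "AE x in lebesgue. x \<notin> ball c \<rho>"
        by eventually_elim (use no sub in blast)
      then have "negligible (ball c \<rho>)"
        by (simp add: negligible_iff_null_sets AE_iff_null_sets)
      then show False using \<rho> open_not_negligible[of "ball c \<rho>"] by auto
    qed
    then obtain x where x: "x \<in> ball c \<rho>" "(y has_derivative (\<lambda>v. G x *v v)) (at x)" "det (G x) = l ^ CARD('n)" by blast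
    have "(\<lambda>v. G x *v v) = (\<lambda>v. (l *\<^sub>R R) *v v)" using x(2) derR[OF x(1)] by (rule has_derivative_unique)
    then have "G x = l *\<^sub>R R" by (metis matrix_of_matrix_vector_mul)
    moreover have "l *\<^sub>R R = matrix ((*\<^sub>R) l) ** R"
      by (simp add: matrix_eq matrix_vector_mul_assoc[symmetric] scaleR_matrix_vector_assoc[symmetric] linear_scaleR del: matrix_vector_mul_assoc)
    ultimately have "l ^ CARD('n) * det R = l ^ CARD('n)" using x(3) by (simp add: det_mul det_matrix_scaleR)
    then have "det R = 1" using l by simp
    then have "rotation_matrix R" using R(1) by (simp add: rotation_matrix_def)
    then show ?thesis using R(2) sub \<rho> by blast
  qed
  have "\<forall>c\<in>\<Omega>. \<exists>q. fst q > 0 \<and> rotation_matrix (snd q) \<and> ball c (fst q) \<subseteq> \<Omega> \<and>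
     (\<forall>x\<in>ball c (fst q). y x = y c + l *\<^sub>R (snd q *v (x - c)))"
  proof
    fix c assume "c \<in> \<Omega>"
    then obtain \<rho> R where "\<rho> > 0" "rotation_matrix R" "ball c \<rho> \<subseteq> \<Omega>" "\<forall>x\<in>ball c \<rho>. y x = y c + l *\<^sub>R (R *v (x - c))"
      using loc by blast
    then show "\<exists>q. fst q > 0 \<and> rotation_matrix (snd q) \<and> ball c (fst q) \<subseteq> \<Omega> \<and>
       (\<forall>x\<in>ball c (fst q). y x = y c + l *\<^sub>R (snd q *v (x - c)))"
      by (intro exI[of _ "(\<rho>, R)"], unfold fst_conv snd_conv) (intro conjI)
  qed
  from bchoice[OF this] obtain q where q: "\<forall>c\<in>\<Omega>. fst (q c) > 0 \<and> rotation_matrix (snd (q c)) \<and> ball c (fst (q c)) \<subseteq> \<Omega> \<and>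
     (\<forall>x\<in>ball c (fst (q c)). y x = y c + l *\<^sub>R (snd (q c) *v (x - c)))"
    by (rule exE)
  define \<rho> where "\<rho> c = fst (q c)" for c
  define R where "R c = snd (q c)" for c
  have P: "\<rho> c > 0 \<and> rotation_matrix (R c) \<and> ball c (\<rho> c) \<subseteq> \<Omega> \<and> (\<forall>x\<in>ball c (\<rho> c). y x = y c + l *\<^sub>R (R c *v (x - c)))"
    if "c \<in> \<Omega>" for c
    unfolding \<rho>_def R_def by (rule bspec[OF q that])
  have \<rho>: "\<rho> c > 0" "rotation_matrix (R c)" "ball c (\<rho> c) \<subseteq> \<Omega>" if "c \<in> \<Omega>" for c
    using P[OF that] by blast+
  have \<rho>4: "y x = y c + l *\<^sub>R (R c *v (x - c))" if "c \<in> \<Omega>" "x \<in> ball c (\<rho> c)" for c x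
    using P[OF that(1)] that(2) by (elim conjE) (rule bspec)
  \<comment> \<open>The linear part and the translation part of the local affine form, written so as
    not to depend on the base point; \<open>T\<close> is locally constant.\<close>
  define T where "T c = (R c, y c - l *\<^sub>R (R c *v c))" for c
  have eqT: "T z = T c" if c: "c \<in> \<Omega>" and z: "z \<in> ball c (\<rho> c)" for c z
  proof -
    have zO: "z \<in> \<Omega>" using \<rho>(3)[OF c] z by blast
    have d: "(y has_derivative (\<lambda>v. l *\<^sub>R (R q *v v))) (at x)" if "q \<in> \<Omega>" "x \<in> ball q (\<rho> q)" for q x
    proof -
      have "((\<lambda>x. y q + l *\<^sub>R (R q *v (x - q))) has_derivative (\<lambda>v. l *\<^sub>R (R q *v v))) (at x)"
        by (auto intro!: derivative_eq_intros bounded_linear.has_derivative[OF matrix_vector_mul_bounded_linear] simp: matrix_vector_mult_diff_distrib)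
      then show ?thesis
        by (rule has_derivative_transform_within_open[of _ _ _ _ "ball q (\<rho> q)"]) (use that \<rho>4 in auto)
    qed
    have "(\<lambda>v. l *\<^sub>R (R z *v v)) = (\<lambda>v. l *\<^sub>R (R c *v v))"
      by (rule has_derivative_unique[OF d[OF zO] d[OF c z]]) (use \<rho>(1)[OF zO] in simp)
    then have "R z *v v = R c *v v" for v using l by (metis scaleR_left_imp_eq less_irrefl)
    then have "R z = R c" by (simp add: matrix_eq)
    then show ?thesis using \<rho>4[OF c z] by (simp add: T_def matrix_vector_mult_diff_distrib scaleR_diff_right)
  qed
  obtain c0 where c0: "c0 \<in> \<Omega>" using conn(2) by blast
  have T: "T x = T c0" if "x \<in> \<Omega>" for x
  proof (rule connected_local_const[OF conn(1) that c0])
    show "\<forall>a\<in>\<Omega>. \<forall>\<^sub>F b in at a within \<Omega>. T a = T b"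
    proof
      fix a assume a: "a \<in> \<Omega>"
      have "\<forall>\<^sub>F b in nhds a. b \<in> ball a (\<rho> a)" using \<rho>(1)[OF a] by (intro eventually_nhds_in_open) auto
      then have "\<forall>\<^sub>F b in at a within \<Omega>. b \<in> ball a (\<rho> a)" by (auto simp: eventually_at_filter elim: eventually_mono)
      then show "\<forall>\<^sub>F b in at a within \<Omega>. T a = T b"
        by (rule eventually_mono) (use eqT[OF a] in auto)
    qed
  qed
  have "y x = (y c0 - l *\<^sub>R (R c0 *v c0)) + l *\<^sub>R (R c0 *v x)" if "x \<in> \<Omega>" for x
    using T[OF that] by (auto simp: T_def algebra_simps)
  then show ?thesis using \<rho>(2)[OF c0] by blast
qed

section \<open>Singular values\<close>

text \<open>A maximiser of the Rayleigh quotient on the unit sphere of \<open>V\<close> is an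
  eigenvector: moving it by \<open>t\<close> in direction f x - c x changes the quotient to first
  order by twice the squared length of that vector, which must vanish.\<close>

lemma selfadjoint_eigenvector:
  fixes f :: "'a::euclidean_space \<Rightarrow> 'a"
  assumes f: "linear f" "\<And>x y. x \<bullet> f y = f x \<bullet> y"
    and V: "subspace V" "f ` V \<subseteq> V" "V \<noteq> {0}"
  obtains x c where "x \<in> V" "norm x = 1" "f x = c *\<^sub>R x"
proof -
  obtain v where v: "v \<in> V" "v \<noteq> 0" using V subspace_0 by blast
  let ?K = "V \<inter> sphere 0 1"
  have "compact ?K" by (intro closed_Int_compact closed_subspace V) auto
  moreover have "v /\<^sub>R norm v \<in> ?K" using v V by (auto simp: subspace_scale)
  moreover have "continuous_on ?K (\<lambda>x. x \<bullet> f x)"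
    using f(1) by (intro continuous_intros linear_continuous_on) (simp add: linear_linear)
  ultimately obtain x where x: "x \<in> ?K" "\<And>y. y \<in> ?K \<Longrightarrow> y \<bullet> f y \<le> x \<bullet> f x"
    using continuous_attains_sup[of ?K "\<lambda>x. x \<bullet> f x"] by blast
  define c where "c = x \<bullet> f x"
  have xx: "x \<in> V" "norm x = 1" "x \<bullet> x = 1" using x by (auto simp: norm_eq_1)
  have le: "y \<bullet> f y \<le> c * (y \<bullet> y)" if y: "y \<in> V" for y
  proof (cases "y = 0")
    case False
    then have "y /\<^sub>R norm y \<in> ?K" using y V by (auto simp: subspace_scale)
    from x(2)[OF this] have "(y \<bullet> f y) / (norm y * norm y) \<le> c"
      using f(1) by (simp add: c_def linear_scale divide_inverse mult_ac)
    then show ?thesis using False by (simp add: field_simps dot_square_norm power2_eq_square)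
  qed (use f(1) in \<open>simp add: linear_0\<close>)
  define y where "y = f x - c *\<^sub>R x"
  have yV: "y \<in> V" using V xx by (auto simp: y_def subspace_diff subspace_scale)
  have yx: "y \<bullet> x = 0"
    unfolding y_def inner_diff_left inner_scaleR_left xx(3) by (simp add: c_def inner_commute)
  have "f x = y + c *\<^sub>R x" by (simp add: y_def)
  then have "y \<bullet> f x = y \<bullet> (y + c *\<^sub>R x)" by (rule arg_cong)
  then have yfx: "y \<bullet> f x = y \<bullet> y" using yx by (simp only: inner_add_right inner_scaleR_right mult_zero_right add_0_right)
  define k where "k = y \<bullet> f y - c * (y \<bullet> y)"
  have q: "2 * t * (y \<bullet> y) + t\<^sup>2 * k \<le> 0" for t
  proof -
    have "x + t *\<^sub>R y \<in> V" using xx yV V by (simp add: subspace_add subspace_scale)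
    note * = le[OF this]
    have "f (x + t *\<^sub>R y) = f x + t *\<^sub>R f y" using f(1) by (simp add: linear_add linear_scale)
    moreover have "x \<bullet> f y = y \<bullet> y" using f(2)[of x y] yfx by (simp add: inner_commute)
    ultimately have 1: "(x + t *\<^sub>R y) \<bullet> f (x + t *\<^sub>R y) = c + 2 * t * (y \<bullet> y) + t\<^sup>2 * (y \<bullet> f y)"
      using yfx by (simp add: inner_add_left inner_add_right c_def[symmetric] power2_eq_square algebra_simps)
    have 2: "(x + t *\<^sub>R y) \<bullet> (x + t *\<^sub>R y) = 1 + t\<^sup>2 * (y \<bullet> y)"
      using yx xx(3) by (simp add: inner_add_left inner_add_right inner_commute[of x y] power2_eq_square)
    from * show ?thesis
      unfolding 1 2 by (simp add: k_def algebra_simps)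
  qed
  have "y \<bullet> y = 0"
  proof (rule ccontr)
    assume "y \<bullet> y \<noteq> 0"
    then have p: "y \<bullet> y > 0" by simp
    \<comment> \<open>Small enough that the quadratic term takes back at most half of the linear
      gain.\<close>
    define t where "t = (y \<bullet> y) / (1 + \<bar>k\<bar>)"
    have t: "t > 0" using p by (simp add: t_def)
    have "t * (2 * (y \<bullet> y) + t * k) \<le> 0" using q[of t] by (simp add: algebra_simps power2_eq_square)
    then have "2 * (y \<bullet> y) + t * k \<le> 0" using t by (simp add: mult_le_0_iff)
    moreover have "t * k \<ge> - (y \<bullet> y)"
    proof -
      have "t * \<bar>k\<bar> \<le> y \<bullet> y" unfolding t_def using p by (simp add: field_simps)
      moreover have "t * k \<ge> - (t * \<bar>k\<bar>)" using t mult_left_mono[of "-\<bar>k\<bar>" k t] by simp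
      ultimately show ?thesis by linarith
    qed
    ultimately show False using p by linarith
  qed
  then have "f x = c *\<^sub>R x" by (simp add: y_def)
  then show ?thesis using that xx by blast
qed

text \<open>The orthogonal complement of an eigenvector within \<open>V\<close> is again invariant
  and of smaller dimension.\<close>

lemma selfadjoint_eigenbasis:
  fixes f :: "'a::euclidean_space \<Rightarrow> 'a"
  assumes f: "linear f" "\<And>x y. x \<bullet> f y = f x \<bullet> y"
    and V: "subspace V" "f ` V \<subseteq> V"
  shows "\<exists>B. B \<subseteq> V \<and> pairwise orthogonal B \<and> (\<forall>b\<in>B. norm b = 1 \<and> (\<exists>c. f b = c *\<^sub>R b)) \<and> V \<subseteq> span B"
  using V
proof (induction "dim V" arbitrary: V rule: less_induct)
  case (less V)
  show ?case
  proof (cases "V = {0}")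
    case True
    then show ?thesis by (intro exI[of _ "{}"]) auto
  next
    case False
    obtain x c where x: "x \<in> V" "norm x = 1" "f x = c *\<^sub>R x"
      using selfadjoint_eigenvector[OF f less.prems False] by blast
    have xx: "x \<bullet> x = 1" using x by (simp add: norm_eq_1)
    define W where "W = {v \<in> V. v \<bullet> x = 0}"
    have W: "subspace W" using less.prems(1) 
      by (auto simp: W_def subspace_def inner_add_left)
    have fW: "f ` W \<subseteq> W"
    proof
      fix z assume "z \<in> f ` W"
      then obtain w where w: "w \<in> W" "z = f w" by blast
      have "f w \<bullet> x = w \<bullet> f x" by (rule f(2)[symmetric])
      also have "\<dots> = 0" using w x(3) by (simp add: W_def)
      finally show "z \<in> W" using w less.prems by (auto simp: W_def)
    qed
    have "span W \<subset> span V"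
    proof -
      have "x \<notin> W" using xx by (simp add: W_def)
      moreover have "W \<subseteq> V" unfolding W_def by blast
      ultimately have "W \<subset> V" using x(1) by blast
      moreover have sp: "span V = V" "span W = W" using W less.prems(1) by (simp_all only: span_eq_iff)
      ultimately show ?thesis by (simp only: sp)
    qed
    then have "dim W < dim V" by (rule dim_psubset)
    from less.hyps[OF this W fW] obtain B where B: "B \<subseteq> W" "pairwise orthogonal B"
      "\<forall>b\<in>B. norm b = 1 \<and> (\<exists>c. f b = c *\<^sub>R b)" "W \<subseteq> span B" by blast
    have "V \<subseteq> span (insert x B)"
    proof
      fix v assume v: "v \<in> V"
      have "v - (v \<bullet> x) *\<^sub>R x \<in> W" using v x less.prems xx
        by (auto simp: W_def inner_diff_left subspace_diff subspace_scale)
      then have "v - (v \<bullet> x) *\<^sub>R x \<in> span (insert x B)"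
        using B(4) span_mono[of B "insert x B"] by blast
      moreover have "(v \<bullet> x) *\<^sub>R x \<in> span (insert x B)" by (simp add: span_base span_scale)
      ultimately have "v - (v \<bullet> x) *\<^sub>R x + (v \<bullet> x) *\<^sub>R x \<in> span (insert x B)" by (rule span_add)
      then show "v \<in> span (insert x B)" by simp
    qed
    moreover have "pairwise orthogonal (insert x B)"
      using B(1,2) by (auto simp: pairwise_insert orthogonal_def W_def inner_commute)
    moreover have "insert x B \<subseteq> V" using B(1) x(1) by (auto simp: W_def)
    moreover have "\<forall>b\<in>insert x B. norm b = 1 \<and> (\<exists>c. f b = c *\<^sub>R b)" using B(3) x(2,3) by blast
    ultimately show ?thesis by blast
  qed
qed

section \<open>Diagonal matrices and orthogonal diagonalisation\<close>

definition diag :: "('n \<Rightarrow> 'a::zero) \<Rightarrow> 'a^'n^'n" where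
  "diag d = (\<chi> i j. if i = j then d i else 0)"

lemma diag_nth:
  fixes d :: "'n::finite \<Rightarrow> 'a::semiring_1"
  shows diag_mult_left_nth: "(diag d ** A) $ i $ j = d i * A $ i $ j"
    and diag_mult_right_nth: "(B ** diag d) $ k $ j = B $ k $ j * d j"
    and diag_mult_vec_nth: "(diag d *v x) $ i = d i * x $ i"
proof -
  have "(diag d ** A) $ i $ j = (\<Sum>k\<in>UNIV. if i = k then d i * A $ k $ j else 0)"
    unfolding matrix_matrix_mult_def diag_def vec_lambda_beta by (intro sum.cong) auto
  then show "(diag d ** A) $ i $ j = d i * A $ i $ j" by simp
  have "(B ** diag d) $ k $ j = (\<Sum>l\<in>UNIV. if l = j then B $ k $ l * d l else 0)"
    unfolding matrix_matrix_mult_def diag_def vec_lambda_beta by (intro sum.cong) auto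
  then show "(B ** diag d) $ k $ j = B $ k $ j * d j" by simp
  have "(diag d *v x) $ i = (\<Sum>k\<in>UNIV. if i = k then d i * x $ k else 0)"
    unfolding matrix_vector_mult_def diag_def vec_lambda_beta by (intro sum.cong) auto
  then show "(diag d *v x) $ i = d i * x $ i" by simp
qed

theorem symmetric_matrix_diagonalizable:
  fixes S :: "real^'n^'n"
  assumes "transpose S = S"
  obtains P d where "orthogonal_matrix P" "S = P ** diag d ** transpose P"
proof -
  have sa: "x \<bullet> (S *v y) = (S *v x) \<bullet> y" for x y
    using assms by (metis dot_lmul_matrix vector_transpose_matrix)
  obtain B where B: "pairwise orthogonal B" "\<forall>b\<in>B. norm b = 1 \<and> (\<exists>c. S *v b = c *\<^sub>R b)" "UNIV \<subseteq> span B"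
    using selfadjoint_eigenbasis[OF matrix_vector_mul_linear sa subspace_UNIV] by auto
  have ind: "independent B" using B(1,2) by (intro pairwise_orthogonal_independent) auto
  have "card B = CARD('n)"
    using ind B(3) by (metis DIM_cart DIM_real dim_UNIV dim_eq_card mult.right_neutral span_UNIV top.extremum_uniqueI)
  moreover have "finite B" using ind by (rule independent_imp_finite)
  ultimately obtain b where b: "bij_betw b (UNIV::'n set) B"
    using finite_same_card_bij[of "UNIV::'n set" B] by auto
  then have bB: "b i \<in> B" for i by (auto simp: bij_betw_def)
  define P where "P = (\<chi> i j. b j $ i)"
  have col: "column i P = b i" for i by (simp add: P_def column_def)
  have orth: "orthogonal_matrix P"
    unfolding orthogonal_matrix_orthonormal_columns col
  proof (intro conjI allI impI)
    fix i j :: 'n assume "i \<noteq> j"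
    then have "b i \<noteq> b j" using b by (auto simp: bij_betw_def inj_on_def)
    then show "orthogonal (b i) (b j)" using B(1) bB[of i] bB[of j] by (auto simp: pairwise_def)
  qed (use B(2) bB in auto)
  have "\<forall>i. \<exists>c. S *v b i = c *\<^sub>R b i" using B(2) bB by blast
  then obtain d where d: "\<And>i. S *v b i = d i *\<^sub>R b i" by metis
  have "S ** P = P ** diag d"
  proof -
    have "(S ** P) $ i $ j = (P ** diag d) $ i $ j" for i j
    proof -
      have "(S ** P) $ i $ j = (S *v b j) $ i"
        by (simp add: matrix_matrix_mult_def matrix_vector_mult_def P_def)
      also have "\<dots> = (P ** diag d) $ i $ j"
        by (simp add: d diag_mult_right_nth P_def)
      finally show ?thesis .
    qed
    then show ?thesis by (simp add: vec_eq_iff)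
  qed
  then have "S = P ** diag d ** transpose P"
    using orth by (metis matrix_mul_assoc matrix_mul_rid orthogonal_matrix_def)
  then show ?thesis using that orth by blast
qed

lemma diag_mult: "diag d ** diag e = (diag (\<lambda>i. d i * e i) :: 'a::semiring_1^'n^'n)"
  by (simp add: vec_eq_iff diag_mult_left_nth) (simp add: diag_def)

lemma transpose_diag: "transpose (diag d) = diag d"
  by (auto simp: transpose_def diag_def vec_eq_iff)

lemma det_diag: "det (diag d :: 'a::comm_ring_1^'n^'n) = (\<Prod>i\<in>UNIV. d i)"
  by (subst det_diagonal) (auto simp: diag_def)

lemma diag_conj_mult:
  fixes P :: "real^'n^'n"
  assumes "orthogonal_matrix P"
  shows "(P ** diag d ** transpose P) ** (P ** diag e ** transpose P) = P ** diag (\<lambda>i. d i * e i) ** transpose P"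
proof -
  have "transpose P ** P = mat 1" using assms by (simp add: orthogonal_matrix_def)
  then have "(P ** diag d ** transpose P) ** (P ** diag e ** transpose P) = P ** (diag d ** diag e) ** transpose P"
    by (metis matrix_mul_assoc matrix_mul_rid)
  then show ?thesis by (simp add: diag_mult)
qed

lemma transpose_diag_conj: "transpose (P ** diag d ** transpose P) = P ** diag d ** transpose (P :: real^'n^'n)"
  by (simp add: matrix_transpose_mul transpose_diag matrix_mul_assoc)

lemma inner_diag_conj:
  fixes P :: "real^'n^'n"
  shows "x \<bullet> ((P ** diag d ** transpose P) *v x) = (\<Sum>i\<in>UNIV. d i * ((transpose P *v x) $ i)\<^sup>2)"
proof -
  have "x \<bullet> ((P ** diag d ** transpose P) *v x) = (transpose P *v x) \<bullet> (diag d *v (transpose P *v x))"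
    by (metis dot_lmul_matrix matrix_vector_mul_assoc vector_transpose_matrix transpose_transpose)
  also have "\<dots> = (\<Sum>i\<in>UNIV. d i * ((transpose P *v x) $ i)\<^sup>2)"
    by (simp add: inner_vec_def diag_mult_vec_nth power2_eq_square mult_ac del: transpose_matrix_vector)
  finally show ?thesis .
qed

text \<open>Gives meaning to the definite description in \<open>psd_sqrt\<close>. For a unit
  eigenvector \<open>x\<close> of S - T with eigenvalue \<open>d\<close>, the identity S^2 - T^2 = S
  (S - T) + (S - T) T gives d (x \<bullet> S x + x \<bullet> T x) = 0, while the difference of the
  same two nonnegative numbers is \<open>d\<close>; hence d = 0.\<close>

lemma psd_sqrt_unique:
  fixes S T :: "real^'n^'n"
  assumes S: "transpose S = S" "\<And>x. 0 \<le> x \<bullet> (S *v x)"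
    and T: "transpose T = T" "\<And>x. 0 \<le> x \<bullet> (T *v x)"
    and eq: "S ** S = T ** T"
  shows "S = T"
proof -
  have tr: "transpose (S - T) = S - T" using S T by (simp add: transpose_def vec_eq_iff)
  obtain P d where P: "orthogonal_matrix P" "S - T = P ** diag d ** transpose P"
    using symmetric_matrix_diagonalizable[OF tr] by blast
  have "d i = 0" for i
  proof -
    define x where "x = P *v axis i 1"
    have px: "transpose P *v x = axis i 1"
      using P(1) by (simp only: x_def matrix_vector_mul_assoc orthogonal_matrix_def matrix_vector_mul_lid)
    then have ev: "(S - T) *v x = d i *\<^sub>R x"
      unfolding P(2) matrix_vector_mul_assoc[symmetric]
    proof -
      assume "transpose P *v x = axis i 1"
      moreover have "diag d *v axis i 1 = d i *\<^sub>R axis i (1::real)"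
        by (simp add: vec_eq_iff diag_mult_vec_nth axis_def)
      ultimately show "P *v (diag d *v (transpose P *v x)) = d i *\<^sub>R x"
        by (simp only: x_def matrix_vector_mult_scaleR)
    qed
    have "x \<bullet> x = (P *v axis i 1) \<bullet> x" by (simp add: x_def)
    also have "\<dots> = axis i 1 \<bullet> (transpose P *v x)"
      by (metis dot_lmul_matrix vector_transpose_matrix transpose_transpose)
    also have "\<dots> = 1" unfolding px by (simp add: inner_axis_axis)
    finally have "x \<bullet> x = 1" .
    have sa: "x \<bullet> (S *v y) = (S *v x) \<bullet> y" for y
      using S by (metis dot_lmul_matrix vector_transpose_matrix)
    have "0 = x \<bullet> ((S ** S - T ** T) *v x)" by (simp add: eq)
    also have "(S ** S - T ** T) *v x = S *v ((S - T) *v x) + (S - T) *v (T *v x)"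
      by (simp add: matrix_vector_mult_diff_rdistrib matrix_vector_mult_diff_distrib
          matrix_vector_mul_assoc[symmetric] del: matrix_vector_mul_assoc)
    also have "x \<bullet> \<dots> = d i * (x \<bullet> (S *v x)) + ((S - T) *v x) \<bullet> (T *v x)"
    proof -
      have "x \<bullet> ((S - T) *v (T *v x)) = ((S - T) *v x) \<bullet> (T *v x)"
        using tr by (metis dot_lmul_matrix vector_transpose_matrix)
      then show ?thesis by (simp add: ev inner_add_right matrix_vector_mult_scaleR)
    qed
    finally have "0 = d i * (x \<bullet> (S *v x)) + ((S - T) *v x) \<bullet> (T *v x)" .
    then have "d i * (x \<bullet> (S *v x) + x \<bullet> (T *v x)) = 0" unfolding ev by (simp add: distrib_left)
    moreover have "x \<bullet> (S *v x) - x \<bullet> (T *v x) = d i"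
      using ev \<open>x \<bullet> x = 1\<close> by (metis inner_diff_right inner_scaleR_right matrix_vector_mult_diff_rdistrib mult.right_neutral)
    ultimately show "d i = 0" using S(2)[of x] T(2)[of x]
      by (smt (verit) mult_eq_0_iff)
  qed
  then have "diag d = 0" by (simp add: diag_def vec_eq_iff)
  then have "S - T = 0" using P(2) by (simp add: matrix_matrix_mult_def vec_eq_iff)
  then show ?thesis by simp
qed

text \<open>Being multiplicative, this embedding carries matrix identities over the reals to the
  polynomial matrices in which the characteristic polynomial is a determinant.\<close>

definition const_poly_matrix :: "real^'n^'n \<Rightarrow> real poly^'n^'n" where
  "const_poly_matrix A = (\<chi> i j. [:A $ i $ j:])"

lemma matrix_diff_distribs:
  fixes A :: "'a::ring_1^'n^'m"
  shows "A ** (B - C) = A ** B - A ** C" "(D - E) ** A = D ** A - E ** A"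
  by (simp_all add: vec_eq_iff matrix_matrix_mult_def right_diff_distrib left_diff_distrib sum_subtractf)

lemma const_poly_matrix_mult: "const_poly_matrix (A ** B) = const_poly_matrix A ** const_poly_matrix B"
proof -
  have "[:\<Sum>k\<in>K. A $ i $ k * B $ k $ j:] = (\<Sum>k\<in>K. [:A $ i $ k:] * [:B $ k $ j:])" if "finite K" for i j K
    using that
  proof (induction K)
    case (insert x K)
    have "[:A $ i $ x * B $ x $ j + s:] = [:A $ i $ x:] * [:B $ x $ j:] + [:s:]" for s by simp
    then show ?case unfolding sum.insert[OF insert.hyps] by (simp only: insert.IH)
  qed simp
  then show ?thesis by (simp add: const_poly_matrix_def matrix_matrix_mult_def vec_eq_iff)
qed

text \<open>The scalar matrix of the variable commutes with everything, so X - P D P^T = P (X - D)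
  P^T already as polynomial matrices. The determinant splits into linear factors, and
  \<open>proots\<close> counts them with multiplicity.\<close>

lemma eigenvalues_diag_conj:
  fixes P :: "real^'n^'n"
  assumes P: "orthogonal_matrix P"
  shows "eigenvalues (P ** diag d ** transpose P) = image_mset d (mset_set UNIV)"
proof -
  let ?C = "const_poly_matrix"
  let ?X = "diag (\<lambda>i. [:0, 1:]) :: real poly^'n^'n"
  have one: "?C P ** ?C (transpose P) = mat 1"
  proof -
    have "?C (mat 1) = mat 1" by (simp add: const_poly_matrix_def mat_def vec_eq_iff one_pCons)
    then show ?thesis using P by (simp add: const_poly_matrix_mult[symmetric] orthogonal_matrix_def)
  qed
  have comm: "A ** ?X = ?X ** A" for A
    by (simp add: vec_eq_iff diag_nth mult.commute del: mult_pCons_left mult_pCons_right)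
  have "?X - ?C (P ** diag d ** transpose P) = ?C P ** (?X - ?C (diag d)) ** ?C (transpose P)"
  proof -
    have "?C P ** (?X - ?C (diag d)) ** ?C (transpose P)
      = ?C P ** ?X ** ?C (transpose P) - ?C P ** ?C (diag d) ** ?C (transpose P)"
      by (simp add: matrix_diff_distribs)
    also have "?C P ** ?X ** ?C (transpose P) = ?X"
      by (metis comm one matrix_mul_assoc matrix_mul_rid)
    finally show ?thesis by (simp add: const_poly_matrix_mult)
  qed
  moreover have "?X - ?C (diag d) = diag (\<lambda>i. [:- d i, 1:])"
    by (simp add: const_poly_matrix_def diag_def vec_eq_iff)
  ultimately have "det (?X - ?C (P ** diag d ** transpose P))
     = det (?C P ** ?C (transpose P)) * (\<Prod>i\<in>UNIV. [:- d i, 1:])"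
    by (simp add: det_mul det_diag mult_ac)
  moreover have "(\<chi> i j. (if i = j then [:0, 1:] else 0) - [:A $ i $ j:]) = ?X - ?C A" for A
    by (simp add: const_poly_matrix_def diag_def vec_eq_iff)
  ultimately have "char_polynomial (P ** diag d ** transpose P) = (\<Prod>i\<in>UNIV. [:- d i, 1:])"
    by (simp add: char_polynomial_def one)
  moreover have "proots (\<Prod>i\<in>K. [:- d i, 1:]) = image_mset d (mset_set K)" if "finite K" for K
    using that 
  proof (induction K)
    case (insert x K)
    have "(\<Prod>i\<in>K. [:- d i, 1:]) \<noteq> 0" using insert by auto
    then show ?case using insert by (simp add: proots_mult del: mult_pCons_left)
  qed simp
  ultimately show ?thesis by (simp add: eigenvalues_def)
qed

text \<open>The access to singular values used below: they are the square roots of the eigenvalues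
  \<open>m i\<close> of A^T A, which are nonnegative because \<open>m i\<close> is the squared
  length of \<open>A\<close> applied to the i-th column of \<open>P\<close>.\<close>

lemma singular_values_diagonalization:
  fixes A :: "real^'n^'n"
  obtains P m where "orthogonal_matrix P" "transpose A ** A = P ** diag m ** transpose P"
    "\<And>i. 0 \<le> m i" "singular_values A = image_mset (\<lambda>i. sqrt (m i)) (mset_set UNIV)"
proof -
  have "transpose (transpose A ** A) = transpose A ** A" by (simp add: matrix_transpose_mul)
  then obtain P m where P: "orthogonal_matrix P" and M: "transpose A ** A = P ** diag m ** transpose P"
    using symmetric_matrix_diagonalizable by blast
  have m: "0 \<le> m i" for i
  proof -
    define x where "x = P *v axis i 1"
    have px: "transpose P *v x = axis i 1"
      using P(1) by (simp only: x_def matrix_vector_mul_assoc orthogonal_matrix_def matrix_vector_mul_lid)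
    have "0 \<le> (A *v x) \<bullet> (A *v x)" by simp
    also have "\<dots> = x \<bullet> ((transpose A ** A) *v x)"
      by (metis dot_lmul_matrix matrix_vector_mul_assoc vector_transpose_matrix transpose_transpose inner_commute)
    also have "\<dots> = (\<Sum>j\<in>UNIV. m j * (axis i 1 $ j)\<^sup>2)" unfolding M inner_diag_conj px ..
    also have "\<dots> = m i" 
    proof -
      have "m j * (axis i 1 $ j)\<^sup>2 = (if j = i then m i else 0)" for j by (simp add: axis_def)
      then show ?thesis by simp
    qed
    finally show ?thesis .
  qed
  define S where "S = P ** diag (\<lambda>i. sqrt (m i)) ** transpose P"
  have S: "transpose S = S" "\<And>x. 0 \<le> x \<bullet> (S *v x)" "S ** S = transpose A ** A"
    using m by (auto simp: S_def transpose_diag_conj inner_diag_conj diag_conj_mult[OF P] M intro!: sum_nonneg)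
  have "psd_sqrt (transpose A ** A) = S"
    unfolding psd_sqrt_def
  proof (rule the_equality)
    fix T assume T: "transpose T = T \<and> (\<forall>x. 0 \<le> x \<bullet> (T *v x)) \<and> T ** T = transpose A ** A"
    then have "T ** T = S ** S" by (simp only: S(3))
    then show "T = S" using T S(1,2) psd_sqrt_unique by blast
  qed (intro conjI allI S)
  then have "singular_values A = image_mset (\<lambda>i. sqrt (m i)) (mset_set UNIV)"
    by (simp add: singular_values_def S_def eigenvalues_diag_conj[OF P])
  then show ?thesis using that P M m by blast
qed

lemma trace_transpose_mult_self: "trace (transpose A ** A) = (norm (A :: real^'n^'n))\<^sup>2"
proof -
  have "(norm A)\<^sup>2 = (\<Sum>i\<in>UNIV. \<Sum>j\<in>UNIV. (A $ i $ j)\<^sup>2)"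
    by (simp add: norm_vec_def L2_set_def sum_nonneg)
  also have "\<dots> = (\<Sum>j\<in>UNIV. \<Sum>i\<in>UNIV. (A $ i $ j)\<^sup>2)" by (rule sum.swap)
  finally show ?thesis
    by (simp add: trace_def matrix_matrix_mult_def transpose_def power2_eq_square)
qed

section \<open>The pointwise lower bound\<close>

text \<open>Two inequalities in a row: exp(z) \<ge> 1 + z at z = b ln x, and ln x \<le> x - 1
  multiplied by the nonpositive \<open>b\<close>. The second is strict unless x = 1.\<close>

lemma powr_nonpos_above_tangent:
  fixes x b :: real
  assumes "0 < x" "b \<le> 0"
  shows "1 + b * (x - 1) \<le> x powr b"
    and "b < 0 \<Longrightarrow> x \<noteq> 1 \<Longrightarrow> 1 + b * (x - 1) < x powr b"
proof -
  have e: "1 + b * ln x \<le> x powr b"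
    using assms exp_ge_add_one_self[of "b * ln x"] by (simp add: powr_def)
  have "b * (x - 1) \<le> b * ln x" using assms ln_le_minus_one[of x] by (intro mult_left_mono_neg) auto
  then show "1 + b * (x - 1) \<le> x powr b" using e by linarith
  assume b: "b < 0" "x \<noteq> 1"
  have "ln x < x - 1" using ln_le_minus_one[of x] ln_eq_minus_one[of x] assms b by fastforce
  then have "b * (x - 1) < b * ln x" using b by simp
  then show "1 + b * (x - 1) < x powr b" using e by linarith
qed

text \<open>The preceding inequality for the exponent 1 - a at the point 1/x, multiplied by
  \<open>x\<close>: this turns the power into x^a and the tangent into the tangent.\<close>

lemma powr_ge1_above_tangent:
  fixes x a :: real
  assumes "0 < x" "1 \<le> a"
  shows "1 + a * (x - 1) \<le> x powr a"
    and "1 < a \<Longrightarrow> x \<noteq> 1 \<Longrightarrow> 1 + a * (x - 1) < x powr a"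
proof -
  have eq: "x * (1 / x) powr (1 - a) = x powr a"
    using assms by (simp add: powr_divide powr_diff)
  have eq2: "x * (1 + (1 - a) * (1 / x - 1)) = 1 + a * (x - 1)"
    using assms by (simp add: field_simps)
  show "1 + a * (x - 1) \<le> x powr a"
    using mult_left_mono[OF powr_nonpos_above_tangent(1)[of "1/x" "1 - a"], of x] assms by (simp only: eq eq2) simp
  assume "1 < a" "x \<noteq> 1"
  then show "1 + a * (x - 1) < x powr a"
    using mult_strict_left_mono[OF powr_nonpos_above_tangent(2)[of "1/x" "1 - a"], of x] assms by (simp only: eq eq2) simp
qed

text \<open>The logarithms sum to zero, so the sum minus \<open>card I\<close> is a sum of the
  nonnegative terms s - 1 - ln s, each of which vanishes only at s = 1.\<close>

lemma AM_GM_equality: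
  fixes s :: "'i \<Rightarrow> real"
  assumes "finite I" "\<And>i. i \<in> I \<Longrightarrow> 0 < s i" "(\<Prod>i\<in>I. s i) = 1"
  shows "card I \<le> (\<Sum>i\<in>I. s i)"
    and "(\<Sum>i\<in>I. s i) = card I \<Longrightarrow> i \<in> I \<Longrightarrow> s i = 1"
proof -
  have ln0: "(\<Sum>i\<in>I. ln (s i)) = 0"
  proof -
    have "ln (\<Prod>i\<in>I. s i) = (\<Sum>i\<in>I. ln (s i))"
      by (rule ln_prod) (use assms(1,2) in force)+
    then show ?thesis using assms(3) by simp
  qed
  have nn: "0 \<le> s i - 1 - ln (s i)" if "i \<in> I" for i
    using ln_le_minus_one[OF assms(2)[OF that]] by simp
  have eq: "(\<Sum>i\<in>I. s i - 1 - ln (s i)) = (\<Sum>i\<in>I. s i) - card I"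
    using ln0 by (simp add: sum_subtractf)
  show "card I \<le> (\<Sum>i\<in>I. s i)" using sum_nonneg[of I "\<lambda>i. s i - 1 - ln (s i)"] nn eq by simp
  assume "(\<Sum>i\<in>I. s i) = card I" "i \<in> I"
  then have "s i - 1 - ln (s i) = 0"
    using eq sum_nonneg_eq_0_iff[OF assms(1), of "\<lambda>i. s i - 1 - ln (s i)"] nn by simp
  then show "s i = 1" using ln_eq_minus_one[of "s i"] assms(2)[OF \<open>i \<in> I\<close>] by simp
qed

lemma prod_powr:
  fixes f :: "'i \<Rightarrow> real"
  assumes "finite I" "\<And>i. i \<in> I \<Longrightarrow> 0 \<le> f i"
  shows "(\<Prod>i\<in>I. f i powr c) = (\<Prod>i\<in>I. f i) powr c"
  using assms by (induction I) (auto simp: powr_mult prod_nonneg)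

lemma AM_GM_powr:
  fixes v :: "'n::finite \<Rightarrow> real"
  assumes "\<And>i. 0 < v i"
  shows "CARD('n) * (\<Prod>i\<in>UNIV. v i) powr (c / CARD('n)) \<le> (\<Sum>i\<in>UNIV. v i powr c)"
proof -
  have "(\<Prod>i\<in>UNIV. v i powr c) powr (1 / CARD('n)) \<le> (\<Sum>i\<in>UNIV. v i powr c / CARD('n))"
    by (rule arith_geom_mean) auto
  also have "(\<Prod>i\<in>UNIV. v i powr c) = (\<Prod>i\<in>UNIV. v i) powr c"
    using assms less_imp_le by (intro prod_powr) auto
  finally show ?thesis
    by (simp add: powr_powr sum_divide_distrib[symmetric] pos_le_divide_eq mult.commute)
qed

context
  fixes A :: "real^'n^'n" and P m
  assumes P: "orthogonal_matrix P" and M: "transpose A ** A = P ** diag m ** transpose P"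
    and m0: "\<And>i. 0 \<le> m i"
begin

lemma prod_gram_eigenvalues: "(\<Prod>i\<in>UNIV. m i) = (det A)\<^sup>2"
proof -
  have "det P * det P = 1" using det_orthogonal_matrix[OF P] by auto
  then show ?thesis
    using arg_cong[OF M, of det] by (simp add: det_mul det_diag det_transpose power2_eq_square mult_ac)
qed

lemma sum_gram_eigenvalues: "(\<Sum>i\<in>UNIV. m i) = (norm A)\<^sup>2"
proof -
  have "trace (P ** diag m ** transpose P) = trace (transpose P ** (P ** diag m))"
    by (rule trace_mul_sym)
  also have "\<dots> = trace (diag m)"
    using P by (simp add: matrix_mul_assoc orthogonal_matrix_def)
  also have "\<dots> = (\<Sum>i\<in>UNIV. m i)" by (simp add: trace_def diag_def)
  finally show ?thesis using trace_transpose_mult_self[of A] M by simp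
qed

lemma gram_eigenvalues_const: "(\<forall>i. m i = c) \<longleftrightarrow> transpose A ** A = mat c"
proof
  have mc: "mat c = diag (\<lambda>i::'n. c)" by (simp add: mat_def diag_def)
  have PP: "P ** transpose P = mat 1" "transpose P ** P = mat 1" using P by (auto simp: orthogonal_matrix_def)
  have comm: "B ** mat c = mat c ** B" for B :: "real^'n^'n"
    unfolding mc by (simp add: vec_eq_iff diag_nth mult.commute)
  { assume "\<forall>i. m i = c"
    then have "diag m = mat c" unfolding mc by (auto simp: fun_eq_iff intro!: arg_cong[of _ _ diag])
    then have "transpose A ** A = mat c ** (P ** transpose P)" using M comm by (simp add: matrix_mul_assoc)
    then show "transpose A ** A = mat c" using PP by simp }
  assume "transpose A ** A = mat c"
  then have "transpose P ** (P ** diag m ** transpose P) ** P = transpose P ** mat c ** P" using M by simp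
  moreover have "transpose P ** (P ** diag m ** transpose P) ** P = diag m"
    using PP by (metis matrix_mul_assoc matrix_mul_lid matrix_mul_rid)
  moreover have "transpose P ** mat c ** P = mat c"
    using PP comm by (metis matrix_mul_assoc matrix_mul_rid)
  ultimately have "diag m = mat c" by simp
  then have "diag m $ i $ i = mat c $ i $ i" for i by simp
  then show "\<forall>i. m i = c" by (simp add: diag_def mat_def)
qed

end

lemma Psi_eq_sum:
  fixes A :: "real^'n^'n"
  assumes "singular_values A = image_mset v (mset_set UNIV)"
  shows "Psi \<alpha> h A = (\<Sum>i\<in>UNIV. v i powr \<alpha>) + det A * (\<Sum>i\<in>UNIV. v i powr (- \<alpha>)) + h (det A)"
  by (simp add: Psi_def assms sum_unfold_sum_mset multiset.map_comp o_def)

lemma det_mat: "det (mat l :: real^'n^'n) = l ^ CARD('n)"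
proof -
  have "mat l = (diag (\<lambda>i. l) :: real^'n^'n)" by (simp add: mat_def diag_def)
  then show ?thesis by (simp add: det_diag)
qed

lemma Psi_mat:
  assumes "0 < l"
  shows "Psi \<alpha> h (mat l :: real^'n^'n)
     = CARD('n) * (l powr \<alpha> + l ^ CARD('n) * l powr (- \<alpha>)) + h (l ^ CARD('n))"
proof -
  obtain P m where P: "orthogonal_matrix P" "transpose (mat l :: real^'n^'n) ** mat l = P ** diag m ** transpose P"
    "\<And>i. 0 \<le> m i" "singular_values (mat l :: real^'n^'n) = image_mset (\<lambda>i. sqrt (m i)) (mset_set UNIV)"
    using singular_values_diagonalization[of "mat l :: real^'n^'n"] by blast
  have "transpose (mat l :: real^'n^'n) ** mat l = mat (l * l)"
  proof -
    have "mat c = (diag (\<lambda>i. c) :: real^'n^'n)" for c by (simp add: mat_def diag_def)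
    then show ?thesis by (simp only: transpose_diag diag_mult)
  qed
  then have "m i = l * l" for i using gram_eigenvalues_const[OF P(1-3)] by blast
  then have "sqrt (m i) = l" for i using assms by simp
  then show ?thesis unfolding Psi_eq_sum[OF P(4)] by (simp add: det_mat algebra_simps)
qed

text \<open>The height of \<open>d\<^sup>\<alpha>\<^sup>/\<^sup>n\<close> at \<open>d = det A\<close> above its tangent at \<open>l\<^sup>n\<close>.\<close>

definition det_gap :: "real \<Rightarrow> real \<Rightarrow> real^'n^'n \<Rightarrow> real" where
  "det_gap \<alpha> l A = (det A) powr (\<alpha> / CARD('n)) - (l ^ CARD('n)) powr (\<alpha> / CARD('n))
        * (1 + \<alpha> / CARD('n) * (det A / l ^ CARD('n) - 1))"

text \<open>Written with the Frobenius norm, which is visibly measurable in \<open>A\<close>, rather than with singular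
  values. The second term is Bernoulli's inequality for the exponent \<open>\<alpha> / 2\<close>; this exponent is below \<open>1\<close> only if
  \<open>n = 1\<close>, where the term vanishes.\<close>

definition excess :: "real \<Rightarrow> real \<Rightarrow> real^'n^'n \<Rightarrow> real" where
  "excess \<alpha> l A =
     CARD('n) * det_gap \<alpha> l A
     + \<alpha> / 2 * (det A) powr (\<alpha> / CARD('n)) * ((norm A)\<^sup>2 / (det A) powr (2 / CARD('n)) - CARD('n))"

text \<open>The first two parts are strict convexity of d^(\<alpha>/n). The last two are AM-GM with
  its equality case for the eigenvalues of A^T A, whose sum is the squared Frobenius norm and whose
  product is (det A)^2.\<close>

lemma excess_terms:
  fixes A :: "real^'n^'n"
  assumes \<alpha>: "\<alpha> > real CARD('n)" and l: "l > 0" and A: "det A > 0"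
  shows "0 \<le> det_gap \<alpha> l A"
    and "det_gap \<alpha> l A = 0 \<Longrightarrow> det A = l ^ CARD('n)"
    and "CARD('n) \<le> (norm A)\<^sup>2 / (det A) powr (2 / CARD('n))"
    and "(norm A)\<^sup>2 / (det A) powr (2 / CARD('n)) = CARD('n) \<Longrightarrow> transpose A ** A = mat ((det A) powr (2 / CARD('n)))"
proof -
  define n where "n = real CARD('n)"
  have n: "n \<ge> 1" by (simp add: n_def Suc_leI)
  have a: "\<alpha> / n > 1" using \<alpha> n by (simp add: n_def)
  define d0 where "d0 = l ^ CARD('n)"
  have d0: "d0 > 0" using l by (simp add: d0_def)
  define s where "s = det A / d0"
  have s: "s > 0" "det A = d0 * s" using A d0 by (auto simp: s_def)
  have T1: "det_gap \<alpha> l A = d0 powr (\<alpha> / n) * (s powr (\<alpha> / n) - (1 + \<alpha> / n * (s - 1)))"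
    unfolding det_gap_def n_def[symmetric] d0_def[symmetric] using d0 s by (simp add: powr_mult right_diff_distrib)
  show "0 \<le> det_gap \<alpha> l A" unfolding T1 using powr_ge1_above_tangent(1)[OF s(1), of "\<alpha> / n"] a by simp
  show "det A = l ^ CARD('n)" if "det_gap \<alpha> l A = 0"
  proof (rule ccontr)
    assume "det A \<noteq> l ^ CARD('n)"
    then have "s \<noteq> 1" using s d0_def by auto
    from powr_ge1_above_tangent(2)[OF s(1) less_imp_le[OF a] a this] that T1 d0 show False by simp
  qed
  obtain P m where P: "orthogonal_matrix P" "transpose A ** A = P ** diag m ** transpose P" "\<And>i. 0 \<le> m i"
    using singular_values_diagonalization[of A] by blast
  have pm: "(\<Prod>i\<in>UNIV. m i) = (det A)\<^sup>2" by (rule prod_gram_eigenvalues[OF P])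
  then have "(\<Prod>i\<in>UNIV. m i) \<noteq> 0" using A by simp
  then have m: "0 < m i" for i using P(3)[of i] by (auto simp: less_le)
  \<comment> \<open>The geometric mean of the \<open>m i\<close>, so that the quotients by
    \<open>c\<close> have product 1.\<close>
  define c where "c = (det A) powr (2 / n)"
  have c: "c > 0" using A by (simp add: c_def)
  have cn: "c ^ CARD('n) = (det A)\<^sup>2"
  proof -
    have "c ^ CARD('n) = c powr n" using powr_realpow[OF c] by (simp add: n_def)
    also have "\<dots> = (det A) powr 2" using n by (simp add: c_def powr_powr)
    finally show ?thesis using A by simp
  qed
  have s1: "(\<Prod>i\<in>UNIV. m i / c) = 1"
    using pm cn A by (simp add: prod_dividef)
  have pos: "\<And>i. i \<in> UNIV \<Longrightarrow> 0 < m i / c" using m c by simp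
  have sm: "(\<Sum>i\<in>UNIV. m i / c) = (norm A)\<^sup>2 / c"
    using sum_gram_eigenvalues[OF P] by (simp add: sum_divide_distrib[symmetric])
  show "CARD('n) \<le> (norm A)\<^sup>2 / (det A) powr (2 / CARD('n))"
    using AM_GM_equality(1)[OF finite pos s1] sm by (simp add: c_def n_def)
  show "transpose A ** A = mat ((det A) powr (2 / CARD('n)))" if "(norm A)\<^sup>2 / (det A) powr (2 / CARD('n)) = CARD('n)"
  proof -
    have "m i / c = 1" for i
      by (rule AM_GM_equality(2)[OF finite pos s1]) (use sm that in \<open>auto simp: c_def n_def\<close>)
    then have "\<forall>i. m i = c" using c by (simp add: field_simps)
    then have "transpose A ** A = mat c" using gram_eigenvalues_const[OF P] by blast
    then show ?thesis by (simp only: c_def n_def)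
  qed
qed

lemma excess_nonneg:
  fixes A :: "real^'n^'n"
  assumes "\<alpha> > real CARD('n)" "l > 0" "det A > 0"
  shows "0 \<le> excess \<alpha> l A"
proof -
  have "\<alpha> > 0" using assms(1) by (meson less_trans of_nat_0_less_iff zero_less_card_finite)
  then show ?thesis
    unfolding excess_def using excess_terms(1,3)[OF assms] by (intro add_nonneg_nonneg mult_nonneg_nonneg) auto
qed

lemma excess_eq_0:
  fixes A :: "real^'n^'n"
  assumes *: "\<alpha> > real CARD('n)" "l > 0" "det A > 0" and 0: "excess \<alpha> l A = 0"
  shows "transpose A ** A = mat (l\<^sup>2)" "det A = l ^ CARD('n)"
proof -
  have \<alpha>: "\<alpha> > 0" using *(1) by (meson less_trans of_nat_0_less_iff zero_less_card_finite)
  note t = excess_terms[OF *]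
  define X where "X = det_gap \<alpha> l A"
  define Y where "Y = (norm A)\<^sup>2 / (det A) powr (2 / CARD('n)) - CARD('n)"
  define k where "k = \<alpha> / 2 * (det A) powr (\<alpha> / CARD('n))"
  have k: "k > 0" using \<alpha> *(3) by (simp add: k_def)
  have XY: "X \<ge> 0" "Y \<ge> 0" using t by (auto simp: X_def Y_def)
  have "real CARD('n) * X + k * Y = 0" using 0 by (simp add: excess_def X_def Y_def k_def)
  moreover have "real CARD('n) * X \<ge> 0" "k * Y \<ge> 0" using XY k by auto
  ultimately have "real CARD('n) * X = 0" "k * Y = 0" by linarith+
  then have XY0: "X = 0" "Y = 0" using k by auto
  show d: "det A = l ^ CARD('n)" using t(2) XY0 by (simp add: X_def)
  have "(l ^ CARD('n)) powr (2 / CARD('n)) = l\<^sup>2"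
  proof -
    have "l ^ CARD('n) = l powr real CARD('n)" using *(2) by (rule powr_realpow[symmetric])
    then have "(l ^ CARD('n)) powr (2 / CARD('n)) = l powr 2" by (simp add: powr_powr)
    then show ?thesis using *(2) by simp
  qed
  then show "transpose A ** A = mat (l\<^sup>2)" using t(4) XY0 d by (simp add: Y_def)
qed

text \<open>d^(1 - \<alpha>/n) and \<open>h\<close> are replaced by their tangents at l^n. For
  d^(\<alpha>/n) the height above the tangent is kept, and so is a lower bound for the deficit in
  the AM-GM inequality for the positive powers; together they form \<open>excess\<close>. One
  \<open>k\<close> serves all \<open>A\<close>, so the linear term can be integrated.\<close>

lemma Psi_lower_bound:
  fixes l :: real
  assumes \<alpha>: "\<alpha> > real CARD('n)" and l: "l > 0"
    and h: "h C1_differentiable_on {0<..}" "convex_on {0<..} h"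
  obtains k where "\<And>A::real^'n^'n. det A > 0 \<Longrightarrow>
     Psi \<alpha> h (mat l :: real^'n^'n) + k * (det A - l ^ CARD('n)) + excess \<alpha> l A \<le> Psi \<alpha> h A"
proof -
  define n where "n = real CARD('n)"
  have n: "n \<ge> 1" by (simp add: n_def Suc_leI)
  define a where "a = \<alpha> / n"
  have a: "a > 1" using \<alpha> n by (simp add: n_def a_def)
  define d0 where "d0 = l ^ CARD('n)"
  have d0: "d0 > 0" using l by (simp add: d0_def)
  have ln: "d0 powr a = l powr \<alpha>" "d0 powr (1 - a) = d0 * l powr (-\<alpha>)"
  proof -
    have 1: "d0 = l powr n" using l by (simp add: d0_def n_def powr_realpow)
    then show e: "d0 powr a = l powr \<alpha>" using n by (simp add: powr_powr a_def)
    show "d0 powr (1 - a) = d0 * l powr (-\<alpha>)" using d0 by (simp add: powr_diff e powr_minus_divide)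
  qed
  obtain D where D: "\<And>x. x \<in> {0<..} \<Longrightarrow> (h has_vector_derivative D x) (at x)"
    using h(1) unfolding C1_differentiable_on_def by blast
  have hd: "(h has_real_derivative D d0) (at d0 within {0<..})"
    using D[of d0] d0 by (simp add: has_real_derivative_iff_has_vector_derivative has_vector_derivative_at_within)
  have htan: "h d0 + D d0 * (x - d0) \<le> h x" if "x > 0" for x
    using convex_on_imp_above_tangent[OF h(2) _ _ _ hd, of x] that d0 by (simp add: interior_open)
  \<comment> \<open>The derivative at \<open>d0\<close> of n d^a + n d^(1 - a) + h d;
    \<open>D d0\<close> is the derivative of \<open>h\<close> there.\<close>
  define k where "k = n * (d0 powr a * (a / d0)) + n * (d0 powr (1 - a) * ((1 - a) / d0)) + D d0"
  have "Psi \<alpha> h (mat l :: real^'n^'n) + k * (det A - l ^ CARD('n)) + excess \<alpha> l A \<le> Psi \<alpha> h A"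
    if A: "det A > 0" for A :: "real^'n^'n"
  proof -
    define d where "d = det A"
    have d: "d > 0" using A by (simp add: d_def)
    obtain P m where P: "orthogonal_matrix P" "transpose A ** A = P ** diag m ** transpose P" "\<And>i. 0 \<le> m i"
      and sv: "singular_values A = image_mset (\<lambda>i. sqrt (m i)) (mset_set UNIV)"
      using singular_values_diagonalization[of A] by blast
    have pm: "(\<Prod>i\<in>UNIV. m i) = d\<^sup>2" unfolding d_def by (rule prod_gram_eigenvalues[OF P])
    then have "(\<Prod>i\<in>UNIV. m i) \<noteq> 0" using d by simp
    then have m: "0 < m i" for i using P(3)[of i] by (auto simp: less_le)
    define v where "v i = sqrt (m i)" for i
    have v: "0 < v i" for i using m by (simp add: v_def)
    have pv: "(\<Prod>i\<in>UNIV. v i) = d"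
    proof -
      have "(\<Prod>i\<in>UNIV. v i)\<^sup>2 = d\<^sup>2"
        using pm P(3) by (simp add: v_def prod_power_distrib)
      moreover have "0 \<le> (\<Prod>i\<in>UNIV. v i)" using v less_imp_le by (intro prod_nonneg) blast
      ultimately show ?thesis using d by (simp add: power2_eq_iff_nonneg)
    qed
    have Psi: "Psi \<alpha> h A = (\<Sum>i\<in>UNIV. v i powr \<alpha>) + d * (\<Sum>i\<in>UNIV. v i powr (- \<alpha>)) + h d"
      using Psi_eq_sum[OF sv] by (simp add: d_def v_def)
    \<comment> \<open>Only the plain AM-GM inequality is used for the negative powers; its deficit
      is discarded.\<close>
    have low2: "n * d powr (1 - a) \<le> d * (\<Sum>i\<in>UNIV. v i powr (- \<alpha>))"
    proof -
      have "n * d powr (- a) \<le> (\<Sum>i\<in>UNIV. v i powr (- \<alpha>))"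
        using AM_GM_powr[of v "-\<alpha>", OF v] pv by (simp add: n_def a_def)
      from mult_left_mono[OF this, of d] d show ?thesis
        by (simp add: powr_diff powr_minus_divide mult.commute[of n])
    qed
    have low2': "n * (d0 powr (1 - a) * (1 + (1 - a) * (d / d0 - 1))) \<le> n * d powr (1 - a)"
    proof -
      have "d0 powr (1 - a) * (1 + (1 - a) * (d / d0 - 1)) \<le> d0 powr (1 - a) * (d / d0) powr (1 - a)"
        using powr_nonpos_above_tangent(1)[of "d/d0" "1-a"] a d d0 by (intro mult_left_mono) auto
      also have "\<dots> = d powr (1 - a)" using d d0 by (simp add: powr_mult[symmetric])
      finally show ?thesis using n by simp
    qed
    define c where "c = d powr (2 / n)"
    have c: "c > 0" using d by (simp add: c_def)
    have ca: "c powr (\<alpha> / 2) = d powr a" using n by (simp add: c_def powr_powr a_def)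
    have low1: "n * d powr a + \<alpha> / 2 * d powr a * ((norm A)\<^sup>2 / c - n) \<le> (\<Sum>i\<in>UNIV. v i powr \<alpha>)"
    proof -
      \<comment> \<open>The square of \<open>v i\<close> is \<open>m i\<close>; factoring out
        c^(\<alpha>/2) = d^a leaves powers of the normalised eigenvalues
        \<open>m i / c\<close>.\<close>
      have vi: "v i powr \<alpha> = d powr a * (m i / c) powr (\<alpha> / 2)" for i
      proof -
        have "v i powr \<alpha> = m i powr (\<alpha> / 2)"
          using m[of i] by (simp add: v_def powr_half_sqrt[symmetric] powr_powr)
        then show ?thesis using c m[of i] by (simp add: ca[symmetric] powr_divide)
      qed
      have sm: "(\<Sum>i\<in>UNIV. m i / c) = (norm A)\<^sup>2 / c"
        using sum_gram_eigenvalues[OF P] by (simp add: sum_divide_distrib[symmetric])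
      have key: "n + \<alpha> / 2 * ((norm A)\<^sup>2 / c - n) \<le> (\<Sum>i\<in>UNIV. (m i / c) powr (\<alpha> / 2))"
      proof (cases "CARD('n) = 1")
        case True
        then obtain i0 :: 'n where i0: "UNIV = {i0}" by (metis card_1_singletonE)
        have "n = 1" using True by (simp add: n_def)
        then have "c = d\<^sup>2" using d by (simp add: c_def)
        then have mc: "m i0 / c = 1" using pm d by (simp add: i0)
        have "(norm A)\<^sup>2 / c = 1" unfolding sm[symmetric] i0 by (simp only: sum.insert_if finite.intros empty_iff if_False sum.empty mc add_0_right)
        moreover have "(\<Sum>i\<in>UNIV. (m i / c) powr (\<alpha> / 2)) = 1" unfolding i0 by (simp add: mc del: divide_eq_1_iff)
        ultimately show ?thesis using \<open>n = 1\<close> by (simp only:) simp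
      next
        case False
        then have "CARD('n) \<ge> 2" using zero_less_card_finite[where 'a = 'n] by linarith
        then have "\<alpha> / 2 \<ge> 1" using \<alpha> by linarith
        then have "(\<Sum>i\<in>UNIV. 1 + \<alpha> / 2 * (m i / c - 1)) \<le> (\<Sum>i\<in>UNIV. (m i / c) powr (\<alpha> / 2))"
          using m c by (intro sum_mono powr_ge1_above_tangent) auto
        moreover have "(\<Sum>i\<in>UNIV. 1 + \<alpha> / 2 * (m i / c - 1)) = n + \<alpha> / 2 * ((norm A)\<^sup>2 / c - n)"
        proof -
          have "(\<Sum>i\<in>UNIV. 1 + \<alpha> / 2 * (m i / c - 1)) = (\<Sum>i\<in>(UNIV::'n set). 1) + \<alpha> / 2 * (\<Sum>i\<in>UNIV. m i / c - 1)"
            by (simp only: sum.distrib sum_distrib_left)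
          also have "(\<Sum>i\<in>UNIV. m i / c - 1) = (norm A)\<^sup>2 / c - n" by (simp only: sum_subtractf sm) (simp add: n_def)
          finally show ?thesis by (simp add: n_def)
        qed
        ultimately show ?thesis by simp
      qed
      have "d powr a * (n + \<alpha> / 2 * ((norm A)\<^sup>2 / c - n)) \<le> d powr a * (\<Sum>i\<in>UNIV. (m i / c) powr (\<alpha> / 2))"
        using key by (intro mult_left_mono) auto
      then show ?thesis by (simp add: vi sum_distrib_left algebra_simps)
    qed
    have ex: "excess \<alpha> l A = n * (d powr a - d0 powr a * (1 + a * (d / d0 - 1)))
        + \<alpha> / 2 * d powr a * ((norm A)\<^sup>2 / c - n)"
      by (simp add: excess_def det_gap_def n_def a_def d_def d0_def c_def)
    have Pl: "Psi \<alpha> h (mat l :: real^'n^'n) = n * d0 powr a + n * d0 powr (1 - a) + h d0"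
      using Psi_mat[OF l, of \<alpha> h, where 'n = 'n] ln by (simp add: n_def d0_def algebra_simps)
    have k: "k * (d - d0) = n * (d0 powr a * (a * (d / d0 - 1))) + n * (d0 powr (1 - a) * ((1 - a) * (d / d0 - 1))) + D d0 * (d - d0)"
    proof -
      have "(b / d0) * (d - d0) = b * (d / d0 - 1)" for b using d0 by (simp add: field_simps)
      then show ?thesis unfolding k_def by (simp only: distrib_right mult.assoc)
    qed
    have "Psi \<alpha> h (mat l :: real^'n^'n) + k * (d - d0) + excess \<alpha> l A
       = (n * d powr a + \<alpha> / 2 * d powr a * ((norm A)\<^sup>2 / c - n))
         + n * (d0 powr (1 - a) * (1 + (1 - a) * (d / d0 - 1))) + (h d0 + D d0 * (d - d0))"
      unfolding Pl k ex by (simp add: algebra_simps)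
    also have "\<dots> \<le> Psi \<alpha> h A"
      unfolding Psi using low1 order_trans[OF low2' low2] htan[OF d] by (intro add_mono)
    finally show ?thesis by (simp add: d_def d0_def)
  qed
  then show ?thesis by (rule that)
qed

section \<open>The theorem\<close>

lemma locally_integrable_continuous:
  fixes f :: "real^'n::finite \<Rightarrow> 'b::euclidean_space"
  assumes "continuous_on UNIV f"
  shows "locally_integrable \<Omega> f"
  unfolding locally_integrable_def
proof (intro allI impI)
  fix K assume K: "compact K \<and> K \<subseteq> \<Omega>"
  then have "integrable lborel (\<lambda>x. indicator K x *\<^sub>R f x)"
    by (intro borel_integrable_compact continuous_on_subset[OF assms]) auto
  then have "integrable lebesgue (\<lambda>x. indicator K x *\<^sub>R f x)" by (simp add: integrable_completion)
  moreover have "K \<in> sets lebesgue" using K by (simp add: lmeasurable_compact fmeasurableD)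
  ultimately show "integrable (lebesgue_on K) f" by (simp add: integrable_restrict_space)
qed

lemma in_Lp_continuous_bounded:
  fixes f :: "real^'n::finite \<Rightarrow> 'b::euclidean_space"
  assumes f: "continuous_on UNIV f" and \<Omega>: "\<Omega> \<in> lmeasurable" "bounded \<Omega>" and p: "0 \<le> p"
  shows "in_Lp p \<Omega> f"
proof -
  have \<Omega>s: "\<Omega> \<in> sets lebesgue" using \<Omega> by auto
  have m: "f \<in> borel_measurable (lebesgue_on \<Omega>)"
    by (intro continuous_imp_measurable_on_sets_lebesgue continuous_on_subset[OF f] \<Omega>s) auto
  have "compact (f ` closure \<Omega>)"
    using \<Omega>(2) by (intro compact_continuous_image continuous_on_subset[OF f]) auto
  then obtain B where B: "\<And>x. x \<in> closure \<Omega> \<Longrightarrow> norm (f x) \<le> B"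
    using compact_imp_bounded by (metis bounded_iff imageI)
  have "integrable (lebesgue_on \<Omega>) (\<lambda>x. norm (f x) powr p)"
  proof (rule finite_measure.integrable_const_bound[OF finite_measure_lebesgue_on[OF \<Omega>(1)], where B = "B powr p"])
    show "AE x in lebesgue_on \<Omega>. norm (norm (f x) powr p) \<le> B powr p"
    proof (intro AE_I2)
      fix x assume "x \<in> space (lebesgue_on \<Omega>)"
      then have "norm (f x) \<le> B" using B closure_subset[of \<Omega>] by auto
      then show "norm (norm (f x) powr p) \<le> B powr p" using p by (simp add: powr_mono2)
    qed
    show "(\<lambda>x. norm (f x) powr p) \<in> borel_measurable (lebesgue_on \<Omega>)" using m by measurable
  qed
  then show ?thesis using m by (simp add: in_Lp_def)
qed

lemma has_weak_gradient_scaling: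
  fixes \<Omega> :: "(real^'n::finite) set"
  assumes "\<Omega> \<in> sets lebesgue"
  shows "has_weak_gradient \<Omega> (\<lambda>x. c *\<^sub>R x) (\<lambda>x. mat c)"
  unfolding has_weak_gradient_def
proof (intro conjI allI impI)
  show "locally_integrable \<Omega> (\<lambda>x. c *\<^sub>R x)" "locally_integrable \<Omega> (\<lambda>x. mat c :: real^'n^'n)"
    by (intro locally_integrable_continuous continuous_intros)+
  fix \<phi> :: "real^'n \<Rightarrow> real" and i j assume "test_function \<Omega> \<phi>"
  then have "(LINT x|lebesgue_on \<Omega>. ((c *\<^sub>R axis i 1) \<bullet> x + 0) * partial_deriv j \<phi> x)
     = - (LINT x|lebesgue_on \<Omega>. (c *\<^sub>R axis i 1) $ j * \<phi> x)"
    using weak_grad_affine[OF assms, of "c *\<^sub>R axis i 1" 0] unfolding weak_grad_def by blast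
  moreover have "(c *\<^sub>R axis i 1) \<bullet> x + 0 = (c *\<^sub>R x) $ i" for x :: "real^'n" by (simp add: inner_axis')
  moreover have "(c *\<^sub>R axis i 1 :: real^'n) $ j = (mat c :: real^'n^'n) $ i $ j" by (simp add: axis_def mat_def)
  ultimately show "(LINT x|lebesgue_on \<Omega>. (c *\<^sub>R x) $ i * partial_deriv j \<phi> x) = - (LINT x|lebesgue_on \<Omega>. (mat c :: real^'n^'n) $ i $ j * \<phi> x)"
    by (simp only:)
qed

lemma in_W1p_scaling:
  fixes \<Omega> :: "(real^'n::finite) set"
  assumes \<Omega>: "\<Omega> \<in> lmeasurable" "bounded \<Omega>" and p: "0 \<le> p"
  shows "in_W1p p \<Omega> (\<lambda>x. c *\<^sub>R x)"
  unfolding in_W1p_def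
proof
  show "in_Lp p \<Omega> (\<lambda>x. c *\<^sub>R x)" by (intro in_Lp_continuous_bounded \<Omega> p continuous_intros)
  have "in_Lp p \<Omega> (\<lambda>x. mat c :: real^'n^'n)" by (intro in_Lp_continuous_bounded \<Omega> p continuous_intros)
  moreover have "has_weak_gradient \<Omega> (\<lambda>x. c *\<^sub>R x) (\<lambda>x. mat c)"
    using \<Omega>(1) by (intro has_weak_gradient_scaling) auto
  ultimately show "\<exists>G. has_weak_gradient \<Omega> (\<lambda>x. c *\<^sub>R x) G \<and> in_Lp p \<Omega> G" by blast
qed

lemma AE_weak_gradient_eq:
  fixes y :: "real^'n::finite \<Rightarrow> real^'k::finite"
  assumes "open \<Omega>" "has_weak_gradient \<Omega> y G"
  shows "AE x in lebesgue_on \<Omega>. weak_gradient \<Omega> y x = G x"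
proof -
  have "has_weak_gradient \<Omega> y (weak_gradient \<Omega> y)"
    unfolding weak_gradient_def by (rule someI[of _ G]) (rule assms(2))
  then show ?thesis using weak_gradient_unique[OF assms(1) _ assms(2)] by blast
qed

lemma orientation_preserving_invertible_scaling:
  fixes \<Omega> :: "(real^'n::finite) set"
  assumes \<Omega>: "open \<Omega>" "bounded \<Omega>" and p: "0 \<le> p" and l: "0 < l"
  shows "orientation_preserving_invertible p \<Omega> ((\<lambda>x. l *\<^sub>R x) ` \<Omega>) (\<lambda>x. l *\<^sub>R x)"
  unfolding orientation_preserving_invertible_def
proof (intro conjI exI)
  show "homeomorphism \<Omega> ((\<lambda>x. l *\<^sub>R x) ` \<Omega>) (\<lambda>x. l *\<^sub>R x) (\<lambda>x. (1 / l) *\<^sub>R x)"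
    using l by (intro homeomorphismI continuous_intros) auto
  show "in_W1p p \<Omega> (\<lambda>x. l *\<^sub>R x)"
    using \<Omega> by (intro in_W1p_scaling lmeasurable_open p)
  have "open ((\<lambda>x. l *\<^sub>R x) ` \<Omega>)" "bounded ((\<lambda>x. l *\<^sub>R x) ` \<Omega>)"
    using \<Omega> l by (auto intro: open_scaling bounded_scaling)
  then show "in_W1p p ((\<lambda>x. l *\<^sub>R x) ` \<Omega>) (\<lambda>x. (1 / l) *\<^sub>R x)"
    by (intro in_W1p_scaling lmeasurable_open p)
  have "\<Omega> \<in> sets lebesgue" using \<Omega>(1) by auto
  from AE_weak_gradient_eq[OF \<Omega>(1) has_weak_gradient_scaling[OF this, of l]]
  show "AE x in lebesgue_on \<Omega>. det (weak_gradient \<Omega> (\<lambda>x. l *\<^sub>R x) x) > 0"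
    by eventually_elim (simp add: det_mat l)
qed

text \<open>\<open>nn_integral\<close> is monotone on arbitrary functions. The energy can therefore
  be bounded below by the integral of a measurable minorant without examining the measurability of
  the energy density, and the value \<infinity> is covered.\<close>

lemma ext_integral_mono_AE:
  assumes "AE x in M. g x \<le> f x"
  shows "ext_integral M g \<le> ext_integral M f"
  unfolding ext_integral_def
proof (rule ereal_minus_mono)
  have "(\<integral>\<^sup>+ x. ennreal (g x) \<partial>M) \<le> (\<integral>\<^sup>+ x. ennreal (f x) \<partial>M)"
    by (rule nn_integral_mono_AE) (use assms in \<open>auto elim!: eventually_mono intro: ennreal_leI\<close>)
  then show "enn2ereal (\<integral>\<^sup>+ x. ennreal (g x) \<partial>M) \<le> enn2ereal (\<integral>\<^sup>+ x. ennreal (f x) \<partial>M)"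
    by (simp add: less_eq_ennreal.rep_eq)
  have "(\<integral>\<^sup>+ x. ennreal (- f x) \<partial>M) \<le> (\<integral>\<^sup>+ x. ennreal (- g x) \<partial>M)"
    by (rule nn_integral_mono_AE) (use assms in \<open>auto elim!: eventually_mono intro: ennreal_leI\<close>)
  then show "enn2ereal (\<integral>\<^sup>+ x. ennreal (- f x) \<partial>M) \<le> enn2ereal (\<integral>\<^sup>+ x. ennreal (- g x) \<partial>M)"
    by (simp add: less_eq_ennreal.rep_eq)
qed

lemma ext_integral_cong_AE:
  assumes "AE x in M. g x = f x"
  shows "ext_integral M g = ext_integral M f"
  by (intro antisym ext_integral_mono_AE eventually_mono[OF assms]) simp_all

lemma ext_integral_eq_integral:
  assumes "integrable M g"
  shows "ext_integral M g = ereal (LINT x|M. g x)"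
proof -
  have fin: "(\<integral>\<^sup>+ x. ennreal (g x) \<partial>M) \<noteq> top" "(\<integral>\<^sup>+ x. ennreal (- g x) \<partial>M) \<noteq> top"
    using assms unfolding real_integrable_def by auto
  obtain a where a: "0 \<le> a" "(\<integral>\<^sup>+ x. ennreal (g x) \<partial>M) = ennreal a"
    using fin(1) by (cases "\<integral>\<^sup>+ x. ennreal (g x) \<partial>M" rule: ennreal_cases) auto
  obtain b where b: "0 \<le> b" "(\<integral>\<^sup>+ x. ennreal (- g x) \<partial>M) = ennreal b"
    using fin(2) by (cases "\<integral>\<^sup>+ x. ennreal (- g x) \<partial>M" rule: ennreal_cases) auto
  have "(LINT x|M. g x) = a - b"
    using real_lebesgue_integral_def[OF assms] a b by simp
  then show ?thesis
    unfolding ext_integral_def using a b by (simp add: enn2ereal_ennreal)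
qed

text \<open>The integrable minorant \<open>g + e\<close> consists of the tangent \<open>g\<close>,
  whose integral is the value at the magnification because the integral of det Dy is fixed, and a
  nonnegative remainder \<open>e\<close>. Equality of the energies makes the integral of
  \<open>e\<close> vanish, which leads to the hypotheses of the rigidity theorem.\<close>

lemma energy_lower_bound:
  fixes \<alpha> p l :: real and \<Omega>1 \<Omega>2 :: "(real^'n::finite) set" and c1 c2 :: "real^'n \<Rightarrow> real^'m::finite"
  assumes \<alpha>: "\<alpha> > real CARD('n)" and p: "p > real CARD('n)" and l: "l > 0"
    and h: "h C1_differentiable_on {0<..}" "convex_on {0<..} h"
    and \<Omega>: "open \<Omega>1" "bounded \<Omega>1" "connected \<Omega>1" "\<Omega>1 \<noteq> {}" and \<Omega>2: "\<Omega>2 = (\<lambda>x. l *\<^sub>R x) ` \<Omega>1"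
    and y: "orientation_preserving_invertible p \<Omega>1 \<Omega>2 y"
  defines "E \<equiv> energy (psi \<alpha> h) (\<Omega>1, c1) (\<Omega>2, c2) y"
    and "E0 \<equiv> ext_integral (lebesgue_on \<Omega>1) (\<lambda>x. Psi \<alpha> h (mat l :: real^'n^'n))"
  shows "E0 \<le> E"
    and "E = E0 \<Longrightarrow> \<exists>a R. rotation_matrix R \<and> (\<lambda>x. a + l *\<^sub>R (R *v x)) ` \<Omega>1 = \<Omega>2 \<and>
             (\<forall>x\<in>\<Omega>1. y x = a + l *\<^sub>R (R *v x))"
proof -
  let ?M = "lebesgue_on \<Omega>1"
  have \<Omega>m: "\<Omega>1 \<in> lmeasurable" "\<Omega>1 \<in> sets lebesgue" using \<Omega>(1,2) by (auto simp: lmeasurable_open)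
  have p0: "0 \<le> p" using p by (meson less_le_not_le of_nat_0_le_iff order_trans)
  obtain z where hom: "homeomorphism \<Omega>1 \<Omega>2 y z" and W: "in_W1p p \<Omega>1 y"
    and pos: "AE x in ?M. det (weak_gradient \<Omega>1 y x) > 0"
    using y unfolding orientation_preserving_invertible_def by blast
  obtain G where G: "has_weak_gradient \<Omega>1 y G" "in_Lp p \<Omega>1 G" using W unfolding in_W1p_def by blast
  have WG: "AE x in ?M. weak_gradient \<Omega>1 y x = G x" by (rule AE_weak_gradient_eq[OF \<Omega>(1) G(1)])
  have Gpos: "AE x in ?M. det (G x) > 0" using pos WG by eventually_elim simp
  have yc: "continuous_on \<Omega>1 y" and yim: "y ` \<Omega>1 = \<Omega>2" and inj: "inj_on y \<Omega>1"
    using hom by (auto simp: homeomorphism_def inj_on_def) metis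
  have b2: "bounded \<Omega>2" unfolding \<Omega>2 by (rule bounded_scaling[OF \<Omega>(2)])
  note A = \<Omega>(1,2) yc G p
  have area: "integrable ?M (\<lambda>x. \<bar>det (G x)\<bar>)" "(LINT x|?M. \<bar>det (G x)\<bar>) = measure lebesgue \<Omega>2"
    using area_formula_W1p(1,2)[OF A inj _ \<Omega>m(2) subset_refl] b2 by (auto simp: yim)
  \<comment> \<open>The volume of the magnified domain comes from the area formula applied to the
    magnification itself.\<close>
  have "measure lebesgue \<Omega>2 = l ^ CARD('n) * measure lebesgue \<Omega>1"
  proof -
    have "continuous_on \<Omega>1 (\<lambda>x. l *\<^sub>R x)" "inj_on (\<lambda>x. l *\<^sub>R x) \<Omega>1"
      using l by (auto intro!: continuous_intros simp: inj_on_def)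
    moreover have "in_Lp p \<Omega>1 (\<lambda>x. mat l :: real^'n^'n)"
      by (intro in_Lp_continuous_bounded \<Omega>m \<Omega> p0 continuous_intros)
    ultimately have "(LINT x|?M. \<bar>det (mat l :: real^'n^'n)\<bar>) = measure lebesgue ((\<lambda>x. l *\<^sub>R x) ` \<Omega>1)"
      using area_formula_W1p(2)[OF \<Omega>(1,2) _ has_weak_gradient_scaling[OF \<Omega>m(2), of l] _ p _ _ \<Omega>m(2) subset_refl] b2
      by (simp add: \<Omega>2)
    then show ?thesis using l \<Omega>m by (simp add: \<Omega>2 det_mat measure_restrict_space mult.commute)
  qed
  note area2 = area(2)[unfolded this]
  have Gm: "G \<in> borel_measurable ?M" using G(2) by (simp add: in_Lp_def)
  note dm = borel_measurable_det[OF Gm]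
  have dI: "integrable ?M (\<lambda>x. det (G x))"
    by (rule integrable_cong_AE_imp[OF area(1) dm]) (use Gpos in \<open>auto elim!: eventually_mono\<close>)
  have dL: "(LINT x|?M. det (G x)) = l ^ CARD('n) * measure lebesgue \<Omega>1"
    unfolding area2[symmetric] by (rule integral_cong_AE) (use Gpos dm in \<open>auto elim!: eventually_mono\<close>)
  obtain k where k: "\<And>A::real^'n^'n. det A > 0 \<Longrightarrow>
     Psi \<alpha> h (mat l :: real^'n^'n) + k * (det A - l ^ CARD('n)) + excess \<alpha> l A \<le> Psi \<alpha> h A"
    using Psi_lower_bound[OF \<alpha> l h] by blast
  define C0 where "C0 = Psi \<alpha> h (mat l :: real^'n^'n)"
  define g where "g x = C0 + k * (det (G x) - l ^ CARD('n))" for x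
  \<comment> \<open>Truncation at 1 makes the remainder integrable without any bound on
    \<open>excess\<close>, and at 0 it makes it nonnegative also on the null set where det G is not
    positive; its zeros where det G > 0 are those of \<open>excess\<close>.\<close>
  define e where "e x = max 0 (min (excess \<alpha> l (G x)) 1)" for x
  define f where "f x = psi \<alpha> h (c1 x) (c2 (y x)) (weak_gradient \<Omega>1 y x)" for x
  have c: "integrable ?M (\<lambda>x. c)" for c :: real
    by (intro finite_measure.integrable_const finite_measure_lebesgue_on \<Omega>m)
  have gI: "integrable ?M g"
    unfolding g_def by (intro Bochner_Integration.integrable_add integrable_mult_right Bochner_Integration.integrable_diff dI c)
  have gL: "(LINT x|?M. g x) = C0 * measure lebesgue \<Omega>1"
    unfolding g_def using dI c dL \<Omega>m
    by (subst Bochner_Integration.integral_add) (auto simp: measure_restrict_space)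
  have em: "(\<lambda>x. excess \<alpha> l (G x)) \<in> borel_measurable ?M"
    unfolding excess_def det_gap_def using dm Gm by measurable
  have eI: "integrable ?M e"
    by (rule finite_measure.integrable_const_bound[OF finite_measure_lebesgue_on[OF \<Omega>m(1)], where B = 1])
       (use em in \<open>auto simp: e_def[abs_def]\<close>)
  have fge: "AE x in ?M. g x + e x \<le> f x"
    using Gpos WG
  proof eventually_elim
    case (elim x)
    have "e x \<le> excess \<alpha> l (G x)" using excess_nonneg[OF \<alpha> l elim(1)] by (simp add: e_def)
    moreover have "g x + excess \<alpha> l (G x) \<le> Psi \<alpha> h (G x)" using k[OF elim(1)] by (simp add: g_def C0_def)
    \<comment> \<open>The intensity term is nonnegative as 1 + det G > 0, so it may be dropped here;
      along the magnification it is zero.\<close>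
    moreover have "Psi \<alpha> h (G x) \<le> f x" using elim by (simp add: f_def psi_def)
    ultimately show ?case by linarith
  qed
  have E0: "E0 = ereal (C0 * measure lebesgue \<Omega>1)"
    unfolding E0_def C0_def[symmetric] using ext_integral_eq_integral[OF c] \<Omega>m by (simp add: measure_restrict_space)
  have E: "E = ext_integral ?M f" by (simp add: E_def energy_def f_def[abs_def])
  have low: "ereal (C0 * measure lebesgue \<Omega>1 + (LINT x|?M. e x)) \<le> E"
  proof -
    have "ext_integral ?M (\<lambda>x. g x + e x) \<le> E" unfolding E by (rule ext_integral_mono_AE[OF fge])
    then show ?thesis
      using ext_integral_eq_integral[OF Bochner_Integration.integrable_add[OF gI eI]] gI eI by (simp add: gL)
  qed
  have e0: "0 \<le> (LINT x|?M. e x)" by (rule integral_nonneg_AE) (simp add: e_def)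
  show "E0 \<le> E" using low e0 unfolding E0 by (meson ereal_less_eq(3) le_add_same_cancel1 order_trans)
  assume "E = E0"
  then have "(LINT x|?M. e x) \<le> 0" using low by (simp add: E0)
  then have "(LINT x|?M. e x) = 0" using e0 by simp
  then have "AE x in ?M. e x = 0"
    by (subst (asm) integral_nonneg_eq_0_iff_AE[OF eI]) (auto simp: e_def)
  then have "AE x in ?M. transpose (G x) ** G x = mat (l\<^sup>2) \<and> det (G x) = l ^ CARD('n)"
    using Gpos
  proof eventually_elim
    case (elim x)
    have "excess \<alpha> l (G x) = 0" using elim(1) excess_nonneg[OF \<alpha> l elim(2)] by (auto simp: e_def max_def min_def split: if_splits)
    then show ?case using excess_eq_0[OF \<alpha> l elim(2)] by blast
  qed
  then obtain a R where aR: "rotation_matrix R" "\<forall>x\<in>\<Omega>1. y x = a + l *\<^sub>R (R *v x)"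
    using conformal_homeomorphism_rigidity[OF \<Omega> yc G p inj _ l] b2 yim by auto
  have "(\<lambda>x. a + l *\<^sub>R (R *v x)) ` \<Omega>1 = y ` \<Omega>1" using aR(2) by (intro image_cong) auto
  then show "\<exists>a R. rotation_matrix R \<and> (\<lambda>x. a + l *\<^sub>R (R *v x)) ` \<Omega>1 = \<Omega>2 \<and>
             (\<forall>x\<in>\<Omega>1. y x = a + l *\<^sub>R (R *v x))"
    using aR yim by blast
qed

text \<open>Intensities match pointwise along the magnification, so of \<open>psi\<close> only the
  term \<open>Psi\<close> at the constant gradient remains.\<close>

lemma energy_scaling:
  fixes \<Omega>1 \<Omega>2 :: "(real^'n::finite) set" and c1 c2 :: "real^'n \<Rightarrow> real^'m::finite"
  assumes \<Omega>: "open \<Omega>1" and c: "\<And>x. x \<in> \<Omega>1 \<Longrightarrow> c2 (l *\<^sub>R x) = c1 x"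
  shows "energy (psi \<alpha> h) (\<Omega>1, c1) (\<Omega>2, c2) (\<lambda>x. l *\<^sub>R x)
    = ext_integral (lebesgue_on \<Omega>1) (\<lambda>x. Psi \<alpha> h (mat l :: real^'n^'n))"
proof -
  have s: "\<Omega>1 \<in> sets lebesgue" using \<Omega> by auto
  have "AE x in lebesgue_on \<Omega>1. x \<in> \<Omega>1" using s by (auto intro!: AE_I2)
  then have "AE x in lebesgue_on \<Omega>1. psi \<alpha> h (c1 x) (c2 (l *\<^sub>R x)) (weak_gradient \<Omega>1 (\<lambda>x. l *\<^sub>R x) x)
     = Psi \<alpha> h (mat l :: real^'n^'n)"
    using AE_weak_gradient_eq[OF \<Omega> has_weak_gradient_scaling[OF s, of l]]
    by eventually_elim (simp add: psi_def c)
  then show ?thesis by (simp add: energy_def) (rule ext_integral_cong_AE)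
qed

theorem mainTheorem3:
  fixes \<alpha> p l :: real and h :: "real \<Rightarrow> real"
    and \<Omega>1 \<Omega>2 :: "(real^'n) set" and c1 c2 :: "real^'n \<Rightarrow> real^'m"
  assumes "\<alpha> > real CARD('n)"
    and "p > real CARD('n)"
    and "h C1_differentiable_on {0<..}"
    and "convex_on {0<..} h"
    and "bdd_below (h ` {0<..})"
    and "\<And>\<delta>. \<delta> > 0 \<Longrightarrow> h \<delta> = \<delta> * h (inverse \<delta>)"
    and "deriv h 1 = - real CARD('n)"
    and "l > 0"
    and "is_image (\<Omega>1, c1)"
    and "is_image (\<Omega>2, c2)"
    and "magnification_related l (\<Omega>1, c1) (\<Omega>2, c2)"
  shows "(\<forall>y. orientation_preserving_invertible p \<Omega>1 \<Omega>2 y \<longrightarrow>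
            energy (psi \<alpha> h) (\<Omega>1, c1) (\<Omega>2, c2) y
              \<ge> ext_integral (lebesgue_on \<Omega>1) (\<lambda>x. Psi \<alpha> h (mat l :: real^'n^'n)))
    \<and> ext_integral (lebesgue_on \<Omega>1) (\<lambda>x. Psi \<alpha> h (mat l :: real^'n^'n))
        = energy (psi \<alpha> h) (\<Omega>1, c1) (\<Omega>2, c2) (\<lambda>x. l *\<^sub>R x)
    \<and> is_minimizer (psi \<alpha> h) p (\<Omega>1, c1) (\<Omega>2, c2) (\<lambda>x. l *\<^sub>R x)
    \<and> (\<forall>y. orientation_preserving_invertible p \<Omega>1 \<Omega>2 y \<longrightarrow>
          energy (psi \<alpha> h) (\<Omega>1, c1) (\<Omega>2, c2) y
            = ext_integral (lebesgue_on \<Omega>1) (\<lambda>x. Psi \<alpha> h (mat l :: real^'n^'n)) \<longrightarrow>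
          (\<exists>a R. rotation_matrix R \<and> (\<lambda>x. a + l *\<^sub>R (R *v x)) ` \<Omega>1 = \<Omega>2 \<and>
             (\<forall>x\<in>\<Omega>1. y x = a + l *\<^sub>R (R *v x))))
    \<and> ((\<forall>a (R :: real^'n^'n). rotation_matrix R \<and> (\<lambda>x. a + l *\<^sub>R (R *v x)) ` \<Omega>1 = \<Omega>2 \<longrightarrow>
            a = 0 \<and> R = mat 1) \<longrightarrow>
         (\<forall>y. is_minimizer (psi \<alpha> h) p (\<Omega>1, c1) (\<Omega>2, c2) y \<longrightarrow> (\<forall>x\<in>\<Omega>1. y x = l *\<^sub>R x)))"
proof -
  have \<Omega>: "open \<Omega>1" "bounded \<Omega>1" "connected \<Omega>1" "\<Omega>1 \<noteq> {}"
    using assms(9) by (auto simp: is_image_def bounded_lipschitz_domain_def)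
  have \<Omega>2: "\<Omega>2 = (\<lambda>x. l *\<^sub>R x) ` \<Omega>1" and c: "\<And>x. x \<in> \<Omega>1 \<Longrightarrow> c2 (l *\<^sub>R x) = c1 x"
    using assms(11) by (auto simp: magnification_related_def)
  have p0: "0 \<le> p" using assms(2) by (meson less_le_not_le of_nat_0_le_iff order_trans)
  let ?E = "energy (psi \<alpha> h) (\<Omega>1, c1) (\<Omega>2, c2)"
  let ?low = "ext_integral (lebesgue_on \<Omega>1) (\<lambda>x. Psi \<alpha> h (mat l :: real^'n^'n))"
  let ?adm = "orientation_preserving_invertible p \<Omega>1 \<Omega>2"
  let ?aff = "\<lambda>y. \<exists>a R. rotation_matrix R \<and> (\<lambda>x. a + l *\<^sub>R (R *v x)) ` \<Omega>1 = \<Omega>2 \<and>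
             (\<forall>x\<in>\<Omega>1. y x = a + l *\<^sub>R (R *v x))"
  have low: "?low \<le> ?E y" if "?adm y" for y
    by (rule energy_lower_bound(1)[OF assms(1,2,8,3,4) \<Omega> \<Omega>2 that])
  have rigid: "?aff y" if "?adm y" "?E y = ?low" for y
    by (rule energy_lower_bound(2)[OF assms(1,2,8,3,4) \<Omega> \<Omega>2 that])
  have scal: "?E (\<lambda>x. l *\<^sub>R x) = ?low" by (rule energy_scaling[OF \<Omega>(1)]) (rule c)
  have adm: "?adm (\<lambda>x. l *\<^sub>R x)"
    unfolding \<Omega>2 by (rule orientation_preserving_invertible_scaling[OF \<Omega>(1,2) p0 assms(8)])
  have min: "is_minimizer (psi \<alpha> h) p (\<Omega>1, c1) (\<Omega>2, c2) (\<lambda>x. l *\<^sub>R x)"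
    unfolding is_minimizer_def fst_conv scal using adm low by blast
  have uniq: "y x = l *\<^sub>R x"
    if id: "\<forall>a (R :: real^'n^'n). rotation_matrix R \<and> (\<lambda>x. a + l *\<^sub>R (R *v x)) ` \<Omega>1 = \<Omega>2 \<longrightarrow> a = 0 \<and> R = mat 1"
      and y: "is_minimizer (psi \<alpha> h) p (\<Omega>1, c1) (\<Omega>2, c2) y" and x: "x \<in> \<Omega>1" for y x
  proof -
    have y': "?adm y" "?E y \<le> ?low"
      using y adm scal unfolding is_minimizer_def fst_conv by metis+
    then have "?E y = ?low" using low by (simp add: antisym)
    from rigid[OF y'(1) this] obtain a R where aR: "rotation_matrix R" "(\<lambda>x. a + l *\<^sub>R (R *v x)) ` \<Omega>1 = \<Omega>2"
      "\<forall>x\<in>\<Omega>1. y x = a + l *\<^sub>R (R *v x)" by blast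
    then have "a = 0" "R = mat 1" using id by blast+
    then show ?thesis using aR(3) x by simp
  qed
  show ?thesis
  proof (intro conjI)
    show "\<forall>y. ?adm y \<longrightarrow> ?low \<le> ?E y" using low by blast
    show "?low = ?E (\<lambda>x. l *\<^sub>R x)" by (rule scal[symmetric])
    show "\<forall>y. ?adm y \<longrightarrow> ?E y = ?low \<longrightarrow> ?aff y" using rigid by blast
    show "(\<forall>a (R :: real^'n^'n). rotation_matrix R \<and> (\<lambda>x. a + l *\<^sub>R (R *v x)) ` \<Omega>1 = \<Omega>2 \<longrightarrow> a = 0 \<and> R = mat 1) \<longrightarrow>
         (\<forall>y. is_minimizer (psi \<alpha> h) p (\<Omega>1, c1) (\<Omega>2, c2) y \<longrightarrow> (\<forall>x\<in>\<Omega>1. y x = l *\<^sub>R x))"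
      using uniq by blast
  qed (rule min)
qed

end
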